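(* Let $R$ be a unital commutative associative ring with $2\in R^\times$. Let $T,T'$ be projective $R$-modules of constant rank $3$ with isomorphisms $\alpha:\bigwedge^3(T)\to R$ and $\alpha':\bigwedge^3(T')\to R$, and let $\beta:\bigwedge^3(\check T)\to R$ be the isomorphism determined by $\alpha$. If $\varphi:(T,\alpha)\to(T',\alpha')$ is a morphism, then the map $$\begin{bmatrix} a & u\\ \check u & a\end{bmatrix}\mapsto \begin{bmatrix} a & \varphi(u)\\ \check\varphi^{-1}(\check u) & a\end{bmatrix}$$ is an isomorphism of split colour algebras ${\rm Col}(T,\alpha)\cong{\rm Col}(T',\alpha')$, and the map $$\begin{bmatrix} a & u\\ \check u & a\end{bmatrix}\mapsto \begin{bmatrix} a & -\check u\\ -u & a\end{bmatrix}$$ is an isomorphism of split colour algebras ${\rm Col}(T,\alpha)\cong{\rm Col}(\check T,\beta)$.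
   Context: For a projective $R$-module $T$ of constant rank $3$, write $\check T={\rm Hom}_R(T,R)$ and $\langle u,\check v\rangle=\check v(u)$ for $u\in T,\check v\in\check T$; the dual of $\check T$ is identified with $T$ via this pairing. An isomorphism $\alpha:\bigwedge^3(T)\to R$ induces a vector product $T\times T\to\check T$, $u\times v=\alpha(u\wedge v\wedge -)$. It also determines an isomorphism $\beta:\bigwedge^3(\check T)\to R$ by $\alpha(u_1\wedge u_2\wedge u_3)\,\beta(\check u_1\wedge\check u_2\wedge\check u_3)=\det(\langle u_i,\check u_j\rangle)$ for all $u_i\in T$, $\check u_j\in\check T$, and hence a vector product $\check T\times\check T\to T$, $\check u\times\check v=\beta(\check u\wedge\check v\wedge -)$. The split colour algebra ${\rm Col}(T,\alpha)$ is the $R$-module $\left\{\begin{bmatrix} a&u\\ \check u&a\end{bmatrix} : a\in R,\ u\in T,\ \check u\in\check T\right\}\cong R\oplus T\oplus\check T$ with multiplication $$\begin{bmatrix} a&u\\ \check u&a\end{bmatrix}\begin{bmatrix} b&v\\ \check v&b\end{bmatrix}=\begin{bmatrix} ab+\langle u,\check v\rangle+\langle v,\check u\rangle & av+bu-\check u\times\check v\\ b\check u+a\check v+u\times v & ab+\langle u,\check v\rangle+\langle v,\check u\rangle\end{bmatrix}.$$ A morphism $\varphi:(T,\alpha)\to(T',\alpha')$ is an $R$-linear map $\varphi:T\to T'$ with $\alpha'\circ\det(\varphi)=\alpha$, where $\det(\varphi)=\bigwedge^3\varphi$; such a map is bijective. $\check\varphi:\check T'\to\check T$ denotes the dual map of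 $\varphi$, and $\check\varphi^{-1}:\check T\to\check T'$ its inverse. *)

theory Defs
  imports "HOL-Algebra.Module" "HOL-Algebra.QuotRing" "HOL-Combinatorics.Permutations"
begin

section \<open>Modules over a commutative ring\<close>

text \<open>
  A module record extends a ring record. For the modules below that carry no multiplication the
  fields \<open>mult\<close> and \<open>one\<close> are left \<open>undefined\<close>.
\<close>

definition lin_maps ::
  "('a, 'm) ring_scheme \<Rightarrow> ('a, 'b, 'p) module_scheme \<Rightarrow> ('a, 'c, 'q) module_scheme \<Rightarrow> ('b \<Rightarrow> 'c) set"
  where "lin_maps R M N = {h \<in> carrier M \<rightarrow> carrier N.
     (\<forall>x\<in>carrier M. \<forall>y\<in>carrier M. h (x \<oplus>\<^bsub>M\<^esub> y) = h x \<oplus>\<^bsub>N\<^esub> h y) \<and>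
     (\<forall>r\<in>carrier R. \<forall>x\<in>carrier M. h (r \<odot>\<^bsub>M\<^esub> x) = r \<odot>\<^bsub>N\<^esub> h x)}"

definition lin_isos ::
  "('a, 'm) ring_scheme \<Rightarrow> ('a, 'b, 'p) module_scheme \<Rightarrow> ('a, 'c, 'q) module_scheme \<Rightarrow> ('b \<Rightarrow> 'c) set"
  where "lin_isos R M N = {h \<in> lin_maps R M N. bij_betw h (carrier M) (carrier N)}"

definition reg_module :: "('a, 'm) ring_scheme \<Rightarrow> ('a, 'a) module"
  where "reg_module R = \<lparr>carrier = carrier R, monoid.mult = monoid.mult R, one = \<one>\<^bsub>R\<^esub>,
     zero = \<zero>\<^bsub>R\<^esub>, add = add R, smult = monoid.mult R\<rparr>"

definition free_module :: "('a, 'm) ring_scheme \<Rightarrow> 'x set \<Rightarrow> ('a, 'x \<Rightarrow> 'a) module"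
  where "free_module R X =
    \<lparr>carrier = {f \<in> X \<rightarrow>\<^sub>E carrier R. finite {x \<in> X. f x \<noteq> \<zero>\<^bsub>R\<^esub>}},
     monoid.mult = undefined, one = undefined,
     zero = (\<lambda>x\<in>X. \<zero>\<^bsub>R\<^esub>),
     add = (\<lambda>f g. \<lambda>x\<in>X. f x \<oplus>\<^bsub>R\<^esub> g x),
     smult = (\<lambda>r f. \<lambda>x\<in>X. r \<otimes>\<^bsub>R\<^esub> f x)\<rparr>"

definition free_gen :: "('a, 'm) ring_scheme \<Rightarrow> 'x set \<Rightarrow> 'x \<Rightarrow> 'x \<Rightarrow> 'a"
  where "free_gen R X x = (\<lambda>y\<in>X. if y = x then \<one>\<^bsub>R\<^esub> else \<zero>\<^bsub>R\<^esub>)"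

definition submodule_span :: "('a, 'm) ring_scheme \<Rightarrow> ('a, 'b, 'p) module_scheme \<Rightarrow> 'b set \<Rightarrow> 'b set"
  where "submodule_span R M S = \<Inter>{N. submodule N R M \<and> S \<subseteq> N}"

definition quot_module :: "('a, 'b, 'p) module_scheme \<Rightarrow> 'b set \<Rightarrow> ('a, 'b set) module"
  where "quot_module M N =
    \<lparr>carrier = a_rcosets\<^bsub>M\<^esub> N, monoid.mult = undefined, one = undefined,
     zero = N, add = set_add M,
     smult = (\<lambda>r X. \<Union>x\<in>X. N +>\<^bsub>M\<^esub> (r \<odot>\<^bsub>M\<^esub> x))\<rparr>"

text \<open>The elements of the dual are cut off outside \<open>carrier M\<close>, so that equality of functionals
  is HOL equality.\<close>

definition dual_module :: "('a, 'm) ring_scheme \<Rightarrow> ('a, 'b, 'p) module_scheme \<Rightarrow> ('a, 'b \<Rightarrow> 'a) module"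
  where "dual_module R M =
    \<lparr>carrier = lin_maps R M (reg_module R) \<inter> extensional (carrier M),
     monoid.mult = undefined, one = undefined,
     zero = (\<lambda>x\<in>carrier M. \<zero>\<^bsub>R\<^esub>),
     add = (\<lambda>f g. \<lambda>x\<in>carrier M. f x \<oplus>\<^bsub>R\<^esub> g x),
     smult = (\<lambda>r f. \<lambda>x\<in>carrier M. r \<otimes>\<^bsub>R\<^esub> f x)\<rparr>"

definition bidual_eval :: "('a, 'm) ring_scheme \<Rightarrow> ('a, 'b, 'p) module_scheme \<Rightarrow> 'b \<Rightarrow> ('b \<Rightarrow> 'a) \<Rightarrow> 'a"
  where "bidual_eval R M u = (\<lambda>f\<in>carrier (dual_module R M). f u)"

definition transpose_map ::
  "('a, 'b, 'p) module_scheme \<Rightarrow> ('b \<Rightarrow> 'c) \<Rightarrow> ('c \<Rightarrow> 'a) \<Rightarrow> 'b \<Rightarrow> 'a"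
  where "transpose_map M \<phi> f = (\<lambda>u\<in>carrier M. f (\<phi> u))"


section \<open>Projective modules of constant rank\<close>

text \<open>The fraction \<open>m/s\<close> is the class of \<open>(m, s)\<close>; two pairs \<open>(m, s)\<close>, \<open>(n, t)\<close> are identified
  if \<open>w(tm - sn) = 0\<close> for some \<open>w\<close> in the multiplicative set.\<close>

definition frac ::
  "'a set \<Rightarrow> ('a, 'b, 'p) module_scheme \<Rightarrow> 'b \<Rightarrow> 'a \<Rightarrow> ('b \<times> 'a) set"
  where "frac S M m s = {(n, t). n \<in> carrier M \<and> t \<in> S \<and>
     (\<exists>w\<in>S. w \<odot>\<^bsub>M\<^esub> (t \<odot>\<^bsub>M\<^esub> m) = w \<odot>\<^bsub>M\<^esub> (s \<odot>\<^bsub>M\<^esub> n))}"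

definition loc_ring :: "('a, 'm) ring_scheme \<Rightarrow> 'a set \<Rightarrow> ('a \<times> 'a) set ring"
  where "loc_ring R S =
    \<lparr>carrier = {frac S (reg_module R) r s | r s. r \<in> carrier R \<and> s \<in> S},
     monoid.mult = (\<lambda>X Y. \<Union>(r, s)\<in>X. \<Union>(q, t)\<in>Y. frac S (reg_module R) (r \<otimes>\<^bsub>R\<^esub> q) (s \<otimes>\<^bsub>R\<^esub> t)),
     one = frac S (reg_module R) \<one>\<^bsub>R\<^esub> \<one>\<^bsub>R\<^esub>,
     zero = frac S (reg_module R) \<zero>\<^bsub>R\<^esub> \<one>\<^bsub>R\<^esub>,
     add = (\<lambda>X Y. \<Union>(r, s)\<in>X. \<Union>(q, t)\<in>Y.
        frac S (reg_module R) (t \<otimes>\<^bsub>R\<^esub> r \<oplus>\<^bsub>R\<^esub> s \<otimes>\<^bsub>R\<^esub> q) (s \<otimes>\<^bsub>R\<^esub> t))\<rparr>"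

definition loc_module ::
  "('a, 'm) ring_scheme \<Rightarrow> 'a set \<Rightarrow> ('a, 'b, 'p) module_scheme \<Rightarrow> (('a \<times> 'a) set, ('b \<times> 'a) set) module"
  where "loc_module R S M =
    \<lparr>carrier = {frac S M m s | m s. m \<in> carrier M \<and> s \<in> S},
     monoid.mult = undefined, one = undefined,
     zero = frac S M \<zero>\<^bsub>M\<^esub> \<one>\<^bsub>R\<^esub>,
     add = (\<lambda>X Y. \<Union>(m, s)\<in>X. \<Union>(n, t)\<in>Y.
        frac S M (t \<odot>\<^bsub>M\<^esub> m \<oplus>\<^bsub>M\<^esub> s \<odot>\<^bsub>M\<^esub> n) (s \<otimes>\<^bsub>R\<^esub> t)),
     smult = (\<lambda>X Y. \<Union>(r, s)\<in>X. \<Union>(n, t)\<in>Y. frac S M (r \<odot>\<^bsub>M\<^esub> n) (s \<otimes>\<^bsub>R\<^esub> t))\<rparr>"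

text \<open>Finitely generated projective: a direct summand (that is, a retract) of some \<open>R\<^sup>n\<close>.\<close>

definition fg_projective :: "('a, 'm) ring_scheme \<Rightarrow> ('a, 'b, 'p) module_scheme \<Rightarrow> bool"
  where "fg_projective R M \<longleftrightarrow> module R M \<and>
    (\<exists>(n::nat) i p. i \<in> lin_maps R M (free_module R {..<n}) \<and>
       p \<in> lin_maps R (free_module R {..<n}) M \<and> (\<forall>x\<in>carrier M. p (i x) = x))"

definition constant_rank :: "('a, 'm) ring_scheme \<Rightarrow> ('a, 'b, 'p) module_scheme \<Rightarrow> nat \<Rightarrow> bool"
  where "constant_rank R M n \<longleftrightarrow> (\<forall>P. primeideal P R \<longrightarrow>
    lin_isos (loc_ring R (carrier R - P))
      (free_module (loc_ring R (carrier R - P)) {..<n})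
      (loc_module R (carrier R - P) M) \<noteq> {})"


section \<open>The third exterior power\<close>

text \<open>\<open>\<And>\<^sup>3(M)\<close> is presented by the triples \<open>(u, v, w)\<close> subject to trilinearity and to the vanishing
  of \<open>(u, u, w)\<close> and \<open>(u, v, v)\<close>.\<close>

definition ext3_triples :: "('a, 'b, 'p) module_scheme \<Rightarrow> ('b \<times> 'b \<times> 'b) set"
  where "ext3_triples M = carrier M \<times> carrier M \<times> carrier M"

definition ext3_relators ::
  "('a, 'm) ring_scheme \<Rightarrow> ('a, 'b, 'p) module_scheme \<Rightarrow> ('b \<times> 'b \<times> 'b \<Rightarrow> 'a) set"
  where "ext3_relators R M =
    (let F = free_module R (ext3_triples M);
         \<delta> = (\<lambda>u v w. free_gen R (ext3_triples M) (u, v, w))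
     in {\<delta> (u \<oplus>\<^bsub>M\<^esub> u') v w \<ominus>\<^bsub>F\<^esub> (\<delta> u v w \<oplus>\<^bsub>F\<^esub> \<delta> u' v w) | u u' v w.
           u \<in> carrier M \<and> u' \<in> carrier M \<and> v \<in> carrier M \<and> w \<in> carrier M}
      \<union> {\<delta> u (v \<oplus>\<^bsub>M\<^esub> v') w \<ominus>\<^bsub>F\<^esub> (\<delta> u v w \<oplus>\<^bsub>F\<^esub> \<delta> u v' w) | u v v' w.
           u \<in> carrier M \<and> v \<in> carrier M \<and> v' \<in> carrier M \<and> w \<in> carrier M}
      \<union> {\<delta> u v (w \<oplus>\<^bsub>M\<^esub> w') \<ominus>\<^bsub>F\<^esub> (\<delta> u v w \<oplus>\<^bsub>F\<^esub> \<delta> u v w') | u v w w'.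
           u \<in> carrier M \<and> v \<in> carrier M \<and> w \<in> carrier M \<and> w' \<in> carrier M}
      \<union> {\<delta> (r \<odot>\<^bsub>M\<^esub> u) v w \<ominus>\<^bsub>F\<^esub> r \<odot>\<^bsub>F\<^esub> \<delta> u v w | r u v w.
           r \<in> carrier R \<and> u \<in> carrier M \<and> v \<in> carrier M \<and> w \<in> carrier M}
      \<union> {\<delta> u (r \<odot>\<^bsub>M\<^esub> v) w \<ominus>\<^bsub>F\<^esub> r \<odot>\<^bsub>F\<^esub> \<delta> u v w | r u v w.
           r \<in> carrier R \<and> u \<in> carrier M \<and> v \<in> carrier M \<and> w \<in> carrier M}
      \<union> {\<delta> u v (r \<odot>\<^bsub>M\<^esub> w) \<ominus>\<^bsub>F\<^esub> r \<odot>\<^bsub>F\<^esub> \<delta> u v w | r u v w.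
           r \<in> carrier R \<and> u \<in> carrier M \<and> v \<in> carrier M \<and> w \<in> carrier M}
      \<union> {\<delta> u u w | u w. u \<in> carrier M \<and> w \<in> carrier M}
      \<union> {\<delta> u v v | u v. u \<in> carrier M \<and> v \<in> carrier M})"

definition ext3_kernel ::
  "('a, 'm) ring_scheme \<Rightarrow> ('a, 'b, 'p) module_scheme \<Rightarrow> ('b \<times> 'b \<times> 'b \<Rightarrow> 'a) set"
  where "ext3_kernel R M =
    submodule_span R (free_module R (ext3_triples M)) (ext3_relators R M)"

definition ext3 ::
  "('a, 'm) ring_scheme \<Rightarrow> ('a, 'b, 'p) module_scheme \<Rightarrow> ('a, ('b \<times> 'b \<times> 'b \<Rightarrow> 'a) set) module"
  where "ext3 R M = quot_module (free_module R (ext3_triples M)) (ext3_kernel R M)"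

definition wedge3 ::
  "('a, 'm) ring_scheme \<Rightarrow> ('a, 'b, 'p) module_scheme \<Rightarrow> 'b \<Rightarrow> 'b \<Rightarrow> 'b \<Rightarrow> ('b \<times> 'b \<times> 'b \<Rightarrow> 'a) set"
  where "wedge3 R M u v w =
    ext3_kernel R M +>\<^bsub>free_module R (ext3_triples M)\<^esub> free_gen R (ext3_triples M) (u, v, w)"

text \<open>\<open>\<And>\<^sup>3\<phi>\<close>, cut off outside \<open>\<And>\<^sup>3(M)\<close>.\<close>

definition ext3_map ::
  "('a, 'm) ring_scheme \<Rightarrow> ('a, 'b, 'p) module_scheme \<Rightarrow> ('a, 'c, 'q) module_scheme \<Rightarrow> ('b \<Rightarrow> 'c) \<Rightarrow>
     ('b \<times> 'b \<times> 'b \<Rightarrow> 'a) set \<Rightarrow> ('c \<times> 'c \<times> 'c \<Rightarrow> 'a) set"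
  where "ext3_map R M N \<phi> =
    (THE h. h \<in> lin_maps R (ext3 R M) (ext3 R N) \<and> h \<in> extensional (carrier (ext3 R M)) \<and>
       (\<forall>u\<in>carrier M. \<forall>v\<in>carrier M. \<forall>w\<in>carrier M.
          h (wedge3 R M u v w) = wedge3 R N (\<phi> u) (\<phi> v) (\<phi> w)))"

definition vol_morphisms ::
  "('a, 'm) ring_scheme \<Rightarrow>
     ('a, 'b, 'p) module_scheme \<Rightarrow> (('b \<times> 'b \<times> 'b \<Rightarrow> 'a) set \<Rightarrow> 'a) \<Rightarrow>
     ('a, 'c, 'q) module_scheme \<Rightarrow> (('c \<times> 'c \<times> 'c \<Rightarrow> 'a) set \<Rightarrow> 'a) \<Rightarrow> ('b \<Rightarrow> 'c) set"
  where "vol_morphisms R T \<alpha> T' \<alpha>' = {\<phi> \<in> lin_maps R T T'.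
     \<forall>x\<in>carrier (ext3 R T). \<alpha>' (ext3_map R T T' \<phi> x) = \<alpha> x}"


section \<open>Split colour algebras\<close>

definition det3 :: "('a, 'm) ring_scheme \<Rightarrow> (nat \<Rightarrow> nat \<Rightarrow> 'a) \<Rightarrow> 'a"
  where "det3 R A =
    (\<Oplus>\<^bsub>R\<^esub> \<pi> \<in> {\<pi>. \<pi> permutes {1..3}}.
       (if evenperm \<pi> then \<one>\<^bsub>R\<^esub> else \<ominus>\<^bsub>R\<^esub> \<one>\<^bsub>R\<^esub>) \<otimes>\<^bsub>R\<^esub>
       (\<Otimes>\<^bsub>R\<^esub> i \<in> {1..3}. A i (\<pi> i)))"

text \<open>The isomorphism \<open>\<beta>\<close> on \<open>\<And>\<^sup>3\<close> of the dual that is determined by \<open>\<alpha>\<close>.\<close>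

definition dual_vol ::
  "('a, 'm) ring_scheme \<Rightarrow> ('a, 'b, 'p) module_scheme \<Rightarrow> (('b \<times> 'b \<times> 'b \<Rightarrow> 'a) set \<Rightarrow> 'a) \<Rightarrow>
     (('b \<Rightarrow> 'a) \<times> ('b \<Rightarrow> 'a) \<times> ('b \<Rightarrow> 'a) \<Rightarrow> 'a) set \<Rightarrow> 'a"
  where "dual_vol R T \<alpha> =
    (let D = dual_module R T
     in THE \<beta>. \<beta> \<in> lin_isos R (ext3 R D) (reg_module R) \<and> \<beta> \<in> extensional (carrier (ext3 R D)) \<and>
       (\<forall>u f. u \<in> {1..3} \<rightarrow> carrier T \<and> f \<in> {1..3} \<rightarrow> carrier D \<longrightarrow>
          \<alpha> (wedge3 R T (u 1) (u 2) (u 3)) \<otimes>\<^bsub>R\<^esub> \<beta> (wedge3 R D (f 1) (f 2) (f 3))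
            = det3 R (\<lambda>i j. f j (u i))))"

definition vec_prod ::
  "('a, 'm) ring_scheme \<Rightarrow> ('a, 'b, 'p) module_scheme \<Rightarrow> (('b \<times> 'b \<times> 'b \<Rightarrow> 'a) set \<Rightarrow> 'a) \<Rightarrow>
     'b \<Rightarrow> 'b \<Rightarrow> 'b \<Rightarrow> 'a"
  where "vec_prod R T \<alpha> u v = (\<lambda>w\<in>carrier T. \<alpha> (wedge3 R T u v w))"

text \<open>The vector product on the dual takes values in the bidual, which is identified with \<open>T\<close>
  via \<^const>\<open>bidual_eval\<close>.\<close>

definition dual_vec_prod ::
  "('a, 'm) ring_scheme \<Rightarrow> ('a, 'b, 'p) module_scheme \<Rightarrow> (('b \<times> 'b \<times> 'b \<Rightarrow> 'a) set \<Rightarrow> 'a) \<Rightarrow>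
     ('b \<Rightarrow> 'a) \<Rightarrow> ('b \<Rightarrow> 'a) \<Rightarrow> 'b"
  where "dual_vec_prod R T \<alpha> f g =
    inv_into (carrier T) (bidual_eval R T) (vec_prod R (dual_module R T) (dual_vol R T \<alpha>) f g)"

text \<open>The matrix with diagonal entries \<open>a\<close>, upper right entry \<open>u\<close> and lower left entry \<open>f\<close> is
  encoded as the triple \<open>(a, u, f)\<close>.\<close>

definition Col ::
  "('a, 'm) ring_scheme \<Rightarrow> ('a, 'b, 'p) module_scheme \<Rightarrow> (('b \<times> 'b \<times> 'b \<Rightarrow> 'a) set \<Rightarrow> 'a) \<Rightarrow>
     ('a, 'a \<times> 'b \<times> ('b \<Rightarrow> 'a)) module"
  where "Col R T \<alpha> = (let D = dual_module R T in
    \<lparr>carrier = carrier R \<times> carrier T \<times> carrier D,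
     monoid.mult = (\<lambda>(a, u, f) (b, v, g).
       (a \<otimes>\<^bsub>R\<^esub> b \<oplus>\<^bsub>R\<^esub> g u \<oplus>\<^bsub>R\<^esub> f v,
        (a \<odot>\<^bsub>T\<^esub> v \<oplus>\<^bsub>T\<^esub> b \<odot>\<^bsub>T\<^esub> u) \<ominus>\<^bsub>T\<^esub> dual_vec_prod R T \<alpha> f g,
        b \<odot>\<^bsub>D\<^esub> f \<oplus>\<^bsub>D\<^esub> a \<odot>\<^bsub>D\<^esub> g \<oplus>\<^bsub>D\<^esub> vec_prod R T \<alpha> u v)),
     one = (\<one>\<^bsub>R\<^esub>, \<zero>\<^bsub>T\<^esub>, \<zero>\<^bsub>D\<^esub>),
     zero = (\<zero>\<^bsub>R\<^esub>, \<zero>\<^bsub>T\<^esub>, \<zero>\<^bsub>D\<^esub>),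
     add = (\<lambda>(a, u, f) (b, v, g). (a \<oplus>\<^bsub>R\<^esub> b, u \<oplus>\<^bsub>T\<^esub> v, f \<oplus>\<^bsub>D\<^esub> g)),
     smult = (\<lambda>r (a, u, f). (r \<otimes>\<^bsub>R\<^esub> a, r \<odot>\<^bsub>T\<^esub> u, r \<odot>\<^bsub>D\<^esub> f))\<rparr>)"

text \<open>Colour algebras are not associative; \<^const>\<open>ring_iso\<close> only refers to the operations, so it
  applies to them nevertheless.\<close>

definition alg_isos ::
  "('a, 'm) ring_scheme \<Rightarrow> ('a, 'b, 'p) module_scheme \<Rightarrow> ('a, 'c, 'q) module_scheme \<Rightarrow> ('b \<Rightarrow> 'c) set"
  where "alg_isos R A B = lin_isos R A B \<inter> ring_iso A B"

end

theory Submission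
  imports Defs
begin

text \<open>
  Write \<open>[u, v, w] = \<alpha>(u \<and> v \<and> w)\<close>. Since \<open>\<alpha>\<close> is a linear bijection from \<open>\<And>\<^sup>3(T)\<close> to \<open>R\<close>, and
  since \<open>\<And>\<^sup>3(T)\<close> is generated by the products \<open>u \<and> v \<and> w\<close>, two facts are available.

  The first is that every alternating trilinear map \<open>A\<close> from \<open>T\<close> to a module has the form
  \<open>A(u, v, w) = [u, v, w] c\<close> for a constant \<open>c\<close>, namely the value at \<open>\<alpha>\<^sup>-\<^sup>1(1)\<close> of the linear map on
  \<open>\<And>\<^sup>3(T)\<close> that \<open>A\<close> induces (\<open>alternating_factor\<close>). The second is that the values \<open>[u, v, w]\<close> generate
  the unit ideal, and so do their \<open>n\<close>-th powers (\<open>volume_powers_generate\<close>). Hence a statement of the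
  form \<open>y \<in> S\<close>, with \<open>S\<close> a submodule, holds as soon as it holds after multiplication by all
  \<open>[u, v, w]\<^sup>n\<close> (\<open>local_membership\<close>). This plays the role of passing to the open sets on which
  \<open>u, v, w\<close> is a basis of \<open>T\<close>.

  Together they give Cramer's rule \<open>[u, v, w] t = [t, v, w] u + [t, w, u] v + [t, u, v] w\<close>
  (\<open>cramer\<close>): if \<open>\<delta>\<^sub>t(u, v, w)\<close> is the difference of the two sides, then \<open>\<delta>\<^sub>t\<close> is alternating, so it is
  \<open>[u, v, w] d\<close>, and antisymmetry in \<open>t\<close> and \<open>u\<close> makes \<open>[u, v, w]\<^sup>2 d\<close> vanish. Cramer's rule
  replaces all computations in coordinates:

  \<^item> The evaluation map from \<open>T\<close> to its bidual is bijective, because a functional \<open>\<Xi>\<close> on the dual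
    multiplied by \<open>[u, v, w]\<close> is evaluation at
    \<open>\<Xi>(v \<times> w) u + \<Xi>(w \<times> u) v + \<Xi>(u \<times> v) w\<close> (\<open>bidual_eval_bij\<close>).
  \<^item> The form \<open>\<beta>\<close> exists. For functionals \<open>f, g, h\<close> the determinant of their values at \<open>u, v, w\<close> is
    alternating in \<open>u, v, w\<close>, hence equal to \<open>[u, v, w] \<beta>(f, g, h)\<close> for a unique scalar, which is
    alternating in \<open>f, g, h\<close>. The induced map on the third exterior power of the dual is bijective,
    because \<open>[u, v, w] \<beta>(v \<times> w, w \<times> u, u \<times> v) = [u, v, w]\<^sup>3\<close> and because the dual Cramer rule
    shows \<open>[u, v, w]\<^sup>3 \<xi> = \<beta>(\<xi>) [u, v, w] (v \<times> w) \<and> (w \<times> u) \<and> (u \<times> v)\<close> for every \<open>\<xi>\<close>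
    (\<open>dual_form_extension_bij\<close>, \<open>dual_vol\<close>). So the dual with \<open>\<beta>\<close> is again a module with a volume form.
  \<^item> A morphism \<open>\<phi>\<close> preserves \<open>[u, v, w]\<close>. Cramer's rule then recovers \<open>t\<close> locally from \<open>\<phi>(t)\<close> and
    writes elements of \<open>T'\<close> locally as images, so \<open>\<phi>\<close> is bijective (\<open>volume_morphism.bij\<close>).

  That the two maps respect the products of the colour algebras is a matter of comparing vector
  products, and these are determined by the volume forms. For a morphism, the determinant identity
  turns invariance of \<open>\<alpha>\<close> into invariance of \<open>\<beta>\<close> (\<open>dual_vec_prod_image\<close>). For the passage to the
  dual, the same identity and the symmetry of determinants under transposition show that the volume
  form obtained from \<open>\<alpha>\<close> by dualizing twice is \<open>\<alpha>\<close> itself (\<open>vol_bidual\<close>).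
\<close>

section \<open>Linear maps\<close>

lemma (in abelian_group) minus_eq_zero_iff:
  "x \<in> carrier G \<Longrightarrow> y \<in> carrier G \<Longrightarrow> x \<ominus> y = \<zero> \<longleftrightarrow> x = y"
  by (metis a_minus_def add.inv_closed minus_equality minus_minus r_neg)

lemma lin_maps_closed: "h \<in> lin_maps R M N \<Longrightarrow> x \<in> carrier M \<Longrightarrow> h x \<in> carrier N"
  by (auto simp: lin_maps_def)

lemma lin_maps_add:
  "h \<in> lin_maps R M N \<Longrightarrow> x \<in> carrier M \<Longrightarrow> y \<in> carrier M \<Longrightarrow> h (x \<oplus>\<^bsub>M\<^esub> y) = h x \<oplus>\<^bsub>N\<^esub> h y"
  by (auto simp: lin_maps_def)

lemma lin_maps_smult:
  "h \<in> lin_maps R M N \<Longrightarrow> r \<in> carrier R \<Longrightarrow> x \<in> carrier M \<Longrightarrow> h (r \<odot>\<^bsub>M\<^esub> x) = r \<odot>\<^bsub>N\<^esub> h x"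
  by (auto simp: lin_maps_def)

lemma lin_mapsI:
  assumes "\<And>x. x \<in> carrier M \<Longrightarrow> h x \<in> carrier N"
    and "\<And>x y. x \<in> carrier M \<Longrightarrow> y \<in> carrier M \<Longrightarrow> h (x \<oplus>\<^bsub>M\<^esub> y) = h x \<oplus>\<^bsub>N\<^esub> h y"
    and "\<And>r x. r \<in> carrier R \<Longrightarrow> x \<in> carrier M \<Longrightarrow> h (r \<odot>\<^bsub>M\<^esub> x) = r \<odot>\<^bsub>N\<^esub> h x"
  shows "h \<in> lin_maps R M N"
  using assms by (auto simp: lin_maps_def)

lemma lin_maps_cong:
  assumes "h \<in> lin_maps R M N" and "module R M" and "\<And>x. x \<in> carrier M \<Longrightarrow> k x = h x"
  shows "k \<in> lin_maps R M N"
proof -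
  interpret M: module R M by fact
  show ?thesis using assms by (auto simp: lin_maps_def)
qed

lemma lin_maps_zero:
  assumes "module R M" "module R N" "h \<in> lin_maps R M N"
  shows "h \<zero>\<^bsub>M\<^esub> = \<zero>\<^bsub>N\<^esub>"
proof -
  interpret M: module R M by fact
  interpret N: module R N by fact
  have "h (\<zero>\<^bsub>R\<^esub> \<odot>\<^bsub>M\<^esub> \<zero>\<^bsub>M\<^esub>) = \<zero>\<^bsub>R\<^esub> \<odot>\<^bsub>N\<^esub> h \<zero>\<^bsub>M\<^esub>"
    using assms(3) by (intro lin_maps_smult) auto
  then show ?thesis using lin_maps_closed[OF assms(3)] by simp
qed

lemma lin_maps_neg:
  assumes "module R M" "module R N" "h \<in> lin_maps R M N" "x \<in> carrier M"
  shows "h (\<ominus>\<^bsub>M\<^esub> x) = \<ominus>\<^bsub>N\<^esub> h x"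
proof -
  interpret M: module R M by fact
  interpret N: module R N by fact
  have "h (\<ominus>\<^bsub>M\<^esub> x) = h ((\<ominus>\<^bsub>R\<^esub> \<one>\<^bsub>R\<^esub>) \<odot>\<^bsub>M\<^esub> x)"
    using assms by (simp add: M.smult_l_minus)
  also have "\<dots> = (\<ominus>\<^bsub>R\<^esub> \<one>\<^bsub>R\<^esub>) \<odot>\<^bsub>N\<^esub> h x"
    using assms by (intro lin_maps_smult) auto
  finally show ?thesis using assms by (simp add: N.smult_l_minus lin_maps_closed)
qed

lemma lin_maps_minus:
  assumes "module R M" "module R N" "h \<in> lin_maps R M N" "x \<in> carrier M" "y \<in> carrier M"
  shows "h (x \<ominus>\<^bsub>M\<^esub> y) = h x \<ominus>\<^bsub>N\<^esub> h y"
proof -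
  interpret M: module R M by fact
  interpret N: module R N by fact
  show ?thesis using assms by (simp add: a_minus_def lin_maps_add lin_maps_neg)
qed

lemma lin_maps_id: "(\<lambda>x. x) \<in> lin_maps R M M"
  by (auto simp: lin_maps_def)

lemma lin_maps_comp:
  assumes "h \<in> lin_maps R M N" "k \<in> lin_maps R N P"
  shows "(\<lambda>x. k (h x)) \<in> lin_maps R M P"
  using assms by (intro lin_mapsI) (simp_all add: lin_maps_closed lin_maps_add lin_maps_smult)

lemma lin_maps_sum:
  assumes "module R N" "h \<in> lin_maps R M N" "k \<in> lin_maps R M N"
  shows "(\<lambda>x. h x \<oplus>\<^bsub>N\<^esub> k x) \<in> lin_maps R M N"
proof -
  interpret N: module R N by fact
  show ?thesis using assms(2,3)
    by (intro lin_mapsI)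
      (simp_all add: lin_maps_closed lin_maps_add lin_maps_smult N.smult_r_distr N.M.a_ac)
qed

lemma lin_maps_scaled:
  assumes "module R N" "h \<in> lin_maps R M N" "r \<in> carrier R"
  shows "(\<lambda>x. r \<odot>\<^bsub>N\<^esub> h x) \<in> lin_maps R M N"
proof -
  interpret N: module R N by fact
  show ?thesis using assms(2,3)
    by (intro lin_mapsI)
      (simp_all add: lin_maps_closed lin_maps_add lin_maps_smult N.smult_r_distr
        N.smult_assoc1[symmetric] N.R.m_comm)
qed

lemma lin_maps_diff:
  assumes "module R M" "module R N" "h \<in> lin_maps R M N" "k \<in> lin_maps R M N"
  shows "(\<lambda>x. h x \<ominus>\<^bsub>N\<^esub> k x) \<in> lin_maps R M N"
proof -
  interpret M: module R M by fact
  interpret N: module R N by fact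
  have lin: "(\<lambda>x. h x \<oplus>\<^bsub>N\<^esub> (\<ominus>\<^bsub>R\<^esub> \<one>\<^bsub>R\<^esub>) \<odot>\<^bsub>N\<^esub> k x) \<in> lin_maps R M N"
    using assms by (intro lin_maps_sum lin_maps_scaled) auto
  show ?thesis
    using assms(3,4)
    by (intro lin_maps_cong[OF lin assms(1)]) (auto simp: a_minus_def N.smult_l_minus lin_maps_closed)
qed

lemma reg_module_simps [simp]:
  "carrier (reg_module R) = carrier R" "\<zero>\<^bsub>reg_module R\<^esub> = \<zero>\<^bsub>R\<^esub>"
  "x \<oplus>\<^bsub>reg_module R\<^esub> y = x \<oplus>\<^bsub>R\<^esub> y" "x \<odot>\<^bsub>reg_module R\<^esub> y = x \<otimes>\<^bsub>R\<^esub> y"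
  by (simp_all add: reg_module_def)

lemma reg_module_neg [simp]: "\<ominus>\<^bsub>reg_module R\<^esub> x = \<ominus>\<^bsub>R\<^esub> x"
  by (simp add: reg_module_def a_inv_def m_inv_def)

lemma reg_module_minus [simp]: "x \<ominus>\<^bsub>reg_module R\<^esub> y = x \<ominus>\<^bsub>R\<^esub> y"
  by (simp add: a_minus_def)

lemma module_reg_module:
  assumes "cring R"
  shows "module R (reg_module R)"
proof -
  interpret cring R by fact
  show ?thesis
  proof (rule moduleI)
    show "abelian_group (reg_module R)"
      by (rule abelian_groupI) (auto simp: a_ac intro: l_neg)
  qed (auto simp: assms l_distr r_distr m_assoc)
qed

lemma lin_maps_scalar:
  assumes "module R N" "g \<in> lin_maps R M (reg_module R)" "n \<in> carrier N"
  shows "(\<lambda>x. g x \<odot>\<^bsub>N\<^esub> n) \<in> lin_maps R M N"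
proof -
  interpret N: module R N by fact
  have [simp]: "x \<in> carrier M \<Longrightarrow> g x \<in> carrier R" for x
    using lin_maps_closed[OF assms(2)] by simp
  show ?thesis using assms(2,3)
    by (intro lin_mapsI)
      (simp_all add: lin_maps_add lin_maps_smult N.smult_l_distr N.smult_assoc1)
qed

section \<open>Free modules, quotients and duals\<close>

lemma free_module_simps:
  "carrier (free_module R X) = {f \<in> X \<rightarrow>\<^sub>E carrier R. finite {x \<in> X. f x \<noteq> \<zero>\<^bsub>R\<^esub>}}"
  "\<zero>\<^bsub>free_module R X\<^esub> = (\<lambda>x\<in>X. \<zero>\<^bsub>R\<^esub>)"
  "f \<oplus>\<^bsub>free_module R X\<^esub> g = (\<lambda>x\<in>X. f x \<oplus>\<^bsub>R\<^esub> g x)"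
  "r \<odot>\<^bsub>free_module R X\<^esub> f = (\<lambda>x\<in>X. r \<otimes>\<^bsub>R\<^esub> f x)"
  by (simp_all add: free_module_def)

lemma module_free_module:
  assumes "cring R"
  shows "module R (free_module R X)"
proof -
  interpret cring R by fact
  show ?thesis
  proof (rule moduleI)
    show "abelian_group (free_module R X)"
    proof (rule abelian_groupI)
      fix f assume f: "f \<in> carrier (free_module R X)"
      have "(\<lambda>x\<in>X. \<ominus>\<^bsub>R\<^esub> f x) \<in> carrier (free_module R X)"
        using f by (auto simp: free_module_simps elim!: rev_finite_subset)
      then show "\<exists>g\<in>carrier (free_module R X). g \<oplus>\<^bsub>free_module R X\<^esub> f = \<zero>\<^bsub>free_module R X\<^esub>"
        using f by (intro bexI[of _ "\<lambda>x\<in>X. \<ominus>\<^bsub>R\<^esub> f x"])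
          (auto simp: free_module_simps fun_eq_iff l_neg PiE_iff)
    next
      fix f g assume fg: "f \<in> carrier (free_module R X)" "g \<in> carrier (free_module R X)"
      have "{x \<in> X. f x \<oplus>\<^bsub>R\<^esub> g x \<noteq> \<zero>\<^bsub>R\<^esub>} \<subseteq> {x \<in> X. f x \<noteq> \<zero>\<^bsub>R\<^esub>} \<union> {x \<in> X. g x \<noteq> \<zero>\<^bsub>R\<^esub>}"
        by auto
      then have "finite {x \<in> X. f x \<oplus>\<^bsub>R\<^esub> g x \<noteq> \<zero>\<^bsub>R\<^esub>}"
        by (rule finite_subset) (use fg in \<open>auto simp: free_module_simps\<close>)
      then show "f \<oplus>\<^bsub>free_module R X\<^esub> g \<in> carrier (free_module R X)"
        using fg by (auto simp: free_module_simps PiE_iff cong: conj_cong)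
    qed (auto simp: free_module_simps fun_eq_iff a_ac PiE_iff extensional_def)
  next
    fix r f assume rf: "r \<in> carrier R" "f \<in> carrier (free_module R X)"
    have "{x \<in> X. r \<otimes>\<^bsub>R\<^esub> f x \<noteq> \<zero>\<^bsub>R\<^esub>} \<subseteq> {x \<in> X. f x \<noteq> \<zero>\<^bsub>R\<^esub>}"
      using rf by auto
    then have "finite {x \<in> X. r \<otimes>\<^bsub>R\<^esub> f x \<noteq> \<zero>\<^bsub>R\<^esub>}"
      by (rule finite_subset) (use rf in \<open>auto simp: free_module_simps\<close>)
    then show "r \<odot>\<^bsub>free_module R X\<^esub> f \<in> carrier (free_module R X)"
      using rf by (auto simp: free_module_simps PiE_iff cong: conj_cong)
  qed (auto simp: assms free_module_simps fun_eq_iff l_distr r_distr m_assoc PiE_iff extensional_def)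
qed

lemma free_gen_closed:
  assumes "cring R" "x \<in> X"
  shows "free_gen R X x \<in> carrier (free_module R X)"
proof -
  interpret cring R by fact
  have "{y \<in> X. (if y = x then \<one>\<^bsub>R\<^esub> else \<zero>\<^bsub>R\<^esub>) \<noteq> \<zero>\<^bsub>R\<^esub>} \<subseteq> {x}" by auto
  then have "finite {y \<in> X. (if y = x then \<one>\<^bsub>R\<^esub> else \<zero>\<^bsub>R\<^esub>) \<noteq> \<zero>\<^bsub>R\<^esub>}"
    by (rule finite_subset) simp
  then show ?thesis
    by (auto simp: free_module_simps free_gen_def cong: conj_cong)
qed

lemma free_module_induct:
  assumes R: "cring R" and f: "f \<in> carrier (free_module R X)"
    and zero: "P \<zero>\<^bsub>free_module R X\<^esub>"
    and step: "\<And>r x g. r \<in> carrier R \<Longrightarrow> x \<in> X \<Longrightarrow> g \<in> carrier (free_module R X) \<Longrightarrow> P g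
       \<Longrightarrow> P (r \<odot>\<^bsub>free_module R X\<^esub> free_gen R X x \<oplus>\<^bsub>free_module R X\<^esub> g)"
  shows "P f"
proof -
  interpret cring R by fact
  have "finite S \<Longrightarrow> f \<in> carrier (free_module R X) \<Longrightarrow> {x \<in> X. f x \<noteq> \<zero>\<^bsub>R\<^esub>} \<subseteq> S \<Longrightarrow> P f" for S f
  proof (induction S arbitrary: f rule: finite_induct)
    case empty
    then have "f = \<zero>\<^bsub>free_module R X\<^esub>"
      by (auto simp: free_module_simps fun_eq_iff PiE_iff extensional_def)
    then show ?case using zero by simp
  next
    case (insert x S)
    show ?case
    proof (cases "x \<in> X")
      case False
      then show ?thesis using insert by (intro insert.IH) auto
    next
      case True
      define g where "g = f(x := \<zero>\<^bsub>R\<^esub>)"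
      have "{y \<in> X. g y \<noteq> \<zero>\<^bsub>R\<^esub>} \<subseteq> {y \<in> X. f y \<noteq> \<zero>\<^bsub>R\<^esub>}" by (auto simp: g_def)
      then have "finite {y \<in> X. g y \<noteq> \<zero>\<^bsub>R\<^esub>}"
        by (rule finite_subset) (use insert.prems in \<open>auto simp: free_module_simps\<close>)
      then have g: "g \<in> carrier (free_module R X)"
        using insert.prems True by (auto simp: free_module_simps g_def PiE_iff extensional_def)
      have "P g" using insert.prems by (intro insert.IH g) (auto simp: g_def)
      then have "P (f x \<odot>\<^bsub>free_module R X\<^esub> free_gen R X x \<oplus>\<^bsub>free_module R X\<^esub> g)"
        using insert.prems True g by (intro step) (auto simp: free_module_simps)
      also have "f x \<odot>\<^bsub>free_module R X\<^esub> free_gen R X x \<oplus>\<^bsub>free_module R X\<^esub> g = f"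
        using insert.prems True
        by (auto simp: free_module_simps g_def free_gen_def fun_eq_iff PiE_iff extensional_def)
      finally show ?thesis .
    qed
  qed
  from this[of "{x \<in> X. f x \<noteq> \<zero>\<^bsub>R\<^esub>}" f] f show ?thesis by (auto simp: free_module_simps)
qed

text \<open>
  The sum runs over the support of the coefficient function, because a sum over an infinite index set
  has the default value zero.
\<close>

definition free_lift ::
  "('a, 'm) ring_scheme \<Rightarrow> 'x set \<Rightarrow> ('a, 'b, 'p) module_scheme \<Rightarrow> ('x \<Rightarrow> 'b) \<Rightarrow> ('x \<Rightarrow> 'a) \<Rightarrow> 'b"
  where "free_lift R X N A f = (\<Oplus>\<^bsub>N\<^esub>x\<in>{x \<in> X. f x \<noteq> \<zero>\<^bsub>R\<^esub>}. f x \<odot>\<^bsub>N\<^esub> A x)"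

lemma free_lift_superset:
  assumes "module R N" "A \<in> X \<rightarrow> carrier N" "f \<in> X \<rightarrow> carrier R"
    and "finite S" "{x \<in> X. f x \<noteq> \<zero>\<^bsub>R\<^esub>} \<subseteq> S" "S \<subseteq> X"
  shows "free_lift R X N A f = (\<Oplus>\<^bsub>N\<^esub>x\<in>S. f x \<odot>\<^bsub>N\<^esub> A x)"
proof -
  interpret N: module R N by fact
  show ?thesis
    unfolding free_lift_def using assms(2-)
    by (intro N.add.finprod_mono_neutral_cong_left) (auto simp: Pi_iff subset_iff)
qed

lemma free_lift_linear:
  assumes "module R N" "A \<in> X \<rightarrow> carrier N"
  shows "free_lift R X N A \<in> lin_maps R (free_module R X) N"
proof -
  interpret N: module R N by fact
  let ?F = "free_module R X"
  interpret F: module R ?F by (rule module_free_module) (rule module.axioms(1)[OF assms(1)])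
  have A: "x \<in> X \<Longrightarrow> A x \<in> carrier N" for x using assms(2) by auto
  have fin: "finite {x \<in> X. f x \<noteq> \<zero>\<^bsub>R\<^esub>}" and val: "f \<in> X \<rightarrow> carrier R"
    if "f \<in> carrier ?F" for f using that by (auto simp: free_module_simps)
  show ?thesis
  proof (rule lin_mapsI)
    fix f assume f: "f \<in> carrier ?F"
    then show "free_lift R X N A f \<in> carrier N"
      unfolding free_lift_def using A val[OF f] by (intro N.M.finsum_closed) auto
  next
    fix f g assume f: "f \<in> carrier ?F" and g: "g \<in> carrier ?F"
    let ?S = "{x \<in> X. f x \<noteq> \<zero>\<^bsub>R\<^esub>} \<union> {x \<in> X. g x \<noteq> \<zero>\<^bsub>R\<^esub>}"
    have S: "finite ?S" "?S \<subseteq> X" using fin f g by auto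
    have fg: "f \<oplus>\<^bsub>?F\<^esub> g \<in> carrier ?F" using f g by simp
    have "free_lift R X N A (f \<oplus>\<^bsub>?F\<^esub> g) = (\<Oplus>\<^bsub>N\<^esub>x\<in>?S. (f \<oplus>\<^bsub>?F\<^esub> g) x \<odot>\<^bsub>N\<^esub> A x)"
      using assms val[OF fg] S by (intro free_lift_superset) (auto simp: free_module_simps)
    also have "\<dots> = (\<Oplus>\<^bsub>N\<^esub>x\<in>?S. f x \<odot>\<^bsub>N\<^esub> A x \<oplus>\<^bsub>N\<^esub> g x \<odot>\<^bsub>N\<^esub> A x)"
      using S A val[OF f] val[OF g]
      by (intro N.M.finsum_cong') (auto simp: free_module_simps N.smult_l_distr Pi_iff)
    also have "\<dots> = (\<Oplus>\<^bsub>N\<^esub>x\<in>?S. f x \<odot>\<^bsub>N\<^esub> A x) \<oplus>\<^bsub>N\<^esub> (\<Oplus>\<^bsub>N\<^esub>x\<in>?S. g x \<odot>\<^bsub>N\<^esub> A x)"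
      using S A val[OF f] val[OF g] by (intro N.M.finsum_addf) (auto simp: Pi_iff)
    also have "(\<Oplus>\<^bsub>N\<^esub>x\<in>?S. f x \<odot>\<^bsub>N\<^esub> A x) = free_lift R X N A f"
      using assms val[OF f] S by (intro free_lift_superset[symmetric]) auto
    also have "(\<Oplus>\<^bsub>N\<^esub>x\<in>?S. g x \<odot>\<^bsub>N\<^esub> A x) = free_lift R X N A g"
      using assms val[OF g] S by (intro free_lift_superset[symmetric]) auto
    finally show "free_lift R X N A (f \<oplus>\<^bsub>?F\<^esub> g) = free_lift R X N A f \<oplus>\<^bsub>N\<^esub> free_lift R X N A g" .
  next
    fix r f assume r: "r \<in> carrier R" and f: "f \<in> carrier ?F"
    let ?S = "{x \<in> X. f x \<noteq> \<zero>\<^bsub>R\<^esub>}"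
    have rf: "r \<odot>\<^bsub>?F\<^esub> f \<in> carrier ?F" using f r by simp
    have "free_lift R X N A (r \<odot>\<^bsub>?F\<^esub> f) = (\<Oplus>\<^bsub>N\<^esub>x\<in>?S. (r \<odot>\<^bsub>?F\<^esub> f) x \<odot>\<^bsub>N\<^esub> A x)"
      using assms val[OF rf] fin[OF f] r
      by (intro free_lift_superset) (auto simp: free_module_simps)
    also have "\<dots> = (\<Oplus>\<^bsub>N\<^esub>x\<in>?S. r \<odot>\<^bsub>N\<^esub> (f x \<odot>\<^bsub>N\<^esub> A x))"
      using r A val[OF f]
      by (intro N.M.finsum_cong') (auto simp: free_module_simps N.smult_assoc1 Pi_iff)
    also have "\<dots> = r \<odot>\<^bsub>N\<^esub> free_lift R X N A f"
      unfolding free_lift_def using r A val[OF f] fin[OF f]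
      by (intro N.finsum_smult_ldistr[symmetric]) (auto simp: Pi_iff)
    finally show "free_lift R X N A (r \<odot>\<^bsub>?F\<^esub> f) = r \<odot>\<^bsub>N\<^esub> free_lift R X N A f" .
  qed
qed

lemma free_lift_gen:
  assumes "module R N" "A \<in> X \<rightarrow> carrier N" "x \<in> X"
  shows "free_lift R X N A (free_gen R X x) = A x"
proof -
  interpret N: module R N by fact
  have "free_lift R X N A (free_gen R X x) = (\<Oplus>\<^bsub>N\<^esub>y\<in>{x}. free_gen R X x y \<odot>\<^bsub>N\<^esub> A y)"
    using assms by (intro free_lift_superset) (auto simp: free_gen_def)
  also have "\<dots> = A x"
    using assms by (subst N.M.finsum_insert) (auto simp: free_gen_def Pi_iff)
  finally show ?thesis .
qed

text \<open>
  Module axioms are equations, so they pass to images under operation-preserving maps. For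
  quotients this avoids verifying each axiom on cosets.
\<close>

lemma module_surjective_image:
  assumes F: "module R F"
    and surj: "carrier Q = \<pi> ` carrier F"
    and zero: "\<zero>\<^bsub>Q\<^esub> = \<pi> \<zero>\<^bsub>F\<^esub>"
    and add: "\<And>x y. x \<in> carrier F \<Longrightarrow> y \<in> carrier F \<Longrightarrow> \<pi> x \<oplus>\<^bsub>Q\<^esub> \<pi> y = \<pi> (x \<oplus>\<^bsub>F\<^esub> y)"
    and smult: "\<And>r x. r \<in> carrier R \<Longrightarrow> x \<in> carrier F \<Longrightarrow> r \<odot>\<^bsub>Q\<^esub> \<pi> x = \<pi> (r \<odot>\<^bsub>F\<^esub> x)"
  shows "module R Q"
proof -
  interpret F: module R F by fact
  show ?thesis
  proof (rule moduleI)
    show "cring R" by (rule module.axioms(1)[OF F])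
    show "abelian_group Q"
    proof (rule abelian_groupI)
      fix x assume "x \<in> carrier Q"
      then obtain a where a: "a \<in> carrier F" "x = \<pi> a" using surj by auto
      then have "\<pi> (\<ominus>\<^bsub>F\<^esub> a) \<oplus>\<^bsub>Q\<^esub> x = \<zero>\<^bsub>Q\<^esub>"
        by (simp add: add zero F.M.l_neg)
      then show "\<exists>y\<in>carrier Q. y \<oplus>\<^bsub>Q\<^esub> x = \<zero>\<^bsub>Q\<^esub>"
        using a surj by (intro bexI[of _ "\<pi> (\<ominus>\<^bsub>F\<^esub> a)"]) auto
    qed (auto simp: surj zero add F.M.a_ac)
  qed (auto simp: surj add smult F.smult_l_distr F.smult_r_distr F.smult_assoc1)
qed

lemma quot_module_simps:
  "carrier (quot_module F K) = (\<lambda>x. K +>\<^bsub>F\<^esub> x) ` carrier F"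
  "\<zero>\<^bsub>quot_module F K\<^esub> = K"
  "X \<oplus>\<^bsub>quot_module F K\<^esub> Y = X <+>\<^bsub>F\<^esub> Y"
  "r \<odot>\<^bsub>quot_module F K\<^esub> X = (\<Union>x\<in>X. K +>\<^bsub>F\<^esub> (r \<odot>\<^bsub>F\<^esub> x))"
  by (auto simp: quot_module_def A_RCOSETS_def')

lemma abelian_subgroup_submodule:
  assumes "module R F" "submodule K R F"
  shows "abelian_subgroup K F"
proof -
  interpret F: module R F by fact
  show ?thesis
    by (rule abelian_subgroupI3)
      (auto intro: additive_subgroup.intro submodule.axioms(1)[OF assms(2)] F.M.abelian_group_axioms)
qed

lemma coset_eq_iff:
  assumes "module R F" "submodule K R F" "x \<in> carrier F" "y \<in> carrier F"
  shows "K +>\<^bsub>F\<^esub> x = K +>\<^bsub>F\<^esub> y \<longleftrightarrow> x \<ominus>\<^bsub>F\<^esub> y \<in> K"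
proof -
  interpret F: module R F by fact
  interpret K: abelian_subgroup K F by (rule abelian_subgroup_submodule) fact+
  have "K +>\<^bsub>F\<^esub> x = K +>\<^bsub>F\<^esub> y \<longleftrightarrow> x \<in> K +>\<^bsub>F\<^esub> y"
    using K.a_repr_independence'[of x y] K.a_rcos_self[of x] assms(3,4) by metis
  also have "\<dots> \<longleftrightarrow> x \<ominus>\<^bsub>F\<^esub> y \<in> K"
    using K.a_rcos_module[of y x] assms(3,4) F.M.abelian_group_axioms by (simp add: a_minus_def)
  finally show ?thesis .
qed

text \<open>
  Scalar multiplication of a coset is defined as a union over all its representatives; the members
  of the union coincide, since the submodule absorbs \<open>r (y - x)\<close>.
\<close>

lemma quot_module_smult:
  assumes "module R F" "submodule K R F" "r \<in> carrier R" "x \<in> carrier F"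
  shows "r \<odot>\<^bsub>quot_module F K\<^esub> (K +>\<^bsub>F\<^esub> x) = K +>\<^bsub>F\<^esub> (r \<odot>\<^bsub>F\<^esub> x)"
proof -
  interpret F: module R F by fact
  interpret K: abelian_subgroup K F by (rule abelian_subgroup_submodule) fact+
  have *: "K +>\<^bsub>F\<^esub> (r \<odot>\<^bsub>F\<^esub> y) = K +>\<^bsub>F\<^esub> (r \<odot>\<^bsub>F\<^esub> x)" if "y \<in> K +>\<^bsub>F\<^esub> x" for y
  proof -
    have y: "y \<in> carrier F"
      using that assms(4) by (rule K.a_elemrcos_carrier[rotated])
    then have "y \<ominus>\<^bsub>F\<^esub> x \<in> K"
      using that assms(4) K.a_rcos_module[of x y] by (simp add: a_minus_def)
    then have "r \<odot>\<^bsub>F\<^esub> (y \<ominus>\<^bsub>F\<^esub> x) \<in> K" by (rule submodule.smult_closed[OF assms(2,3)])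
    then have "r \<odot>\<^bsub>F\<^esub> y \<ominus>\<^bsub>F\<^esub> r \<odot>\<^bsub>F\<^esub> x \<in> K"
      using assms y by (simp add: a_minus_def F.smult_r_distr F.smult_r_minus)
    then show ?thesis using coset_eq_iff[OF assms(1,2)] assms y by simp
  qed
  have "(\<Union>y\<in>K +>\<^bsub>F\<^esub> x. K +>\<^bsub>F\<^esub> (r \<odot>\<^bsub>F\<^esub> y)) = K +>\<^bsub>F\<^esub> (r \<odot>\<^bsub>F\<^esub> x)"
    by (rule UN_constant_eq[OF K.a_rcos_self[OF assms(4)]]) (intro ballI *)
  then show ?thesis by (simp only: quot_module_simps)
qed

lemma module_quot_module:
  assumes "module R F" "submodule K R F"
  shows "module R (quot_module F K)"
proof -
  interpret F: module R F by fact
  interpret K: abelian_subgroup K F by (rule abelian_subgroup_submodule) fact+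
  show ?thesis
  proof (rule module_surjective_image[OF assms(1), where \<pi> = "\<lambda>x. K +>\<^bsub>F\<^esub> x"])
    show "\<zero>\<^bsub>quot_module F K\<^esub> = K +>\<^bsub>F\<^esub> \<zero>\<^bsub>F\<^esub>"
      by (simp add: quot_module_simps F.M.a_coset_add_zero K.a_subset)
  qed (simp_all add: quot_module_simps(1,3) K.a_rcos_sum quot_module_smult[OF assms])
qed

lemma coset_map_linear:
  assumes "module R F" "submodule K R F"
  shows "(\<lambda>x. K +>\<^bsub>F\<^esub> x) \<in> lin_maps R F (quot_module F K)"
proof -
  interpret F: module R F by fact
  interpret K: abelian_subgroup K F by (rule abelian_subgroup_submodule) fact+
  show ?thesis
    by (rule lin_mapsI)
      (simp_all add: quot_module_simps(1,3) K.a_rcos_sum quot_module_smult[OF assms])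
qed

lemma quot_module_lift:
  assumes "module R F" "submodule K R F" "module R N" "h \<in> lin_maps R F N"
    and "\<And>x. x \<in> K \<Longrightarrow> h x = \<zero>\<^bsub>N\<^esub>"
  obtains k where "k \<in> lin_maps R (quot_module F K) N"
    and "\<And>x. x \<in> carrier F \<Longrightarrow> k (K +>\<^bsub>F\<^esub> x) = h x"
proof -
  interpret F: module R F by fact
  interpret N: module R N by fact
  interpret Q: module R "quot_module F K" by (rule module_quot_module[OF assms(1,2)])
  let ?\<pi> = "\<lambda>x. K +>\<^bsub>F\<^esub> x"
  have lin: "?\<pi> \<in> lin_maps R F (quot_module F K)" by (rule coset_map_linear[OF assms(1,2)])
  define k where "k X = h (SOME x. x \<in> carrier F \<and> ?\<pi> x = X)" for X
  have k: "k (?\<pi> x) = h x" if x: "x \<in> carrier F" for x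
  proof -
    define y where "y = (SOME y. y \<in> carrier F \<and> ?\<pi> y = ?\<pi> x)"
    have "\<exists>y. y \<in> carrier F \<and> ?\<pi> y = ?\<pi> x" using x by auto
    from someI_ex[OF this] have "y \<in> carrier F \<and> ?\<pi> y = ?\<pi> x" by (simp only: y_def)
    then have "y \<in> carrier F" "y \<ominus>\<^bsub>F\<^esub> x \<in> K" using coset_eq_iff[OF assms(1,2)] x by auto
    then have "h y \<ominus>\<^bsub>N\<^esub> h x = \<zero>\<^bsub>N\<^esub>"
      using assms(5) x by (simp add: lin_maps_minus[OF assms(1,3,4), symmetric])
    then have "h y = h x"
      using \<open>y \<in> carrier F\<close> x lin_maps_closed[OF assms(4)]
      by (simp add: N.M.minus_eq_zero_iff)
    then show ?thesis by (simp add: k_def y_def)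
  qed
  have "k \<in> lin_maps R (quot_module F K) N"
  proof (rule lin_mapsI)
    fix X Y assume "X \<in> carrier (quot_module F K)" "Y \<in> carrier (quot_module F K)"
    then obtain x y where "x \<in> carrier F" "y \<in> carrier F" "X = ?\<pi> x" "Y = ?\<pi> y"
      by (auto simp: quot_module_simps(1))
    then show "k (X \<oplus>\<^bsub>quot_module F K\<^esub> Y) = k X \<oplus>\<^bsub>N\<^esub> k Y"
      by (simp add: lin_maps_add[OF lin, symmetric] k lin_maps_add[OF assms(4)])
  next
    fix r X assume "r \<in> carrier R" "X \<in> carrier (quot_module F K)"
    then obtain x where "x \<in> carrier F" "X = ?\<pi> x"
      by (auto simp: quot_module_simps(1))
    then show "k (r \<odot>\<^bsub>quot_module F K\<^esub> X) = r \<odot>\<^bsub>N\<^esub> k X"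
      using \<open>r \<in> carrier R\<close>
      by (simp add: lin_maps_smult[OF lin, symmetric] k lin_maps_smult[OF assms(4)])
  qed (auto simp: quot_module_simps(1) k lin_maps_closed[OF assms(4)])
  with k that show thesis by blast
qed

lemma submodule_kernel:
  assumes "module R F" "module R N" "h \<in> lin_maps R F N"
  shows "submodule {x \<in> carrier F. h x = \<zero>\<^bsub>N\<^esub>} R F"
proof -
  interpret F: module R F by fact
  interpret N: module R N by fact
  show ?thesis
    by (rule F.submoduleI)
      (simp_all add: lin_maps_zero[OF assms] lin_maps_neg[OF assms] lin_maps_add[OF assms(3)]
        lin_maps_smult[OF assms(3)] subset_iff)
qed

lemma submodule_submodule_span:
  assumes "module R F" "S \<subseteq> carrier F"
  shows "submodule (submodule_span R F S) R F"
proof -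
  interpret F: module R F by fact
  let ?C = "{N. submodule N R F \<and> S \<subseteq> N}"
  have C: "carrier F \<in> ?C" using assms(2) F.carrier_is_submodule by auto
  show ?thesis
    unfolding submodule_span_def
  proof (rule F.submoduleI)
    show "\<Inter>?C \<subseteq> carrier F" using C by blast
    show "\<zero>\<^bsub>F\<^esub> \<in> \<Inter>?C"
      using subgroup.one_closed[OF submodule.axioms(1)] by fastforce
    show "\<ominus>\<^bsub>F\<^esub> a \<in> \<Inter>?C" if "a \<in> \<Inter>?C" for a
      using that F.submoduleE(3) by fastforce
    show "a \<oplus>\<^bsub>F\<^esub> b \<in> \<Inter>?C" if "a \<in> \<Inter>?C" "b \<in> \<Inter>?C" for a b
      using that F.submoduleE(5) by fastforce
    show "r \<odot>\<^bsub>F\<^esub> a \<in> \<Inter>?C" if "r \<in> carrier R" "a \<in> \<Inter>?C" for r a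
      using that F.submoduleE(4) by fastforce
  qed
qed

lemma submodule_span_superset: "S \<subseteq> submodule_span R F S"
  by (auto simp: submodule_span_def)

lemma submodule_span_least: "submodule N R F \<Longrightarrow> S \<subseteq> N \<Longrightarrow> submodule_span R F S \<subseteq> N"
  by (auto simp: submodule_span_def)

lemma dual_module_simps:
  "f \<in> carrier (dual_module R M) \<longleftrightarrow> f \<in> lin_maps R M (reg_module R) \<and> f \<in> extensional (carrier M)"
  "\<zero>\<^bsub>dual_module R M\<^esub> = (\<lambda>x\<in>carrier M. \<zero>\<^bsub>R\<^esub>)"
  "f \<oplus>\<^bsub>dual_module R M\<^esub> g = (\<lambda>x\<in>carrier M. f x \<oplus>\<^bsub>R\<^esub> g x)"
  "r \<odot>\<^bsub>dual_module R M\<^esub> f = (\<lambda>x\<in>carrier M. r \<otimes>\<^bsub>R\<^esub> f x)"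
  by (simp_all add: dual_module_def)

lemma dual_lin: "f \<in> carrier (dual_module R M) \<Longrightarrow> f \<in> lin_maps R M (reg_module R)"
  by (simp add: dual_module_simps)

lemma dual_closed: "f \<in> carrier (dual_module R M) \<Longrightarrow> x \<in> carrier M \<Longrightarrow> f x \<in> carrier R"
  using lin_maps_closed[OF dual_lin] by simp

lemma dual_eqI:
  assumes "f \<in> carrier (dual_module R M)" "g \<in> carrier (dual_module R M)"
    and "\<And>x. x \<in> carrier M \<Longrightarrow> f x = g x"
  shows "f = g"
  using assms by (auto simp: dual_module_simps intro: extensionalityI)

lemma restrict_in_dual:
  assumes "module R M" "h \<in> lin_maps R M (reg_module R)"
  shows "(\<lambda>x\<in>carrier M. h x) \<in> carrier (dual_module R M)"
  unfolding dual_module_simps using lin_maps_cong[OF assms(2,1)] by simp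

lemma module_dual_module:
  assumes "module R M"
  shows "module R (dual_module R M)"
proof -
  interpret M: module R M by fact
  let ?D = "dual_module R M"
  have reg: "module R (reg_module R)" by (rule module_reg_module[OF module.axioms(1)[OF assms]])
  have cl [simp]: "f x \<in> carrier R" if "f \<in> carrier ?D" "x \<in> carrier M" for f x
    using that by (rule dual_closed)
  have add: "f \<oplus>\<^bsub>?D\<^esub> g \<in> carrier ?D" if "f \<in> carrier ?D" "g \<in> carrier ?D" for f g
    using restrict_in_dual[OF assms lin_maps_sum[OF reg dual_lin[OF that(1)] dual_lin[OF that(2)]]]
    by (simp add: dual_module_simps(3))
  have smult: "r \<odot>\<^bsub>?D\<^esub> f \<in> carrier ?D" if "r \<in> carrier R" "f \<in> carrier ?D" for r f
    using restrict_in_dual[OF assms lin_maps_scaled[OF reg dual_lin[OF that(2)] that(1)]]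
    by (simp add: dual_module_simps(4))
  have ext: "f x = undefined" if "f \<in> carrier ?D" "x \<notin> carrier M" for f x
    using that by (simp add: dual_module_simps(1) extensional_def)
  have zero: "\<zero>\<^bsub>?D\<^esub> \<in> carrier ?D"
    by (auto simp: dual_module_simps(1,2) intro!: lin_mapsI)
  show ?thesis
  proof (rule moduleI)
    show "cring R" by (rule module.axioms(1)[OF assms])
    show "abelian_group ?D"
    proof (rule abelian_groupI)
      fix f assume f: "f \<in> carrier ?D"
      have "(\<ominus>\<^bsub>R\<^esub> \<one>\<^bsub>R\<^esub>) \<odot>\<^bsub>?D\<^esub> f \<oplus>\<^bsub>?D\<^esub> f = \<zero>\<^bsub>?D\<^esub>"
        using f by (auto simp: dual_module_simps(2,3,4) fun_eq_iff M.R.l_neg M.R.l_minus)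
      then show "\<exists>g\<in>carrier ?D. g \<oplus>\<^bsub>?D\<^esub> f = \<zero>\<^bsub>?D\<^esub>"
        using f by (intro bexI[of _ "(\<ominus>\<^bsub>R\<^esub> \<one>\<^bsub>R\<^esub>) \<odot>\<^bsub>?D\<^esub> f"] smult) auto
    next
      fix f assume "f \<in> carrier ?D"
      then show "\<zero>\<^bsub>?D\<^esub> \<oplus>\<^bsub>?D\<^esub> f = f"
        by (auto simp: dual_module_simps(2,3) fun_eq_iff ext)
    next
      fix f g h assume "f \<in> carrier ?D" "g \<in> carrier ?D" "h \<in> carrier ?D"
      then show "f \<oplus>\<^bsub>?D\<^esub> g \<oplus>\<^bsub>?D\<^esub> h = f \<oplus>\<^bsub>?D\<^esub> (g \<oplus>\<^bsub>?D\<^esub> h)"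
        by (simp add: dual_module_simps(3) M.R.a_assoc cong: restrict_cong)
    next
      fix f g assume "f \<in> carrier ?D" "g \<in> carrier ?D"
      then show "f \<oplus>\<^bsub>?D\<^esub> g = g \<oplus>\<^bsub>?D\<^esub> f"
        by (simp add: dual_module_simps(3) M.R.a_comm cong: restrict_cong)
    qed (fact add zero)+
  next
    fix f assume "f \<in> carrier ?D"
    then show "\<one>\<^bsub>R\<^esub> \<odot>\<^bsub>?D\<^esub> f = f"
      by (auto simp: dual_module_simps(4) fun_eq_iff ext)
  next
    fix a b f assume "a \<in> carrier R" "b \<in> carrier R" "f \<in> carrier ?D"
    then show "(a \<oplus>\<^bsub>R\<^esub> b) \<odot>\<^bsub>?D\<^esub> f = a \<odot>\<^bsub>?D\<^esub> f \<oplus>\<^bsub>?D\<^esub> b \<odot>\<^bsub>?D\<^esub> f"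
      and "(a \<otimes>\<^bsub>R\<^esub> b) \<odot>\<^bsub>?D\<^esub> f = a \<odot>\<^bsub>?D\<^esub> (b \<odot>\<^bsub>?D\<^esub> f)"
      by (simp_all add: dual_module_simps(3,4) M.R.l_distr M.R.m_assoc cong: restrict_cong)
  next
    fix a f g assume "a \<in> carrier R" "f \<in> carrier ?D" "g \<in> carrier ?D"
    then show "a \<odot>\<^bsub>?D\<^esub> (f \<oplus>\<^bsub>?D\<^esub> g) = a \<odot>\<^bsub>?D\<^esub> f \<oplus>\<^bsub>?D\<^esub> a \<odot>\<^bsub>?D\<^esub> g"
      by (simp add: dual_module_simps(3,4) M.R.r_distr cong: restrict_cong)
  qed (fact smult)
qed

lemma dual_eval_linear:
  assumes "x \<in> carrier M"
  shows "(\<lambda>f. f x) \<in> lin_maps R (dual_module R M) (reg_module R)"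
  using assms by (intro lin_mapsI) (auto simp: dual_closed dual_module_simps(3,4))

lemma dual_add_apply: "x \<in> carrier M \<Longrightarrow> (f \<oplus>\<^bsub>dual_module R M\<^esub> g) x = f x \<oplus>\<^bsub>R\<^esub> g x"
  by (simp add: dual_module_simps)

lemma dual_smult_apply: "x \<in> carrier M \<Longrightarrow> (r \<odot>\<^bsub>dual_module R M\<^esub> f) x = r \<otimes>\<^bsub>R\<^esub> f x"
  by (simp add: dual_module_simps)

lemma dual_neg_apply:
  assumes "module R M" "f \<in> carrier (dual_module R M)" "x \<in> carrier M"
  shows "(\<ominus>\<^bsub>dual_module R M\<^esub> f) x = \<ominus>\<^bsub>R\<^esub> f x"
  using lin_maps_neg[OF module_dual_module[OF assms(1)]
      module_reg_module[OF module.axioms(1)[OF assms(1)]] dual_eval_linear[OF assms(3)] assms(2)]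
  by simp

section \<open>Alternating trilinear maps\<close>

text \<open>
  Trilinearity is expressed by linear maps in each slot, so that the closure properties of linear
  maps yield those of alternating maps.
\<close>

definition alternating3 ::
  "('a, 'm) ring_scheme \<Rightarrow> ('a, 'b, 'p) module_scheme \<Rightarrow> ('a, 'c, 'q) module_scheme \<Rightarrow>
    ('b \<Rightarrow> 'b \<Rightarrow> 'b \<Rightarrow> 'c) \<Rightarrow> bool"
  where "alternating3 R M N A \<longleftrightarrow>
    (\<forall>v\<in>carrier M. \<forall>w\<in>carrier M. (\<lambda>u. A u v w) \<in> lin_maps R M N) \<and>
    (\<forall>u\<in>carrier M. \<forall>w\<in>carrier M. (\<lambda>v. A u v w) \<in> lin_maps R M N) \<and>
    (\<forall>u\<in>carrier M. \<forall>v\<in>carrier M. (\<lambda>w. A u v w) \<in> lin_maps R M N) \<and>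
    (\<forall>u\<in>carrier M. \<forall>w\<in>carrier M. A u u w = \<zero>\<^bsub>N\<^esub>) \<and>
    (\<forall>u\<in>carrier M. \<forall>v\<in>carrier M. A u v v = \<zero>\<^bsub>N\<^esub>)"

lemma alternating3D:
  assumes "alternating3 R M N A"
  shows "v \<in> carrier M \<Longrightarrow> w \<in> carrier M \<Longrightarrow> (\<lambda>u. A u v w) \<in> lin_maps R M N"
    and "u \<in> carrier M \<Longrightarrow> w \<in> carrier M \<Longrightarrow> (\<lambda>v. A u v w) \<in> lin_maps R M N"
    and "u \<in> carrier M \<Longrightarrow> v \<in> carrier M \<Longrightarrow> (\<lambda>w. A u v w) \<in> lin_maps R M N"
    and "u \<in> carrier M \<Longrightarrow> w \<in> carrier M \<Longrightarrow> A u u w = \<zero>\<^bsub>N\<^esub>"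
    and "u \<in> carrier M \<Longrightarrow> v \<in> carrier M \<Longrightarrow> A u v v = \<zero>\<^bsub>N\<^esub>"
  using assms unfolding alternating3_def by blast+

lemma alternating3_closed:
  assumes "alternating3 R M N A" "u \<in> carrier M" "v \<in> carrier M" "w \<in> carrier M"
  shows "A u v w \<in> carrier N"
  using lin_maps_closed[OF alternating3D(1)[OF assms(1,3,4)] assms(2)] .

lemma alternating_swap:
  assumes "module R M" "module R N"
    and "\<And>v. v \<in> carrier M \<Longrightarrow> (\<lambda>u. B u v) \<in> lin_maps R M N"
    and "\<And>u. u \<in> carrier M \<Longrightarrow> (\<lambda>v. B u v) \<in> lin_maps R M N"
    and "\<And>u. u \<in> carrier M \<Longrightarrow> B u u = \<zero>\<^bsub>N\<^esub>"
    and "u \<in> carrier M" "v \<in> carrier M"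
  shows "B v u = \<ominus>\<^bsub>N\<^esub> B u v"
proof -
  interpret M: module R M by fact
  interpret N: module R N by fact
  have cl: "B x y \<in> carrier N" if "x \<in> carrier M" "y \<in> carrier M" for x y
    using lin_maps_closed[OF assms(3)[OF that(2)] that(1)] .
  have "\<zero>\<^bsub>N\<^esub> = B (u \<oplus>\<^bsub>M\<^esub> v) (u \<oplus>\<^bsub>M\<^esub> v)" using assms(5-7) by simp
  also have "\<dots> = B u u \<oplus>\<^bsub>N\<^esub> B u v \<oplus>\<^bsub>N\<^esub> (B v u \<oplus>\<^bsub>N\<^esub> B v v)"
    using assms(6,7) cl
    by (simp add: lin_maps_add[OF assms(3)] lin_maps_add[OF assms(4)] N.M.a_ac)
  also have "\<dots> = B v u \<oplus>\<^bsub>N\<^esub> B u v"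
    using assms(5-7) cl by (simp add: N.M.a_comm)
  finally show ?thesis using cl assms(6,7) N.M.minus_equality[of "B v u" "B u v"] by simp
qed

lemma alternating3_swap:
  assumes "module R M" "module R N" "alternating3 R M N A"
    and "u \<in> carrier M" "v \<in> carrier M" "w \<in> carrier M"
  shows "A v u w = \<ominus>\<^bsub>N\<^esub> A u v w" and "A u w v = \<ominus>\<^bsub>N\<^esub> A u v w"
  by (rule alternating_swap[where B = "\<lambda>x y. A x y w", OF assms(1,2)],
      use assms alternating3D[OF assms(3)] in simp_all)
    (rule alternating_swap[where B = "\<lambda>x y. A u x y", OF assms(1,2)],
      use assms alternating3D[OF assms(3)] in simp_all)

lemma alternating3_cycle:
  assumes "module R M" "module R N" "alternating3 R M N A"
    and "u \<in> carrier M" "v \<in> carrier M" "w \<in> carrier M"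
  shows "A v w u = A u v w"
proof -
  interpret N: module R N by fact
  show ?thesis
    using alternating3_swap[OF assms(1-3)] alternating3_closed[OF assms(3)] assms(4-6)
    by (metis N.M.minus_minus)
qed

lemma alternating3_outer:
  assumes "module R M" "module R N" "alternating3 R M N A"
    and "u \<in> carrier M" "v \<in> carrier M"
  shows "A u v u = \<zero>\<^bsub>N\<^esub>"
  using alternating3_cycle[OF assms(1-3), of u v u] alternating3D(5)[OF assms(3), of v u] assms(4,5) by simp

lemma alternating3_comp:
  assumes "module R N" "module R P" "alternating3 R M N A" "h \<in> lin_maps R N P"
  shows "alternating3 R M P (\<lambda>u v w. h (A u v w))"
  unfolding alternating3_def
  by (intro conjI ballI lin_maps_comp[OF _ assms(4)] alternating3D(1-3)[OF assms(3)])
    (simp_all add: alternating3D(4,5)[OF assms(3)] lin_maps_zero[OF assms(1,2,4)])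

lemma alternating3_diff:
  assumes "module R M" "module R N" "alternating3 R M N A" "alternating3 R M N B"
  shows "alternating3 R M N (\<lambda>u v w. A u v w \<ominus>\<^bsub>N\<^esub> B u v w)"
proof -
  interpret N: module R N by fact
  show ?thesis
    unfolding alternating3_def
    by (intro conjI ballI lin_maps_diff[OF assms(1,2)] alternating3D(1-3)[OF assms(3)]
        alternating3D(1-3)[OF assms(4)])
      (simp_all add: alternating3D(4,5)[OF assms(3)] alternating3D(4,5)[OF assms(4)] a_minus_def)
qed

text \<open>
  This is the exterior product of an alternating bilinear form \<open>m\<close> with a linear map \<open>l\<close>. It covers both
  the right-hand side of Cramer's rule, where \<open>m = [t, -, -]\<close> and \<open>l\<close> is the identity, and
  \<open>3 \<times> 3\<close> determinants, expanded along the functional \<open>l\<close>.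
\<close>

lemma alternating3_wedge_form:
  assumes M: "module R M" and N: "module R N"
    and m1: "\<And>v. v \<in> carrier M \<Longrightarrow> (\<lambda>u. m u v) \<in> lin_maps R M (reg_module R)"
    and m2: "\<And>u. u \<in> carrier M \<Longrightarrow> (\<lambda>v. m u v) \<in> lin_maps R M (reg_module R)"
    and m0: "\<And>u. u \<in> carrier M \<Longrightarrow> m u u = \<zero>\<^bsub>R\<^esub>"
    and l: "l \<in> lin_maps R M N"
  shows "alternating3 R M N
    (\<lambda>u v w. m v w \<odot>\<^bsub>N\<^esub> l u \<oplus>\<^bsub>N\<^esub> m w u \<odot>\<^bsub>N\<^esub> l v \<oplus>\<^bsub>N\<^esub> m u v \<odot>\<^bsub>N\<^esub> l w)"
proof -
  interpret M: module R M by fact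
  interpret N: module R N by fact
  have l': "l x \<in> carrier N" if "x \<in> carrier M" for x using lin_maps_closed[OF l that] .
  have m': "m x y \<in> carrier R" if "x \<in> carrier M" "y \<in> carrier M" for x y
    using lin_maps_closed[OF m1[OF that(2)] that(1)] by simp
  have swap: "m y x = \<ominus>\<^bsub>R\<^esub> m x y" if "x \<in> carrier M" "y \<in> carrier M" for x y
    using alternating_swap[OF M module_reg_module[OF module.axioms(1)[OF M]], of m, OF m1 m2 _ that] m0
    by simp
  show ?thesis
    unfolding alternating3_def
  proof (intro conjI ballI)
    fix v w assume vw: "v \<in> carrier M" "w \<in> carrier M"
    show "(\<lambda>u. m v w \<odot>\<^bsub>N\<^esub> l u \<oplus>\<^bsub>N\<^esub> m w u \<odot>\<^bsub>N\<^esub> l v \<oplus>\<^bsub>N\<^esub> m u v \<odot>\<^bsub>N\<^esub> l w) \<in> lin_maps R M N"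
      using vw by (intro lin_maps_sum[OF N] lin_maps_scaled[OF N] lin_maps_scalar[OF N] l l' m' m1 m2)
    show "(\<lambda>u. m u w \<odot>\<^bsub>N\<^esub> l v \<oplus>\<^bsub>N\<^esub> m w v \<odot>\<^bsub>N\<^esub> l u \<oplus>\<^bsub>N\<^esub> m v u \<odot>\<^bsub>N\<^esub> l w) \<in> lin_maps R M N"
      using vw by (intro lin_maps_sum[OF N] lin_maps_scaled[OF N] lin_maps_scalar[OF N] l l' m' m1 m2)
    show "(\<lambda>u. m w u \<odot>\<^bsub>N\<^esub> l v \<oplus>\<^bsub>N\<^esub> m u v \<odot>\<^bsub>N\<^esub> l w \<oplus>\<^bsub>N\<^esub> m v w \<odot>\<^bsub>N\<^esub> l u) \<in> lin_maps R M N"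
      using vw by (intro lin_maps_sum[OF N] lin_maps_scaled[OF N] lin_maps_scalar[OF N] l l' m' m1 m2)
    show "m v w \<odot>\<^bsub>N\<^esub> l v \<oplus>\<^bsub>N\<^esub> m w v \<odot>\<^bsub>N\<^esub> l v \<oplus>\<^bsub>N\<^esub> m v v \<odot>\<^bsub>N\<^esub> l w = \<zero>\<^bsub>N\<^esub>"
      using vw by (simp add: swap[of v w] m0 l' m' N.smult_l_minus N.M.r_neg)
    show "m w w \<odot>\<^bsub>N\<^esub> l v \<oplus>\<^bsub>N\<^esub> m w v \<odot>\<^bsub>N\<^esub> l w \<oplus>\<^bsub>N\<^esub> m v w \<odot>\<^bsub>N\<^esub> l w = \<zero>\<^bsub>N\<^esub>"
      using vw by (simp add: swap[of v w] m0 l' m' N.smult_l_minus N.M.l_neg)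
  qed
qed

section \<open>The third exterior power\<close>

lemma module_free_triples: "module R M \<Longrightarrow> module R (free_module R (ext3_triples M))"
  by (rule module_free_module) (rule module.axioms)

lemma triple_gen_closed:
  assumes "module R M" "u \<in> carrier M" "v \<in> carrier M" "w \<in> carrier M"
  shows "free_gen R (ext3_triples M) (u, v, w) \<in> carrier (free_module R (ext3_triples M))"
  using assms by (intro free_gen_closed) (auto simp: ext3_triples_def module_def)

lemma ext3_relators_subset:
  assumes "module R M"
  shows "ext3_relators R M \<subseteq> carrier (free_module R (ext3_triples M))"
proof -
  interpret M: module R M by fact
  interpret F: module R "free_module R (ext3_triples M)" by (rule module_free_triples[OF assms])
  show ?thesis
    unfolding ext3_relators_def Let_def using triple_gen_closed[OF assms] by auto
qed

lemma ext3_relatorsI: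
  shows "u \<in> carrier M \<Longrightarrow> u' \<in> carrier M \<Longrightarrow> v \<in> carrier M \<Longrightarrow> w \<in> carrier M \<Longrightarrow>
      free_gen R (ext3_triples M) (u \<oplus>\<^bsub>M\<^esub> u', v, w) \<ominus>\<^bsub>free_module R (ext3_triples M)\<^esub> (free_gen R (ext3_triples M) (u, v, w) \<oplus>\<^bsub>free_module R (ext3_triples M)\<^esub> free_gen R (ext3_triples M) (u', v, w)) \<in> ext3_relators R M"
    and "u \<in> carrier M \<Longrightarrow> v \<in> carrier M \<Longrightarrow> v' \<in> carrier M \<Longrightarrow> w \<in> carrier M \<Longrightarrow>
      free_gen R (ext3_triples M) (u, v \<oplus>\<^bsub>M\<^esub> v', w) \<ominus>\<^bsub>free_module R (ext3_triples M)\<^esub> (free_gen R (ext3_triples M) (u, v, w) \<oplus>\<^bsub>free_module R (ext3_triples M)\<^esub> free_gen R (ext3_triples M) (u, v', w)) \<in> ext3_relators R M"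
    and "u \<in> carrier M \<Longrightarrow> v \<in> carrier M \<Longrightarrow> w \<in> carrier M \<Longrightarrow> w' \<in> carrier M \<Longrightarrow>
      free_gen R (ext3_triples M) (u, v, w \<oplus>\<^bsub>M\<^esub> w') \<ominus>\<^bsub>free_module R (ext3_triples M)\<^esub> (free_gen R (ext3_triples M) (u, v, w) \<oplus>\<^bsub>free_module R (ext3_triples M)\<^esub> free_gen R (ext3_triples M) (u, v, w')) \<in> ext3_relators R M"
    and "r \<in> carrier R \<Longrightarrow> u \<in> carrier M \<Longrightarrow> v \<in> carrier M \<Longrightarrow> w \<in> carrier M \<Longrightarrow>
      free_gen R (ext3_triples M) (r \<odot>\<^bsub>M\<^esub> u, v, w) \<ominus>\<^bsub>free_module R (ext3_triples M)\<^esub> r \<odot>\<^bsub>free_module R (ext3_triples M)\<^esub> free_gen R (ext3_triples M) (u, v, w) \<in> ext3_relators R M"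
    and "r \<in> carrier R \<Longrightarrow> u \<in> carrier M \<Longrightarrow> v \<in> carrier M \<Longrightarrow> w \<in> carrier M \<Longrightarrow>
      free_gen R (ext3_triples M) (u, r \<odot>\<^bsub>M\<^esub> v, w) \<ominus>\<^bsub>free_module R (ext3_triples M)\<^esub> r \<odot>\<^bsub>free_module R (ext3_triples M)\<^esub> free_gen R (ext3_triples M) (u, v, w) \<in> ext3_relators R M"
    and "r \<in> carrier R \<Longrightarrow> u \<in> carrier M \<Longrightarrow> v \<in> carrier M \<Longrightarrow> w \<in> carrier M \<Longrightarrow>
      free_gen R (ext3_triples M) (u, v, r \<odot>\<^bsub>M\<^esub> w) \<ominus>\<^bsub>free_module R (ext3_triples M)\<^esub> r \<odot>\<^bsub>free_module R (ext3_triples M)\<^esub> free_gen R (ext3_triples M) (u, v, w) \<in> ext3_relators R M"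
    and "u \<in> carrier M \<Longrightarrow> w \<in> carrier M \<Longrightarrow>
      free_gen R (ext3_triples M) (u, u, w) \<in> ext3_relators R M"
    and "u \<in> carrier M \<Longrightarrow> v \<in> carrier M \<Longrightarrow>
      free_gen R (ext3_triples M) (u, v, v) \<in> ext3_relators R M"
  unfolding ext3_relators_def Let_def
    apply ((rule UnI1)+, intro CollectI exI conjI; (rule refl | assumption))
    apply (rule UnI1, rule UnI1, rule UnI1, rule UnI1, rule UnI1, rule UnI1, rule UnI2, intro CollectI exI conjI; (rule refl | assumption))
    apply (rule UnI1, rule UnI1, rule UnI1, rule UnI1, rule UnI1, rule UnI2, intro CollectI exI conjI; (rule refl | assumption))
    apply (rule UnI1, rule UnI1, rule UnI1, rule UnI1, rule UnI2, intro CollectI exI conjI; (rule refl | assumption))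
    apply (rule UnI1, rule UnI1, rule UnI1, rule UnI2, intro CollectI exI conjI; (rule refl | assumption))
    apply (rule UnI1, rule UnI1, rule UnI2, intro CollectI exI conjI; (rule refl | assumption))
    apply (rule UnI1, rule UnI2, intro CollectI exI conjI; (rule refl | assumption))
    apply (rule UnI2, intro CollectI exI conjI; (rule refl | assumption))
  done

lemma submodule_ext3_kernel:
  "module R M \<Longrightarrow> submodule (ext3_kernel R M) R (free_module R (ext3_triples M))"
  unfolding ext3_kernel_def
  by (intro submodule_submodule_span module_free_triples ext3_relators_subset)

lemma module_ext3: "module R M \<Longrightarrow> module R (ext3 R M)"
  unfolding ext3_def by (intro module_quot_module module_free_triples submodule_ext3_kernel)

lemma wedge3_alternating:
  assumes M: "module R M"
  shows "alternating3 R M (ext3 R M) (wedge3 R M)"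
proof -
  let ?F = "free_module R (ext3_triples M)" and ?K = "ext3_kernel R M"
  let ?d = "\<lambda>u v w. free_gen R (ext3_triples M) (u, v, w)"
  interpret M: module R M by fact
  interpret F: module R ?F by (rule module_free_triples[OF M])
  have K: "submodule ?K R ?F" by (rule submodule_ext3_kernel[OF M])
  interpret K: abelian_subgroup ?K ?F
    by (rule abelian_subgroup_submodule[OF module_free_triples[OF M] K])
  have lin: "(\<lambda>x. ?K +>\<^bsub>?F\<^esub> x) \<in> lin_maps R ?F (ext3 R M)"
    unfolding ext3_def by (rule coset_map_linear[OF module_free_triples[OF M] K])
  note d = triple_gen_closed[OF M]
  have rel: "r \<in> ?K" if "r \<in> ext3_relators R M" for r
    unfolding ext3_kernel_def by (rule subsetD[OF submodule_span_superset that])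
  have eqI: "?K +>\<^bsub>?F\<^esub> x = ?K +>\<^bsub>?F\<^esub> y"
    if "x \<ominus>\<^bsub>?F\<^esub> y \<in> ext3_relators R M" "x \<in> carrier ?F" "y \<in> carrier ?F" for x y
    using coset_eq_iff[OF module_free_triples[OF M] K that(2,3)] rel[OF that(1)] by simp
  have zero: "?K +>\<^bsub>?F\<^esub> x = \<zero>\<^bsub>ext3 R M\<^esub>" if "x \<in> ext3_relators R M" for x
    using K.a_rcos_const[OF rel[OF that]] by (simp add: ext3_def quot_module_simps)
  have cl: "wedge3 R M u v w \<in> carrier (ext3 R M)"
    if "u \<in> carrier M" "v \<in> carrier M" "w \<in> carrier M" for u v w
    unfolding wedge3_def using lin_maps_closed[OF lin] d that by simp
  have add: "wedge3 R M x y z = wedge3 R M u v w \<oplus>\<^bsub>ext3 R M\<^esub> wedge3 R M u' v' w'"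
    if "?d x y z \<ominus>\<^bsub>?F\<^esub> (?d u v w \<oplus>\<^bsub>?F\<^esub> ?d u' v' w') \<in> ext3_relators R M"
      "x \<in> carrier M" "y \<in> carrier M" "z \<in> carrier M" "u \<in> carrier M" "v \<in> carrier M" "w \<in> carrier M"
      "u' \<in> carrier M" "v' \<in> carrier M" "w' \<in> carrier M" for x y z u v w u' v' w'
    unfolding wedge3_def using that d
    by (simp add: lin_maps_add[OF lin, symmetric] eqI)
  have smult: "wedge3 R M x y z = r \<odot>\<^bsub>ext3 R M\<^esub> wedge3 R M u v w"
    if "?d x y z \<ominus>\<^bsub>?F\<^esub> r \<odot>\<^bsub>?F\<^esub> ?d u v w \<in> ext3_relators R M" "r \<in> carrier R"
      "x \<in> carrier M" "y \<in> carrier M" "z \<in> carrier M" "u \<in> carrier M" "v \<in> carrier M" "w \<in> carrier M"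
    for r x y z u v w
    unfolding wedge3_def using that d
    by (simp add: lin_maps_smult[OF lin, symmetric] eqI)
  show ?thesis
    unfolding alternating3_def
  proof (intro conjI ballI)
    fix v w assume vw: "v \<in> carrier M" "w \<in> carrier M"
    show "(\<lambda>u. wedge3 R M u v w) \<in> lin_maps R M (ext3 R M)"
      using vw by (intro lin_mapsI cl add smult ext3_relatorsI) auto
    show "(\<lambda>u. wedge3 R M v u w) \<in> lin_maps R M (ext3 R M)"
      using vw by (intro lin_mapsI cl add smult ext3_relatorsI) auto
    show "(\<lambda>u. wedge3 R M v w u) \<in> lin_maps R M (ext3 R M)"
      using vw by (intro lin_mapsI cl add smult ext3_relatorsI) auto
    show "wedge3 R M v v w = \<zero>\<^bsub>ext3 R M\<^esub>"
      unfolding wedge3_def using vw by (intro zero ext3_relatorsI)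
    show "wedge3 R M v w w = \<zero>\<^bsub>ext3 R M\<^esub>"
      unfolding wedge3_def using vw by (intro zero ext3_relatorsI)
  qed
qed

lemma wedge3_closed:
  assumes "module R M" "u \<in> carrier M" "v \<in> carrier M" "w \<in> carrier M"
  shows "wedge3 R M u v w \<in> carrier (ext3 R M)"
  by (rule alternating3_closed[OF wedge3_alternating]) fact+

text \<open>
  Lift to the free module on all triples, which is generated by the triples themselves.
\<close>

lemma ext3_induct:
  assumes M: "module R M" and \<xi>: "\<xi> \<in> carrier (ext3 R M)"
    and wedge: "\<And>u v w. u \<in> carrier M \<Longrightarrow> v \<in> carrier M \<Longrightarrow> w \<in> carrier M \<Longrightarrow> P (wedge3 R M u v w)"
    and zero: "P \<zero>\<^bsub>ext3 R M\<^esub>"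
    and add: "\<And>\<xi> \<eta>. \<xi> \<in> carrier (ext3 R M) \<Longrightarrow> \<eta> \<in> carrier (ext3 R M) \<Longrightarrow> P \<xi> \<Longrightarrow> P \<eta> \<Longrightarrow>
       P (\<xi> \<oplus>\<^bsub>ext3 R M\<^esub> \<eta>)"
    and smult: "\<And>r \<xi>. r \<in> carrier R \<Longrightarrow> \<xi> \<in> carrier (ext3 R M) \<Longrightarrow> P \<xi> \<Longrightarrow> P (r \<odot>\<^bsub>ext3 R M\<^esub> \<xi>)"
  shows "P \<xi>"
proof -
  let ?F = "free_module R (ext3_triples M)" and ?K = "ext3_kernel R M"
  interpret F: module R ?F by (rule module_free_triples[OF M])
  have K: "submodule ?K R ?F" by (rule submodule_ext3_kernel[OF M])
  have lin: "(\<lambda>x. ?K +>\<^bsub>?F\<^esub> x) \<in> lin_maps R ?F (ext3 R M)"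
    unfolding ext3_def by (rule coset_map_linear[OF module_free_triples[OF M] K])
  obtain f where f: "f \<in> carrier ?F" "\<xi> = ?K +>\<^bsub>?F\<^esub> f"
    using \<xi> unfolding ext3_def quot_module_simps(1) by auto
  have "P (?K +>\<^bsub>?F\<^esub> f)"
  proof (rule free_module_induct[OF module.axioms(1)[OF M] f(1)])
    show "P (?K +>\<^bsub>?F\<^esub> \<zero>\<^bsub>?F\<^esub>)"
      using zero lin_maps_zero[OF module_free_triples[OF M] module_ext3[OF M] lin] by simp
    fix r x g assume r: "r \<in> carrier R" and x: "x \<in> ext3_triples M"
      and g: "g \<in> carrier ?F" "P (?K +>\<^bsub>?F\<^esub> g)"
    obtain u v w where x': "x = (u, v, w)" "u \<in> carrier M" "v \<in> carrier M" "w \<in> carrier M"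
      using x by (auto simp: ext3_triples_def)
    have "P (r \<odot>\<^bsub>ext3 R M\<^esub> wedge3 R M u v w \<oplus>\<^bsub>ext3 R M\<^esub> (?K +>\<^bsub>?F\<^esub> g))"
      using r x' g lin_maps_closed[OF lin] wedge3_closed[OF M] module.smult_closed[OF module_ext3[OF M]]
      by (intro add smult wedge) auto
    then show "P (?K +>\<^bsub>?F\<^esub> (r \<odot>\<^bsub>?F\<^esub> free_gen R (ext3_triples M) x \<oplus>\<^bsub>?F\<^esub> g))"
      using r x' g triple_gen_closed[OF M]
      by (simp add: lin_maps_add[OF lin] lin_maps_smult[OF lin] wedge3_def)
  qed
  then show ?thesis using f by simp
qed

text \<open>
  The universal property: the linear extension of \<open>A\<close> to the free module on all triples kills each
  relator, since each relator states one of the properties of an alternating trilinear map.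
\<close>

lemma ext3_lift:
  assumes M: "module R M" and N: "module R N" and A: "alternating3 R M N A"
  obtains h where "h \<in> lin_maps R (ext3 R M) N"
    and "\<And>u v w. u \<in> carrier M \<Longrightarrow> v \<in> carrier M \<Longrightarrow> w \<in> carrier M \<Longrightarrow> h (wedge3 R M u v w) = A u v w"
proof -
  let ?X = "ext3_triples M" and ?F = "free_module R (ext3_triples M)" and ?K = "ext3_kernel R M"
  let ?d = "\<lambda>u v w. free_gen R (ext3_triples M) (u, v, w)"
  interpret M: module R M by fact
  interpret N: module R N by fact
  interpret F: module R ?F by (rule module_free_triples[OF M])
  let ?A = "\<lambda>(u, v, w). A u v w" and ?L = "free_lift R ?X N (\<lambda>(u, v, w). A u v w)"
  note cl = alternating3_closed[OF A]
  have A': "?A \<in> ?X \<rightarrow> carrier N" using cl by (auto simp: ext3_triples_def)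
  have L: "?L \<in> lin_maps R ?F N" by (rule free_lift_linear[OF N A'])
  have gen: "?L (?d u v w) = A u v w" if "u \<in> carrier M" "v \<in> carrier M" "w \<in> carrier M" for u v w
    using free_lift_gen[OF N A', of "(u, v, w)"] that by (simp add: ext3_triples_def)
  note lin = alternating3D(1-3)[OF A]
  note simps = triple_gen_closed[OF M] gen lin_maps_minus[OF module_free_triples[OF M] N L]
    lin_maps_add[OF L] lin_maps_smult[OF L]
    lin_maps_add[OF lin(1)] lin_maps_add[OF lin(2)] lin_maps_add[OF lin(3)]
    lin_maps_smult[OF lin(1)] lin_maps_smult[OF lin(2)] lin_maps_smult[OF lin(3)]
    alternating3D(4,5)[OF A] cl N.M.r_neg
  have "?L x = \<zero>\<^bsub>N\<^esub>" if "x \<in> ext3_relators R M" for x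
    using that unfolding ext3_relators_def Let_def
    by (elim UnE CollectE exE conjE; hypsubst)
      (simp_all add: simps N.M.minus_eq_zero_iff)
  then have "ext3_relators R M \<subseteq> {x \<in> carrier ?F. ?L x = \<zero>\<^bsub>N\<^esub>}"
    using ext3_relators_subset[OF M] by auto
  then have "?K \<subseteq> {x \<in> carrier ?F. ?L x = \<zero>\<^bsub>N\<^esub>}"
    unfolding ext3_kernel_def
    by (intro submodule_span_least submodule_kernel[OF module_free_triples[OF M] N L])
  then have "x \<in> ?K \<Longrightarrow> ?L x = \<zero>\<^bsub>N\<^esub>" for x by auto
  from quot_module_lift[OF module_free_triples[OF M] submodule_ext3_kernel[OF M] N L this]
  obtain k where "k \<in> lin_maps R (ext3 R M) N"
    and "\<And>x. x \<in> carrier ?F \<Longrightarrow> k (?K +>\<^bsub>?F\<^esub> x) = ?L x"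
    unfolding ext3_def by blast
  then show thesis
    by (intro that[of k]) (simp_all add: wedge3_def gen triple_gen_closed[OF M])
qed

lemma ext3_linear_eq:
  assumes M: "module R M" and N: "module R N"
    and h: "h \<in> lin_maps R (ext3 R M) N" and k: "k \<in> lin_maps R (ext3 R M) N"
    and eq: "\<And>u v w. u \<in> carrier M \<Longrightarrow> v \<in> carrier M \<Longrightarrow> w \<in> carrier M \<Longrightarrow>
      h (wedge3 R M u v w) = k (wedge3 R M u v w)"
    and "\<xi> \<in> carrier (ext3 R M)"
  shows "h \<xi> = k \<xi>"
  using M \<open>\<xi> \<in> carrier (ext3 R M)\<close>
  by (rule ext3_induct)
    (simp_all add: eq lin_maps_zero[OF module_ext3[OF M] N] h k lin_maps_add[OF h] lin_maps_add[OF k]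
      lin_maps_smult[OF h] lin_maps_smult[OF k])

section \<open>Volume forms and Cramer's rule\<close>

lemma submodule_zero:
  assumes "module R N"
  shows "submodule {\<zero>\<^bsub>N\<^esub>} R N"
proof -
  interpret N: module R N by fact
  show ?thesis by (rule N.submoduleI) auto
qed

lemma submodule_image:
  assumes M: "module R M" and N: "module R N" and h: "h \<in> lin_maps R M N"
  shows "submodule (h ` carrier M) R N"
proof -
  interpret M: module R M by fact
  interpret N: module R N by fact
  show ?thesis
  proof (rule N.submoduleI)
    show "h ` carrier M \<subseteq> carrier N" using lin_maps_closed[OF h] by auto
    show "\<zero>\<^bsub>N\<^esub> \<in> h ` carrier M"
      by (rule image_eqI[of _ _ "\<zero>\<^bsub>M\<^esub>"]) (simp_all add: lin_maps_zero[OF M N h])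
  next
    fix a assume "a \<in> h ` carrier M"
    then obtain x where x: "x \<in> carrier M" "a = h x" by auto
    then show "\<ominus>\<^bsub>N\<^esub> a \<in> h ` carrier M"
      by (intro image_eqI[of _ _ "\<ominus>\<^bsub>M\<^esub> x"]) (simp_all add: lin_maps_neg[OF M N h])
  next
    fix a b assume "a \<in> h ` carrier M" "b \<in> h ` carrier M"
    then obtain x y where "x \<in> carrier M" "a = h x" "y \<in> carrier M" "b = h y" by auto
    then show "a \<oplus>\<^bsub>N\<^esub> b \<in> h ` carrier M"
      by (intro image_eqI[of _ _ "x \<oplus>\<^bsub>M\<^esub> y"]) (simp_all add: lin_maps_add[OF h])
  next
    fix r a assume r: "r \<in> carrier R" and "a \<in> h ` carrier M"
    then obtain x where "x \<in> carrier M" "a = h x" by auto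
    then show "r \<odot>\<^bsub>N\<^esub> a \<in> h ` carrier M"
      using r by (intro image_eqI[of _ _ "r \<odot>\<^bsub>M\<^esub> x"]) (simp_all add: lin_maps_smult[OF h])
  qed
qed

lemma (in cring) ideal_if_closed:
  assumes "J \<subseteq> carrier R" "\<zero> \<in> J"
    and add: "\<And>x y. x \<in> J \<Longrightarrow> y \<in> J \<Longrightarrow> x \<oplus> y \<in> J"
    and mult: "\<And>r x. r \<in> carrier R \<Longrightarrow> x \<in> J \<Longrightarrow> r \<otimes> x \<in> J"
  shows "ideal J R"
proof (rule idealI)
  show "ring R" by (rule ring_axioms)
  have "\<ominus> x \<in> J" if "x \<in> J" for x
    using mult[of "\<ominus> \<one>" x] that assms(1) by (auto simp: l_minus subset_iff)
  then show "subgroup J (add_monoid R)"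
    using assms by (intro add.subgroupI) (auto simp: a_inv_def[symmetric])
  show "r \<otimes> x \<in> J" if "x \<in> J" "r \<in> carrier R" for x r by (rule mult[OF that(2,1)])
  show "x \<otimes> r \<in> J" if "x \<in> J" "r \<in> carrier R" for x r
    using mult[OF that(2,1)] that assms(1) m_comm by (metis subset_iff)
qed

locale volume_module = module R T
  for R :: "('a, 'm) ring_scheme" (structure) and T :: "('a, 'b, 'p) module_scheme" (structure) +
  fixes \<alpha> :: "('b \<times> 'b \<times> 'b \<Rightarrow> 'a) set \<Rightarrow> 'a"
  assumes volume_iso: "\<alpha> \<in> lin_isos R (ext3 R T) (reg_module R)"
begin

definition vol :: "'b \<Rightarrow> 'b \<Rightarrow> 'b \<Rightarrow> 'a"
  where "vol u v w = \<alpha> (wedge3 R T u v w)"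

lemma cring_R: "cring R" and module_T: "module R T" and module_R: "module R (reg_module R)"
  using module_axioms by (simp_all add: module.axioms module_reg_module)

lemma volume_linear: "\<alpha> \<in> lin_maps R (ext3 R T) (reg_module R)"
  and volume_bij: "bij_betw \<alpha> (carrier (ext3 R T)) (carrier R)"
  using volume_iso by (simp_all add: lin_isos_def)

lemma vol_alternating: "alternating3 R T (reg_module R) vol"
  using alternating3_comp[OF module_ext3[OF module_T] module_R wedge3_alternating[OF module_T]
      volume_linear]
  by (simp add: vol_def[abs_def])

lemma vol_closed [simp]:
  "u \<in> carrier T \<Longrightarrow> v \<in> carrier T \<Longrightarrow> w \<in> carrier T \<Longrightarrow> vol u v w \<in> carrier R"
  using alternating3_closed[OF vol_alternating] by simp

lemma vol_degenerate [simp]: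
  assumes "u \<in> carrier T" "v \<in> carrier T"
  shows "vol u u v = \<zero>\<^bsub>R\<^esub>" "vol u v v = \<zero>\<^bsub>R\<^esub>" "vol u v u = \<zero>\<^bsub>R\<^esub>"
  using alternating3D(4,5)[OF vol_alternating] alternating3_outer[OF module_T module_R vol_alternating]
    assms by simp_all

lemma vol_swap:
  assumes "u \<in> carrier T" "v \<in> carrier T" "w \<in> carrier T"
  shows "vol v u w = \<ominus>\<^bsub>R\<^esub> vol u v w" "vol u w v = \<ominus>\<^bsub>R\<^esub> vol u v w"
  using alternating3_swap[OF module_T module_R vol_alternating assms] by simp_all

lemma vol_cycle:
  assumes "u \<in> carrier T" "v \<in> carrier T" "w \<in> carrier T"
  shows "vol v w u = vol u v w"
  using alternating3_cycle[OF module_T module_R vol_alternating assms] by simp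

text \<open>
  The radical of \<open>J\<close> contains all \<open>[u, v, w]\<close>, hence all values of \<open>\<alpha>\<close>, among them the unit. Instead of
  the radical itself the proof uses a larger set that is visibly closed under addition: the elements
  \<open>a\<close> such that every nonzero element of \<open>R/J\<close> has a nonzero multiple killed by \<open>a\<close>. For a sum
  \<open>a + b\<close> one takes such a multiple for \<open>a\<close> and then, inside the submodule that it generates, one for
  \<open>b\<close>. If the unit belongs to this set, then \<open>R/J = 0\<close>.
\<close>

lemma volume_powers_generate:
  assumes "ideal J R"
    and pow: "\<And>u v w. u \<in> carrier T \<Longrightarrow> v \<in> carrier T \<Longrightarrow> w \<in> carrier T \<Longrightarrow> vol u v w [^]\<^bsub>R\<^esub> (n::nat) \<in> J"
  shows "\<one>\<^bsub>R\<^esub> \<in> J"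
proof -
  interpret J: ideal J R by fact
  define good where "good a \<longleftrightarrow>
    (\<forall>x\<in>carrier R - J. \<exists>r\<in>carrier R. r \<otimes>\<^bsub>R\<^esub> x \<notin> J \<and> a \<otimes>\<^bsub>R\<^esub> (r \<otimes>\<^bsub>R\<^esub> x) \<in> J)" for a
  have nilpotent: "good a" if a: "a \<in> carrier R" "a [^]\<^bsub>R\<^esub> n \<in> J" for a
    unfolding good_def
  proof
    fix x assume x: "x \<in> carrier R - J"
    have "a [^]\<^bsub>R\<^esub> n \<otimes>\<^bsub>R\<^esub> x \<in> J" using a x J.I_r_closed by auto
    moreover have "a [^]\<^bsub>R\<^esub> (0::nat) \<otimes>\<^bsub>R\<^esub> x \<notin> J" using x by simp
    \<comment> \<open>The last power of \<open>a\<close> that does not yet move \<open>x\<close> into \<open>J\<close>.\<close>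
    ultimately obtain k where k: "a [^]\<^bsub>R\<^esub> k \<otimes>\<^bsub>R\<^esub> x \<notin> J" "a [^]\<^bsub>R\<^esub> Suc k \<otimes>\<^bsub>R\<^esub> x \<in> J"
      using dec_induct[of 0 n "\<lambda>k. a [^]\<^bsub>R\<^esub> k \<otimes>\<^bsub>R\<^esub> x \<notin> J"] by blast
    have "a [^]\<^bsub>R\<^esub> Suc k \<otimes>\<^bsub>R\<^esub> x = a \<otimes>\<^bsub>R\<^esub> (a [^]\<^bsub>R\<^esub> k \<otimes>\<^bsub>R\<^esub> x)"
      using a x by (subst R.nat_pow_Suc2) (auto simp: R.m_assoc)
    with k show "\<exists>r\<in>carrier R. r \<otimes>\<^bsub>R\<^esub> x \<notin> J \<and> a \<otimes>\<^bsub>R\<^esub> (r \<otimes>\<^bsub>R\<^esub> x) \<in> J"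
      using a by (intro bexI[of _ "a [^]\<^bsub>R\<^esub> k"]) auto
  qed
  have add: "good (a \<oplus>\<^bsub>R\<^esub> b)" if "good a" "good b" "a \<in> carrier R" "b \<in> carrier R" for a b
    unfolding good_def
  proof
    fix x assume x: "x \<in> carrier R - J"
    obtain r where r: "r \<in> carrier R" "r \<otimes>\<^bsub>R\<^esub> x \<notin> J" "a \<otimes>\<^bsub>R\<^esub> (r \<otimes>\<^bsub>R\<^esub> x) \<in> J"
      using \<open>good a\<close> x unfolding good_def by blast
    obtain s where s: "s \<in> carrier R" "s \<otimes>\<^bsub>R\<^esub> (r \<otimes>\<^bsub>R\<^esub> x) \<notin> J" "b \<otimes>\<^bsub>R\<^esub> (s \<otimes>\<^bsub>R\<^esub> (r \<otimes>\<^bsub>R\<^esub> x)) \<in> J"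
      using \<open>good b\<close> x r unfolding good_def by (metis Diff_iff R.m_closed)
    have "(a \<oplus>\<^bsub>R\<^esub> b) \<otimes>\<^bsub>R\<^esub> (s \<otimes>\<^bsub>R\<^esub> (r \<otimes>\<^bsub>R\<^esub> x))
      = s \<otimes>\<^bsub>R\<^esub> (a \<otimes>\<^bsub>R\<^esub> (r \<otimes>\<^bsub>R\<^esub> x)) \<oplus>\<^bsub>R\<^esub> b \<otimes>\<^bsub>R\<^esub> (s \<otimes>\<^bsub>R\<^esub> (r \<otimes>\<^bsub>R\<^esub> x))"
      using that r s x by (simp add: R.l_distr R.m_lcomm[of s a])
    also have "\<dots> \<in> J" using J.I_l_closed[OF r(3) s(1)] s(3) by (rule J.a_closed)
    finally show "\<exists>r\<in>carrier R. r \<otimes>\<^bsub>R\<^esub> x \<notin> J \<and> (a \<oplus>\<^bsub>R\<^esub> b) \<otimes>\<^bsub>R\<^esub> (r \<otimes>\<^bsub>R\<^esub> x) \<in> J"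
      using r s x by (intro bexI[of _ "s \<otimes>\<^bsub>R\<^esub> r"]) (auto simp: R.m_assoc)
  qed
  have mult: "good (c \<otimes>\<^bsub>R\<^esub> a)" if "good a" "c \<in> carrier R" "a \<in> carrier R" for c a
    unfolding good_def
  proof
    fix x assume x: "x \<in> carrier R - J"
    obtain r where r: "r \<in> carrier R" "r \<otimes>\<^bsub>R\<^esub> x \<notin> J" "a \<otimes>\<^bsub>R\<^esub> (r \<otimes>\<^bsub>R\<^esub> x) \<in> J"
      using \<open>good a\<close> x unfolding good_def by blast
    then show "\<exists>r\<in>carrier R. r \<otimes>\<^bsub>R\<^esub> x \<notin> J \<and> (c \<otimes>\<^bsub>R\<^esub> a) \<otimes>\<^bsub>R\<^esub> (r \<otimes>\<^bsub>R\<^esub> x) \<in> J"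
      using that x J.I_l_closed[OF r(3) that(2)] by (intro bexI[of _ r]) (auto simp: R.m_assoc)
  qed
  note \<alpha>_closed = lin_maps_closed[OF volume_linear, unfolded reg_module_simps]
  have "good (\<alpha> \<xi>)" if "\<xi> \<in> carrier (ext3 R T)" for \<xi>
    using module_T that
  proof (rule ext3_induct)
    show "good (\<alpha> (wedge3 R T u v w))" if "u \<in> carrier T" "v \<in> carrier T" "w \<in> carrier T" for u v w
      using nilpotent[OF vol_closed pow, OF that that] by (simp add: vol_def)
    have "good \<zero>\<^bsub>R\<^esub>"
      unfolding good_def by (intro ballI bexI[of _ "\<one>\<^bsub>R\<^esub>"]) auto
    then show "good (\<alpha> \<zero>\<^bsub>ext3 R T\<^esub>)"
      by (simp add: lin_maps_zero[OF module_ext3[OF module_T] module_R volume_linear])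
  qed (simp_all add: lin_maps_add[OF volume_linear] lin_maps_smult[OF volume_linear] add mult \<alpha>_closed)
  moreover obtain \<xi> where "\<xi> \<in> carrier (ext3 R T)" "\<alpha> \<xi> = \<one>\<^bsub>R\<^esub>"
    using volume_bij R.one_closed unfolding bij_betw_def by (metis imageE)
  ultimately have "good \<one>\<^bsub>R\<^esub>" by metis
  then show ?thesis unfolding good_def by force
qed

text \<open>
  The scalars that move \<open>y\<close> into \<open>S\<close> form an ideal.
\<close>

lemma local_membership:
  assumes N: "module R N" and S: "submodule S R N" and y: "y \<in> carrier N"
    and pow: "\<And>u v w. u \<in> carrier T \<Longrightarrow> v \<in> carrier T \<Longrightarrow> w \<in> carrier T \<Longrightarrow>
      (vol u v w [^]\<^bsub>R\<^esub> (n::nat)) \<odot>\<^bsub>N\<^esub> y \<in> S"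
  shows "y \<in> S"
proof -
  interpret N: module R N by fact
  have "\<one>\<^bsub>R\<^esub> \<in> {r \<in> carrier R. r \<odot>\<^bsub>N\<^esub> y \<in> S}"
  proof (rule volume_powers_generate[where n = n])
    show "ideal {r \<in> carrier R. r \<odot>\<^bsub>N\<^esub> y \<in> S} R"
      using y N.submoduleE(4,5)[OF S] subgroup.one_closed[OF submodule.axioms(1)[OF S]]
      by (intro R.ideal_if_closed) (auto simp: N.smult_l_distr N.smult_assoc1)
  qed (simp add: pow)
  then show ?thesis using y by simp
qed

lemma vol_cancel:
  assumes N: "module R N" and "x \<in> carrier N" "y \<in> carrier N"
    and eq: "\<And>u v w. u \<in> carrier T \<Longrightarrow> v \<in> carrier T \<Longrightarrow> w \<in> carrier T \<Longrightarrow>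
      vol u v w \<odot>\<^bsub>N\<^esub> x = vol u v w \<odot>\<^bsub>N\<^esub> y"
  shows "x = y"
proof -
  interpret N: module R N by fact
  have "x \<ominus>\<^bsub>N\<^esub> y \<in> {\<zero>\<^bsub>N\<^esub>}"
  proof (rule local_membership[where n = 1, OF N submodule_zero[OF N]])
    fix u v w assume "u \<in> carrier T" "v \<in> carrier T" "w \<in> carrier T"
    then show "(vol u v w [^]\<^bsub>R\<^esub> (1::nat)) \<odot>\<^bsub>N\<^esub> (x \<ominus>\<^bsub>N\<^esub> y) \<in> {\<zero>\<^bsub>N\<^esub>}"
      using assms(2,3) eq
      by (simp add: a_minus_def N.smult_r_distr N.smult_r_minus N.M.r_neg)
  qed (use assms(2,3) in simp)
  then show ?thesis using assms(2,3) by (simp add: N.M.minus_eq_zero_iff)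
qed

text \<open>
  If \<open>\<alpha> \<omega> = 1\<close>, then \<open>u \<and> v \<and> w = [u, v, w] \<omega>\<close>, because \<open>\<alpha>\<close> takes the same value on both sides. Apply
  to this the linear map on the exterior power that is induced by \<open>A\<close>.
\<close>

lemma alternating_factor:
  assumes N: "module R N" and A: "alternating3 R T N A"
  obtains c where "c \<in> carrier N"
    and "\<And>u v w. u \<in> carrier T \<Longrightarrow> v \<in> carrier T \<Longrightarrow> w \<in> carrier T \<Longrightarrow> A u v w = vol u v w \<odot>\<^bsub>N\<^esub> c"
proof -
  interpret E: module R "ext3 R T" by (rule module_ext3[OF module_T])
  obtain h where h: "h \<in> lin_maps R (ext3 R T) N"
    and hA: "\<And>u v w. u \<in> carrier T \<Longrightarrow> v \<in> carrier T \<Longrightarrow> w \<in> carrier T \<Longrightarrow> h (wedge3 R T u v w) = A u v w"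
    using ext3_lift[OF module_T N A] by blast
  obtain \<omega> where \<omega>: "\<omega> \<in> carrier (ext3 R T)" "\<alpha> \<omega> = \<one>\<^bsub>R\<^esub>"
    using volume_bij R.one_closed unfolding bij_betw_def by (metis imageE)
  have "wedge3 R T u v w = vol u v w \<odot>\<^bsub>ext3 R T\<^esub> \<omega>"
    if uvw: "u \<in> carrier T" "v \<in> carrier T" "w \<in> carrier T" for u v w
  proof (rule inj_onD[OF bij_betw_imp_inj_on[OF volume_bij]])
    show "\<alpha> (wedge3 R T u v w) = \<alpha> (vol u v w \<odot>\<^bsub>ext3 R T\<^esub> \<omega>)"
      using uvw \<omega> vol_closed[OF uvw]
      by (simp add: lin_maps_smult[OF volume_linear]) (simp add: vol_def)
  qed (use uvw \<omega> in \<open>simp_all add: wedge3_closed[OF module_T]\<close>)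
  then have "A u v w = vol u v w \<odot>\<^bsub>N\<^esub> h \<omega>"
    if "u \<in> carrier T" "v \<in> carrier T" "w \<in> carrier T" for u v w
    using hA[OF that] that \<omega> by (simp add: lin_maps_smult[OF h])
  with that lin_maps_closed[OF h \<omega>(1)] show thesis by blast
qed

text \<open>
  The difference \<open>\<delta> t u v w\<close> of the two sides is alternating in \<open>u, v, w\<close> and changes sign under
  exchange of \<open>t\<close> and \<open>u\<close>; in other words, it is alternating in four vectors. Writing
  \<open>\<delta> t u v w = [u, v, w] d\<close> and \<open>\<delta> u x y z = [x, y, z] e\<close> gives
  \<open>[u, v, w]\<^sup>2 d = - [u, v, w] [t, v, w] e = - [t, v, w] \<delta> u u v w = 0\<close>.
\<close>

lemma cramer:
  assumes t: "t \<in> carrier T" and "u \<in> carrier T" "v \<in> carrier T" "w \<in> carrier T"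
  shows "vol u v w \<odot>\<^bsub>T\<^esub> t = vol t v w \<odot>\<^bsub>T\<^esub> u \<oplus>\<^bsub>T\<^esub> vol t w u \<odot>\<^bsub>T\<^esub> v \<oplus>\<^bsub>T\<^esub> vol t u v \<odot>\<^bsub>T\<^esub> w"
proof -
  define \<delta> where "\<delta> t u v w = vol u v w \<odot>\<^bsub>T\<^esub> t \<ominus>\<^bsub>T\<^esub>
     (vol t v w \<odot>\<^bsub>T\<^esub> u \<oplus>\<^bsub>T\<^esub> vol t w u \<odot>\<^bsub>T\<^esub> v \<oplus>\<^bsub>T\<^esub> vol t u v \<odot>\<^bsub>T\<^esub> w)" for t u v w
  have alt: "alternating3 R T T (\<delta> t)" if t: "t \<in> carrier T" for t
  proof -
    have "alternating3 R T T (\<lambda>u v w. vol u v w \<odot>\<^bsub>T\<^esub> t)"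
      using alternating3_comp[OF module_R module_T vol_alternating, of "\<lambda>r. r \<odot>\<^bsub>T\<^esub> t"]
        lin_maps_scalar[OF module_T, of "\<lambda>r. r" "reg_module R" t] lin_maps_id t by blast
    moreover have "alternating3 R T T
      (\<lambda>u v w. vol t v w \<odot>\<^bsub>T\<^esub> u \<oplus>\<^bsub>T\<^esub> vol t w u \<odot>\<^bsub>T\<^esub> v \<oplus>\<^bsub>T\<^esub> vol t u v \<odot>\<^bsub>T\<^esub> w)"
      using t alternating3D(2,3)[OF vol_alternating]
      by (intro alternating3_wedge_form[OF module_T module_T, of "vol t" "\<lambda>x. x"] lin_maps_id) auto
    ultimately show ?thesis
      unfolding \<delta>_def[abs_def] by (rule alternating3_diff[OF module_T module_T])
  qed
  have \<delta>_diag: "\<delta> u u v w = \<zero>\<^bsub>T\<^esub>" if "u \<in> carrier T" "v \<in> carrier T" "w \<in> carrier T" for u v w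
    using that by (simp add: \<delta>_def a_minus_def M.r_neg)
  have \<delta>_swap: "\<delta> t u v w = \<ominus>\<^bsub>T\<^esub> \<delta> u t v w"
    if "t \<in> carrier T" "u \<in> carrier T" "v \<in> carrier T" "w \<in> carrier T" for t u v w
  proof -
    have "vol u w t = \<ominus>\<^bsub>R\<^esub> vol t w u" and "vol u t v = \<ominus>\<^bsub>R\<^esub> vol t u v"
      using that vol_cycle[of u w t] vol_swap(1)[of t w u] vol_swap(1)[of t u v] by simp_all
    then show ?thesis
      using that by (simp add: \<delta>_def a_minus_def smult_l_minus M.minus_add M.a_ac)
  qed
  obtain d where d: "d \<in> carrier T"
    and \<delta>d: "\<And>u v w. u \<in> carrier T \<Longrightarrow> v \<in> carrier T \<Longrightarrow> w \<in> carrier T \<Longrightarrow> \<delta> t u v w = vol u v w \<odot>\<^bsub>T\<^esub> d"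
    using alternating_factor[OF module_T alt[OF t]] by blast
  have "d \<in> {\<zero>\<^bsub>T\<^esub>}"
  proof (rule local_membership[where n = 2, OF module_T submodule_zero[OF module_T] d])
    fix u v w assume uvw: "u \<in> carrier T" "v \<in> carrier T" "w \<in> carrier T"
    obtain e where e: "e \<in> carrier T"
      and \<delta>e: "\<And>x y z. x \<in> carrier T \<Longrightarrow> y \<in> carrier T \<Longrightarrow> z \<in> carrier T \<Longrightarrow> \<delta> u x y z = vol x y z \<odot>\<^bsub>T\<^esub> e"
      using alternating_factor[OF module_T alt[OF uvw(1)]] by blast
    have "(vol u v w [^]\<^bsub>R\<^esub> (2::nat)) \<odot>\<^bsub>T\<^esub> d = vol u v w \<odot>\<^bsub>T\<^esub> \<delta> t u v w"
      using uvw d by (simp add: \<delta>d numeral_2_eq_2 smult_assoc1)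
    also have "\<dots> = \<ominus>\<^bsub>T\<^esub> (vol u v w \<odot>\<^bsub>T\<^esub> (vol t v w \<odot>\<^bsub>T\<^esub> e))"
      using uvw t e by (simp add: \<delta>_swap[of t] \<delta>e smult_r_minus)
    also have "vol u v w \<odot>\<^bsub>T\<^esub> (vol t v w \<odot>\<^bsub>T\<^esub> e) = vol t v w \<odot>\<^bsub>T\<^esub> \<delta> u u v w"
      using uvw t e by (simp add: \<delta>e smult_assoc1[symmetric] R.m_comm)
    finally show "(vol u v w [^]\<^bsub>R\<^esub> (2::nat)) \<odot>\<^bsub>T\<^esub> d \<in> {\<zero>\<^bsub>T\<^esub>}"
      using uvw t by (simp add: \<delta>_diag)
  qed
  then have "\<delta> t u v w = \<zero>\<^bsub>T\<^esub>" using assms by (simp add: \<delta>d)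
  then show ?thesis unfolding \<delta>_def using assms by (subst (asm) M.minus_eq_zero_iff) simp_all
qed

end

section \<open>The dual volume form\<close>

text \<open>
  The determinant of the \<open>3 \<times> 3\<close> matrix of values of \<open>f, g, h\<close> at \<open>u, v, w\<close>, expanded along \<open>f\<close>. The signs
  of the expansion are absorbed by the cyclic order of \<open>u, v, w\<close>.
\<close>

definition pair_det ::
  "('a, 'm) ring_scheme \<Rightarrow> ('b \<Rightarrow> 'a) \<Rightarrow> ('b \<Rightarrow> 'a) \<Rightarrow> ('b \<Rightarrow> 'a) \<Rightarrow> 'b \<Rightarrow> 'b \<Rightarrow> 'b \<Rightarrow> 'a"
  where "pair_det R f g h u v w =
    (g v \<otimes>\<^bsub>R\<^esub> h w \<ominus>\<^bsub>R\<^esub> g w \<otimes>\<^bsub>R\<^esub> h v) \<otimes>\<^bsub>R\<^esub> f u \<oplus>\<^bsub>R\<^esub>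
    (g w \<otimes>\<^bsub>R\<^esub> h u \<ominus>\<^bsub>R\<^esub> g u \<otimes>\<^bsub>R\<^esub> h w) \<otimes>\<^bsub>R\<^esub> f v \<oplus>\<^bsub>R\<^esub>
    (g u \<otimes>\<^bsub>R\<^esub> h v \<ominus>\<^bsub>R\<^esub> g v \<otimes>\<^bsub>R\<^esub> h u) \<otimes>\<^bsub>R\<^esub> f w"

lemma permutations_3:
  "{\<pi>. \<pi> permutes {1..3::nat}} = {id, transpose 2 3, transpose 1 2, transpose 1 2 \<circ> transpose 2 3,
     transpose 1 3, transpose 1 3 \<circ> transpose 2 3}"
proof -
  have 3: "{1..3::nat} = {1, 2, 3}" by auto
  have image: "(\<lambda>(b, p). f b p) ` {(b, p). b \<in> B \<and> p \<in> S} = (\<Union>b\<in>B. f b ` S)"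
    for f :: "'x \<Rightarrow> 'y \<Rightarrow> 'z" and B S by auto
  show ?thesis
    unfolding 3 permutes_insert image by auto
qed

lemma (in cring) det_transpose:
  assumes "a1 \<in> carrier R" "a2 \<in> carrier R" "a3 \<in> carrier R"
    and "b1 \<in> carrier R" "b2 \<in> carrier R" "b3 \<in> carrier R"
    and "c1 \<in> carrier R" "c2 \<in> carrier R" "c3 \<in> carrier R"
  shows "(b2 \<otimes> c3 \<ominus> b3 \<otimes> c2) \<otimes> a1 \<oplus> (b3 \<otimes> c1 \<ominus> b1 \<otimes> c3) \<otimes> a2 \<oplus> (b1 \<otimes> c2 \<ominus> b2 \<otimes> c1) \<otimes> a3
    = (b2 \<otimes> c3 \<ominus> c2 \<otimes> b3) \<otimes> a1 \<oplus> (c2 \<otimes> a3 \<ominus> a2 \<otimes> c3) \<otimes> b1 \<oplus> (a2 \<otimes> b3 \<ominus> b2 \<otimes> a3) \<otimes> c1"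
  using assms by (simp add: a_minus_def l_distr r_distr l_minus r_minus a_ac m_ac)

lemma det3_pair_det:
  fixes f :: "nat \<Rightarrow> 'b \<Rightarrow> 'a"
  assumes "cring R" and A: "\<And>i j. i \<in> {1, 2, 3} \<Longrightarrow> j \<in> {1, 2, 3} \<Longrightarrow> f j (u i) \<in> carrier R"
  shows "det3 R (\<lambda>i j. f j (u i)) = pair_det R (f 1) (f 2) (f 3) (u 1) (u 2) (u 3)"
proof -
  interpret cring R by fact
  have 3: "{1..3::nat} = {1, 2, 3}" by auto
  define P where "P \<pi> = f (\<pi> 1) (u 1) \<otimes>\<^bsub>R\<^esub> (f (\<pi> 2) (u 2) \<otimes>\<^bsub>R\<^esub> f (\<pi> 3) (u 3))" for \<pi> :: "nat \<Rightarrow> nat"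
  define t where "t \<pi> = (if evenperm \<pi> then \<one>\<^bsub>R\<^esub> else \<ominus>\<^bsub>R\<^esub> \<one>\<^bsub>R\<^esub>) \<otimes>\<^bsub>R\<^esub> P \<pi>" for \<pi>
  have prod: "(\<Otimes>\<^bsub>R\<^esub>i\<in>{1..3}. f (\<pi> i) (u i)) = P \<pi>" if "\<pi> permutes {1..3}" for \<pi>
  proof -
    have "\<pi> i \<in> {1, 2, 3}" if "i \<in> {1, 2, 3}" for i
      using permutes_in_image[OF \<open>\<pi> permutes {1..3}\<close>, of i] that unfolding 3 by blast
    then show ?thesis
      unfolding 3 P_def using A by (subst finprod_insert, simp_all add: Pi_iff)+
  qed
  \<comment> \<open>The six permutations are told apart by their values at 1 and 2.\<close>
  have key: "x \<notin> S" if "(x 1, x 2) \<notin> (\<lambda>\<pi>. (\<pi> 1, \<pi> 2)) ` S" for x :: "nat \<Rightarrow> nat" and S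
    using that by blast
  have even: "evenperm (transpose (2::nat) 3) = False" "evenperm (transpose (1::nat) 2) = False"
    "evenperm (transpose (1::nat) 3) = False"
    "evenperm (transpose (1::nat) 2 \<circ> transpose 2 3) = True"
    "evenperm (transpose (1::nat) 3 \<circ> transpose 2 3) = True"
    by (simp_all add: evenperm_swap evenperm_comp permutation_swap_id)
  have tr: "transpose (2::nat) 3 1 = 1" "transpose (2::nat) 3 2 = 3" "transpose (2::nat) 3 3 = 2"
    "transpose (1::nat) 2 1 = 2" "transpose (1::nat) 2 2 = 1" "transpose (1::nat) 2 3 = 3"
    "transpose (1::nat) 3 1 = 3" "transpose (1::nat) 3 2 = 2" "transpose (1::nat) 3 3 = 1"
    by (simp_all add: transpose_def)
  have cl: "P id \<in> carrier R" "P (transpose 2 3) \<in> carrier R" "P (transpose 1 2) \<in> carrier R"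
    "P (transpose 1 2 \<circ> transpose 2 3) \<in> carrier R" "P (transpose 1 3) \<in> carrier R"
    "P (transpose 1 3 \<circ> transpose 2 3) \<in> carrier R"
    using A by (simp_all add: P_def tr)
  have "det3 R (\<lambda>i j. f j (u i)) = (\<Oplus>\<^bsub>R\<^esub>\<pi>\<in>{\<pi>. \<pi> permutes {1..3}}. t \<pi>)"
    unfolding det3_def t_def
  proof (rule finsum_cong')
    show "(\<lambda>\<pi>. (if evenperm \<pi> then \<one>\<^bsub>R\<^esub> else \<ominus>\<^bsub>R\<^esub> \<one>\<^bsub>R\<^esub>) \<otimes>\<^bsub>R\<^esub> P \<pi>) \<in> {\<pi>. \<pi> permutes {1..3}} \<rightarrow> carrier R"
      unfolding permutations_3 using cl by auto
  qed (simp_all only: mem_Collect_eq prod)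
  also have "\<dots> = t id \<oplus>\<^bsub>R\<^esub> (t (transpose 2 3) \<oplus>\<^bsub>R\<^esub> (t (transpose 1 2) \<oplus>\<^bsub>R\<^esub>
      (t (transpose 1 2 \<circ> transpose 2 3) \<oplus>\<^bsub>R\<^esub> (t (transpose 1 3) \<oplus>\<^bsub>R\<^esub>
        t (transpose 1 3 \<circ> transpose 2 3)))))"
  proof -
    have tc: "t id \<in> carrier R" "t (transpose 2 3) \<in> carrier R" "t (transpose 1 2) \<in> carrier R"
      "t (transpose 1 2 \<circ> transpose 2 3) \<in> carrier R" "t (transpose 1 3) \<in> carrier R"
      "t (transpose 1 3 \<circ> transpose 2 3) \<in> carrier R"
      using cl by (simp_all add: t_def)
    have ni: "id \<notin> {transpose (2::nat) 3, transpose 1 2, transpose 1 2 \<circ> transpose 2 3,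
         transpose 1 3, transpose 1 3 \<circ> transpose 2 3}"
      "transpose (2::nat) 3 \<notin> {transpose 1 2, transpose 1 2 \<circ> transpose 2 3,
         transpose 1 3, transpose 1 3 \<circ> transpose 2 3}"
      "transpose (1::nat) 2 \<notin> {transpose 1 2 \<circ> transpose 2 3,
         transpose 1 3, transpose 1 3 \<circ> transpose 2 3}"
      "transpose (1::nat) 2 \<circ> transpose 2 3 \<notin> {transpose 1 3, transpose 1 3 \<circ> transpose 2 3}"
      "transpose (1::nat) 3 \<notin> {transpose 1 3 \<circ> transpose 2 3}"
      by (rule key, simp add: tr)+
    show ?thesis
      unfolding permutations_3
      using tc ni by (simp add: Pi_iff)
  qed
  also have "\<dots> = pair_det R (f 1) (f 2) (f 3) (u 1) (u 2) (u 3)"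
    unfolding t_def even P_def pair_det_def using A
    by (simp add: tr a_minus_def l_distr r_distr l_minus r_minus a_ac m_ac)
  finally show ?thesis .
qed

lemma pair_det_alternating:
  assumes M: "module R M"
    and f: "f \<in> lin_maps R M (reg_module R)" and g: "g \<in> lin_maps R M (reg_module R)"
    and h: "h \<in> lin_maps R M (reg_module R)"
  shows "alternating3 R M (reg_module R) (pair_det R f g h)"
proof -
  interpret M: module R M by fact
  have reg: "module R (reg_module R)" by (rule module_reg_module[OF module.axioms(1)[OF M]])
  have cl: "k x \<in> carrier R" if "k \<in> lin_maps R M (reg_module R)" "x \<in> carrier M" for k x
    using lin_maps_closed[OF that] by simp
  have m1: "(\<lambda>u. g u \<otimes>\<^bsub>R\<^esub> h v \<ominus>\<^bsub>R\<^esub> g v \<otimes>\<^bsub>R\<^esub> h u) \<in> lin_maps R M (reg_module R)"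
    if "v \<in> carrier M" for v
    using lin_maps_diff[OF M reg lin_maps_scalar[OF reg g, of "h v"] lin_maps_scaled[OF reg h, of "g v"]]
      cl[OF g that] cl[OF h that] by simp
  have m2: "(\<lambda>v. g u \<otimes>\<^bsub>R\<^esub> h v \<ominus>\<^bsub>R\<^esub> g v \<otimes>\<^bsub>R\<^esub> h u) \<in> lin_maps R M (reg_module R)"
    if "u \<in> carrier M" for u
    using lin_maps_diff[OF M reg lin_maps_scaled[OF reg h, of "g u"] lin_maps_scalar[OF reg g, of "h u"]]
      cl[OF g that] cl[OF h that] by simp
  have "alternating3 R M (reg_module R) (\<lambda>u v w.
      (g v \<otimes>\<^bsub>R\<^esub> h w \<ominus>\<^bsub>R\<^esub> g w \<otimes>\<^bsub>R\<^esub> h v) \<odot>\<^bsub>reg_module R\<^esub> f u \<oplus>\<^bsub>reg_module R\<^esub>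
      (g w \<otimes>\<^bsub>R\<^esub> h u \<ominus>\<^bsub>R\<^esub> g u \<otimes>\<^bsub>R\<^esub> h w) \<odot>\<^bsub>reg_module R\<^esub> f v \<oplus>\<^bsub>reg_module R\<^esub>
      (g u \<otimes>\<^bsub>R\<^esub> h v \<ominus>\<^bsub>R\<^esub> g v \<otimes>\<^bsub>R\<^esub> h u) \<odot>\<^bsub>reg_module R\<^esub> f w)"
    by (rule alternating3_wedge_form[OF M reg m1 m2 _ f])
      (simp_all add: cl[OF g] cl[OF h] a_minus_def M.R.r_neg)
  then show ?thesis by (simp add: pair_det_def[abs_def])
qed

lemma pair_det_transpose:
  assumes "cring R" and "\<And>k x. k \<in> {f, g, h} \<Longrightarrow> x \<in> {u, v, w} \<Longrightarrow> k x \<in> carrier R"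
  shows "pair_det R f g h u v w = pair_det R (\<lambda>k. k u) (\<lambda>k. k v) (\<lambda>k. k w) f g h"
  unfolding pair_det_def by (rule cring.det_transpose[OF assms(1)]) (auto intro: assms(2))

text \<open>
  By \<open>pair_det_transpose\<close> this is \<open>pair_det_alternating\<close> for three evaluation functionals on the dual.
\<close>

lemma pair_det_alternating_dual:
  assumes M: "module R M" and uvw: "u \<in> carrier M" "v \<in> carrier M" "w \<in> carrier M"
  shows "alternating3 R (dual_module R M) (reg_module R) (\<lambda>f g h. pair_det R f g h u v w)"
proof -
  let ?D = "dual_module R M"
  have alt: "alternating3 R ?D (reg_module R) (pair_det R (\<lambda>k. k u) (\<lambda>k. k v) (\<lambda>k. k w))"
    by (intro pair_det_alternating module_dual_module M dual_eval_linear uvw)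
  have D: "module R ?D" by (rule module_dual_module[OF M])
  have eq: "pair_det R f g h u v w = pair_det R (\<lambda>k. k u) (\<lambda>k. k v) (\<lambda>k. k w) f g h"
    if "f \<in> carrier ?D" "g \<in> carrier ?D" "h \<in> carrier ?D" for f g h
    using that uvw by (intro pair_det_transpose module.axioms(1)[OF M]) (auto intro: dual_closed)
  show ?thesis
    unfolding alternating3_def
  proof (intro conjI ballI)
    fix g h assume gh: "g \<in> carrier ?D" "h \<in> carrier ?D"
    show "(\<lambda>f. pair_det R f g h u v w) \<in> lin_maps R ?D (reg_module R)"
      by (rule lin_maps_cong[OF alternating3D(1)[OF alt gh] D]) (rule eq[OF _ gh])
    show "(\<lambda>f. pair_det R g f h u v w) \<in> lin_maps R ?D (reg_module R)"
      by (rule lin_maps_cong[OF alternating3D(2)[OF alt gh] D]) (rule eq[OF gh(1) _ gh(2)])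
    show "(\<lambda>f. pair_det R g h f u v w) \<in> lin_maps R ?D (reg_module R)"
      by (rule lin_maps_cong[OF alternating3D(3)[OF alt gh] D]) (rule eq[OF gh])
    show "pair_det R g g h u v w = \<zero>\<^bsub>reg_module R\<^esub>"
      using eq[OF gh(1,1,2)] alternating3D(4)[OF alt gh] by simp
    show "pair_det R g h h u v w = \<zero>\<^bsub>reg_module R\<^esub>"
      using eq[OF gh gh(2)] alternating3D(5)[OF alt gh] by simp
  qed
qed

text \<open>
  Of the 27 terms of the multilinear expansion only those with three different vectors survive. They
  are the six terms of the determinant of the coefficients, with the signs of the permutations.
\<close>

lemma alternating3_expand:
  assumes M: "module R M" and N: "module R N" and A: "alternating3 R M N A"
    and e: "e1 \<in> carrier M" "e2 \<in> carrier M" "e3 \<in> carrier M"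
    and a: "a1 \<in> carrier R" "a2 \<in> carrier R" "a3 \<in> carrier R"
    and b: "b1 \<in> carrier R" "b2 \<in> carrier R" "b3 \<in> carrier R"
    and c: "c1 \<in> carrier R" "c2 \<in> carrier R" "c3 \<in> carrier R"
  shows "A (a1 \<odot>\<^bsub>M\<^esub> e1 \<oplus>\<^bsub>M\<^esub> a2 \<odot>\<^bsub>M\<^esub> e2 \<oplus>\<^bsub>M\<^esub> a3 \<odot>\<^bsub>M\<^esub> e3)
      (b1 \<odot>\<^bsub>M\<^esub> e1 \<oplus>\<^bsub>M\<^esub> b2 \<odot>\<^bsub>M\<^esub> e2 \<oplus>\<^bsub>M\<^esub> b3 \<odot>\<^bsub>M\<^esub> e3)
      (c1 \<odot>\<^bsub>M\<^esub> e1 \<oplus>\<^bsub>M\<^esub> c2 \<odot>\<^bsub>M\<^esub> e2 \<oplus>\<^bsub>M\<^esub> c3 \<odot>\<^bsub>M\<^esub> e3)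
    = ((b2 \<otimes>\<^bsub>R\<^esub> c3 \<ominus>\<^bsub>R\<^esub> b3 \<otimes>\<^bsub>R\<^esub> c2) \<otimes>\<^bsub>R\<^esub> a1 \<oplus>\<^bsub>R\<^esub>
       (b3 \<otimes>\<^bsub>R\<^esub> c1 \<ominus>\<^bsub>R\<^esub> b1 \<otimes>\<^bsub>R\<^esub> c3) \<otimes>\<^bsub>R\<^esub> a2 \<oplus>\<^bsub>R\<^esub>
       (b1 \<otimes>\<^bsub>R\<^esub> c2 \<ominus>\<^bsub>R\<^esub> b2 \<otimes>\<^bsub>R\<^esub> c1) \<otimes>\<^bsub>R\<^esub> a3) \<odot>\<^bsub>N\<^esub> A e1 e2 e3"
proof -
  interpret M: module R M by fact
  interpret N: module R N by fact
  note lin = alternating3D(1-3)[OF A]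
  note cl = alternating3_closed[OF A]
  have lin3: "h (r \<odot>\<^bsub>M\<^esub> e1 \<oplus>\<^bsub>M\<^esub> s \<odot>\<^bsub>M\<^esub> e2 \<oplus>\<^bsub>M\<^esub> t \<odot>\<^bsub>M\<^esub> e3)
      = r \<odot>\<^bsub>N\<^esub> h e1 \<oplus>\<^bsub>N\<^esub> s \<odot>\<^bsub>N\<^esub> h e2 \<oplus>\<^bsub>N\<^esub> t \<odot>\<^bsub>N\<^esub> h e3"
    if "h \<in> lin_maps R M N" "r \<in> carrier R" "s \<in> carrier R" "t \<in> carrier R" for h r s t
    using that e by (simp add: lin_maps_add[OF that(1)] lin_maps_smult[OF that(1)])
  define X where "X = A e1 e2 e3"
  have X: "X \<in> carrier N" using cl e by (simp add: X_def)
  note sw = alternating3_swap[OF M N A] and cy = alternating3_cycle[OF M N A]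
  have perm: "A e1 e2 e3 = X" "A e2 e3 e1 = X" "A e3 e1 e2 = X"
    "A e2 e1 e3 = \<ominus>\<^bsub>N\<^esub> X" "A e1 e3 e2 = \<ominus>\<^bsub>N\<^esub> X" "A e3 e2 e1 = \<ominus>\<^bsub>N\<^esub> X"
    using e sw(1)[of e1 e2 e3] sw(2)[of e1 e2 e3] cy[of e1 e2 e3] cy[of e2 e3 e1] sw(1)[of e2 e3 e1]
    by (simp_all add: X_def)
  have zero: "A x x y = \<zero>\<^bsub>N\<^esub>" "A x y y = \<zero>\<^bsub>N\<^esub>" "A x y x = \<zero>\<^bsub>N\<^esub>"
    if "x \<in> carrier M" "y \<in> carrier M" for x y
    using alternating3D(4,5)[OF A] alternating3_outer[OF M N A] that by simp_all
  let ?c = "c1 \<odot>\<^bsub>M\<^esub> e1 \<oplus>\<^bsub>M\<^esub> c2 \<odot>\<^bsub>M\<^esub> e2 \<oplus>\<^bsub>M\<^esub> c3 \<odot>\<^bsub>M\<^esub> e3"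
  let ?b = "b1 \<odot>\<^bsub>M\<^esub> e1 \<oplus>\<^bsub>M\<^esub> b2 \<odot>\<^bsub>M\<^esub> e2 \<oplus>\<^bsub>M\<^esub> b3 \<odot>\<^bsub>M\<^esub> e3"
  have third: "A x y ?c = c1 \<odot>\<^bsub>N\<^esub> A x y e1 \<oplus>\<^bsub>N\<^esub> c2 \<odot>\<^bsub>N\<^esub> A x y e2 \<oplus>\<^bsub>N\<^esub> c3 \<odot>\<^bsub>N\<^esub> A x y e3"
    if "x \<in> carrier M" "y \<in> carrier M" for x y
    by (rule lin3[OF lin(3)[OF that] c])
  have second: "A x ?b ?c = b1 \<odot>\<^bsub>N\<^esub> A x e1 ?c \<oplus>\<^bsub>N\<^esub> b2 \<odot>\<^bsub>N\<^esub> A x e2 ?c \<oplus>\<^bsub>N\<^esub> b3 \<odot>\<^bsub>N\<^esub> A x e3 ?c"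
    if "x \<in> carrier M" for x
    by (rule lin3[OF lin(2)[OF that] b]) (use c e in simp)
  have bc: "?b \<in> carrier M" "?c \<in> carrier M" using b c e by simp_all
  show ?thesis
    unfolding lin3[OF lin(1)[OF bc] a] second[OF e(1)] second[OF e(2)] second[OF e(3)]
      third[OF e(1,1)] third[OF e(1,2)] third[OF e(1,3)] third[OF e(2,1)] third[OF e(2,2)]
      third[OF e(2,3)] third[OF e(3,1)] third[OF e(3,2)] third[OF e(3,3)]
    using a b c e X
    by (simp add: zero perm a_minus_def N.smult_l_distr N.smult_r_distr N.smult_assoc1[symmetric]
        N.smult_r_minus N.smult_l_minus M.R.l_distr M.R.r_distr M.R.l_minus M.R.r_minus N.M.a_ac M.R.m_ac)
qed

context volume_module
begin

lemma module_dual: "module R (dual_module R T)"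
  by (rule module_dual_module[OF module_T])

lemma vec_prod_apply: "w \<in> carrier T \<Longrightarrow> vec_prod R T \<alpha> u v w = vol u v w"
  by (simp add: vec_prod_def vol_def)

lemma vec_prod_closed:
  assumes "u \<in> carrier T" "v \<in> carrier T"
  shows "vec_prod R T \<alpha> u v \<in> carrier (dual_module R T)"
  using restrict_in_dual[OF module_T alternating3D(3)[OF vol_alternating assms]]
  by (simp add: vec_prod_def vol_def)

text \<open>
  Apply \<open>f\<close> to Cramer's rule for a vector \<open>t\<close> and read both sides as functions of \<open>t\<close>: the vector
  products are the functionals \<open>[v, w, -]\<close>, \<open>[w, u, -]\<close> and \<open>[u, v, -]\<close>.
\<close>

lemma cramer_dual:
  assumes f: "f \<in> carrier (dual_module R T)"
    and uvw: "u \<in> carrier T" "v \<in> carrier T" "w \<in> carrier T"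
  shows "vol u v w \<odot>\<^bsub>dual_module R T\<^esub> f =
    f u \<odot>\<^bsub>dual_module R T\<^esub> vec_prod R T \<alpha> v w \<oplus>\<^bsub>dual_module R T\<^esub>
    f v \<odot>\<^bsub>dual_module R T\<^esub> vec_prod R T \<alpha> w u \<oplus>\<^bsub>dual_module R T\<^esub>
    f w \<odot>\<^bsub>dual_module R T\<^esub> vec_prod R T \<alpha> u v"
proof -
  interpret D: module R "dual_module R T" by (rule module_dual)
  note fT = dual_closed[OF f] and lin = dual_lin[OF f]
  show ?thesis
  proof (rule dual_eqI[where R = R and M = T])
    fix t assume t: "t \<in> carrier T"
    have "vol u v w \<otimes>\<^bsub>R\<^esub> f t = f (vol u v w \<odot>\<^bsub>T\<^esub> t)"
      using t uvw by (simp add: lin_maps_smult[OF lin])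
    also have "\<dots> = vol t v w \<otimes>\<^bsub>R\<^esub> f u \<oplus>\<^bsub>R\<^esub> vol t w u \<otimes>\<^bsub>R\<^esub> f v \<oplus>\<^bsub>R\<^esub> vol t u v \<otimes>\<^bsub>R\<^esub> f w"
      using t uvw by (simp add: cramer[OF t uvw] lin_maps_smult[OF lin] lin_maps_add[OF lin])
    also have "\<dots> = f u \<otimes>\<^bsub>R\<^esub> vol v w t \<oplus>\<^bsub>R\<^esub> f v \<otimes>\<^bsub>R\<^esub> vol w u t \<oplus>\<^bsub>R\<^esub> f w \<otimes>\<^bsub>R\<^esub> vol u v t"
      using t uvw fT vol_cycle[of t v w] vol_cycle[of t w u] vol_cycle[of t u v]
      by (simp add: R.m_comm)
    finally show "(vol u v w \<odot>\<^bsub>dual_module R T\<^esub> f) t =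
      (f u \<odot>\<^bsub>dual_module R T\<^esub> vec_prod R T \<alpha> v w \<oplus>\<^bsub>dual_module R T\<^esub>
       f v \<odot>\<^bsub>dual_module R T\<^esub> vec_prod R T \<alpha> w u \<oplus>\<^bsub>dual_module R T\<^esub>
       f w \<odot>\<^bsub>dual_module R T\<^esub> vec_prod R T \<alpha> u v) t"
      using t by (simp add: dual_add_apply dual_smult_apply vec_prod_apply)
  qed (use f uvw fT in \<open>simp_all add: vec_prod_closed\<close>)
qed

text \<open>
  The trilinear form on the dual that underlies \<open>\<beta>\<close>. The scalar is unique by \<open>vol_cancel\<close>, and it exists
  because determinants are alternating in the vectors.
\<close>

definition dual_form :: "('b \<Rightarrow> 'a) \<Rightarrow> ('b \<Rightarrow> 'a) \<Rightarrow> ('b \<Rightarrow> 'a) \<Rightarrow> 'a"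
  where "dual_form f g h = (SOME c. c \<in> carrier R \<and>
    (\<forall>u\<in>carrier T. \<forall>v\<in>carrier T. \<forall>w\<in>carrier T. pair_det R f g h u v w = vol u v w \<otimes>\<^bsub>R\<^esub> c))"

lemma dual_form:
  assumes "f \<in> carrier (dual_module R T)" "g \<in> carrier (dual_module R T)" "h \<in> carrier (dual_module R T)"
  shows "dual_form f g h \<in> carrier R"
    and "u \<in> carrier T \<Longrightarrow> v \<in> carrier T \<Longrightarrow> w \<in> carrier T \<Longrightarrow>
      vol u v w \<otimes>\<^bsub>R\<^esub> dual_form f g h = pair_det R f g h u v w"
proof -
  have "\<exists>c. c \<in> carrier R \<and>
    (\<forall>u\<in>carrier T. \<forall>v\<in>carrier T. \<forall>w\<in>carrier T. pair_det R f g h u v w = vol u v w \<otimes>\<^bsub>R\<^esub> c)"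
    using alternating_factor[OF module_R pair_det_alternating[OF module_T dual_lin dual_lin dual_lin, OF assms]]
    by (metis reg_module_simps(1,4))
  from someI_ex[OF this, folded dual_form_def]
  show "dual_form f g h \<in> carrier R"
    and "u \<in> carrier T \<Longrightarrow> v \<in> carrier T \<Longrightarrow> w \<in> carrier T \<Longrightarrow>
      vol u v w \<otimes>\<^bsub>R\<^esub> dual_form f g h = pair_det R f g h u v w"
    by force+
qed

lemma vol_cancel_R:
  assumes "x \<in> carrier R" "y \<in> carrier R"
    and "\<And>u v w. u \<in> carrier T \<Longrightarrow> v \<in> carrier T \<Longrightarrow> w \<in> carrier T \<Longrightarrow>
      vol u v w \<otimes>\<^bsub>R\<^esub> x = vol u v w \<otimes>\<^bsub>R\<^esub> y"
  shows "x = y"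
  using vol_cancel[OF module_R, of x y] assms by simp

text \<open>
  The determinants are alternating in the functionals, and \<open>dual_form\<close> inherits this, since a
  scalar is determined by its products with all \<open>[u, v, w]\<close>.
\<close>

lemma dual_form_alternating: "alternating3 R (dual_module R T) (reg_module R) dual_form"
proof -
  let ?D = "dual_module R T"
  interpret D: module R ?D by (rule module_dual)
  note alt = pair_det_alternating_dual[OF module_T]
  have lin: "\<phi> \<in> lin_maps R ?D (reg_module R)"
    if cl: "\<And>f. f \<in> carrier ?D \<Longrightarrow> \<phi> f \<in> carrier R"
      and \<psi>: "\<And>u v w. u \<in> carrier T \<Longrightarrow> v \<in> carrier T \<Longrightarrow> w \<in> carrier T \<Longrightarrow>
        \<psi> u v w \<in> lin_maps R ?D (reg_module R)"
      and eq: "\<And>u v w f. u \<in> carrier T \<Longrightarrow> v \<in> carrier T \<Longrightarrow> w \<in> carrier T \<Longrightarrow> f \<in> carrier ?D \<Longrightarrow>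
        vol u v w \<otimes>\<^bsub>R\<^esub> \<phi> f = \<psi> u v w f" for \<phi> \<psi>
  proof (rule lin_mapsI)
    fix f g assume fg: "f \<in> carrier ?D" "g \<in> carrier ?D"
    have "\<phi> (f \<oplus>\<^bsub>?D\<^esub> g) = \<phi> f \<oplus>\<^bsub>R\<^esub> \<phi> g"
    proof (rule vol_cancel_R)
      fix u v w assume "u \<in> carrier T" "v \<in> carrier T" "w \<in> carrier T"
      then show "vol u v w \<otimes>\<^bsub>R\<^esub> \<phi> (f \<oplus>\<^bsub>?D\<^esub> g) = vol u v w \<otimes>\<^bsub>R\<^esub> (\<phi> f \<oplus>\<^bsub>R\<^esub> \<phi> g)"
        using fg cl by (simp add: R.r_distr eq lin_maps_add[OF \<psi>])
    qed (use fg cl in auto)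
    then show "\<phi> (f \<oplus>\<^bsub>?D\<^esub> g) = \<phi> f \<oplus>\<^bsub>reg_module R\<^esub> \<phi> g" by simp
  next
    fix r f assume rf: "r \<in> carrier R" "f \<in> carrier ?D"
    have "\<phi> (r \<odot>\<^bsub>?D\<^esub> f) = r \<otimes>\<^bsub>R\<^esub> \<phi> f"
    proof (rule vol_cancel_R)
      fix u v w assume "u \<in> carrier T" "v \<in> carrier T" "w \<in> carrier T"
      then show "vol u v w \<otimes>\<^bsub>R\<^esub> \<phi> (r \<odot>\<^bsub>?D\<^esub> f) = vol u v w \<otimes>\<^bsub>R\<^esub> (r \<otimes>\<^bsub>R\<^esub> \<phi> f)"
        using rf cl by (simp add: R.m_lcomm[of _ r] eq lin_maps_smult[OF \<psi>])
    qed (use rf cl in auto)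
    then show "\<phi> (r \<odot>\<^bsub>?D\<^esub> f) = r \<odot>\<^bsub>reg_module R\<^esub> \<phi> f" by simp
  qed (simp add: cl)
  show ?thesis
    unfolding alternating3_def
  proof (intro conjI ballI)
    fix f g assume fg: "f \<in> carrier ?D" "g \<in> carrier ?D"
    show "(\<lambda>k. dual_form k f g) \<in> lin_maps R ?D (reg_module R)"
      by (rule lin[OF _ alternating3D(1)[OF alt fg]]) (use fg in \<open>simp_all add: dual_form\<close>)
    show "(\<lambda>k. dual_form f k g) \<in> lin_maps R ?D (reg_module R)"
      by (rule lin[OF _ alternating3D(2)[OF alt fg]]) (use fg in \<open>simp_all add: dual_form\<close>)
    show "(\<lambda>k. dual_form f g k) \<in> lin_maps R ?D (reg_module R)"
      by (rule lin[OF _ alternating3D(3)[OF alt fg]]) (use fg in \<open>simp_all add: dual_form\<close>)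
    have "dual_form f f g = \<zero>\<^bsub>R\<^esub>"
      by (rule vol_cancel_R) (use fg alternating3D(4)[OF alt fg] in \<open>simp_all add: dual_form\<close>)
    then show "dual_form f f g = \<zero>\<^bsub>reg_module R\<^esub>" by simp
    have "dual_form f g g = \<zero>\<^bsub>R\<^esub>"
      by (rule vol_cancel_R) (use fg alternating3D(5)[OF alt fg] in \<open>simp_all add: dual_form\<close>)
    then show "dual_form f g g = \<zero>\<^bsub>reg_module R\<^esub>" by simp
  qed
qed

text \<open>
  Surjectivity: the matrix of values of \<open>v \<times> w, w \<times> u, u \<times> v\<close> at \<open>u, v, w\<close> is diagonal
  with entries \<open>[u, v, w]\<close>, so the image contains every \<open>[u, v, w]\<^sup>3\<close>. Injectivity: the dual Cramer rule
  writes \<open>[u, v, w] f\<close> in terms of these three functionals, so \<open>[u, v, w]\<^sup>3 \<xi>\<close> is a multiple of their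
  exterior product, with a factor proportional to \<open>\<beta> \<xi>\<close>.
\<close>

lemma dual_form_extension_bij:
  assumes \<beta>: "\<beta> \<in> lin_maps R (ext3 R (dual_module R T)) (reg_module R)"
    and \<beta>_wedge: "\<And>f g h. f \<in> carrier (dual_module R T) \<Longrightarrow> g \<in> carrier (dual_module R T) \<Longrightarrow>
      h \<in> carrier (dual_module R T) \<Longrightarrow> \<beta> (wedge3 R (dual_module R T) f g h) = dual_form f g h"
  shows "bij_betw \<beta> (carrier (ext3 R (dual_module R T))) (carrier R)"
proof -
  let ?D = "dual_module R T"
  let ?E = "ext3 R ?D"
  interpret D: module R ?D by (rule module_dual)
  have modE: "module R ?E" by (rule module_ext3[OF module_dual])
  interpret E: module R ?E by (rule modE)
  note \<beta>_closed = lin_maps_closed[OF \<beta>, unfolded reg_module_simps]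
  let ?x = "vec_prod R T \<alpha>"
  have "\<one>\<^bsub>R\<^esub> \<in> \<beta> ` carrier ?E"
  proof (rule local_membership[where n = 3, OF module_R submodule_image[OF modE module_R \<beta>]])
    fix u v w assume uvw: "u \<in> carrier T" "v \<in> carrier T" "w \<in> carrier T"
    have D: "?x v w \<in> carrier ?D" "?x w u \<in> carrier ?D" "?x u v \<in> carrier ?D"
      using uvw by (simp_all add: vec_prod_closed)
    have "pair_det R (?x v w) (?x w u) (?x u v) u v w
      = vol u v w \<otimes>\<^bsub>R\<^esub> vol u v w \<otimes>\<^bsub>R\<^esub> vol u v w"
      using uvw vol_cycle[of u v w] vol_cycle[of w u v]
      by (simp add: pair_det_def vec_prod_apply a_minus_def)
    then have "vol u v w \<otimes>\<^bsub>R\<^esub> \<beta> (wedge3 R ?D (?x v w) (?x w u) (?x u v))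
      = vol u v w [^]\<^bsub>R\<^esub> (3::nat)"
      using uvw D by (simp add: \<beta>_wedge dual_form numeral_3_eq_3)
    then have "vol u v w [^]\<^bsub>R\<^esub> (3::nat)
      = \<beta> (vol u v w \<odot>\<^bsub>?E\<^esub> wedge3 R ?D (?x v w) (?x w u) (?x u v))"
      using uvw D wedge3_closed[OF module_dual D] by (simp add: lin_maps_smult[OF \<beta>])
    then have "vol u v w [^]\<^bsub>R\<^esub> (3::nat) \<in> \<beta> ` carrier ?E"
      by (rule image_eqI) (use uvw wedge3_closed[OF module_dual D] in simp)
    then show "(vol u v w [^]\<^bsub>R\<^esub> (3::nat)) \<odot>\<^bsub>reg_module R\<^esub> \<one>\<^bsub>R\<^esub> \<in> \<beta> ` carrier ?E"
      using uvw by simp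
  qed simp
  then obtain \<epsilon> where \<epsilon>: "\<epsilon> \<in> carrier ?E" "\<beta> \<epsilon> = \<one>\<^bsub>R\<^esub>" by auto
  have surj: "\<beta> ` carrier ?E = carrier R"
  proof
    show "carrier R \<subseteq> \<beta> ` carrier ?E"
    proof
      fix r assume "r \<in> carrier R"
      then show "r \<in> \<beta> ` carrier ?E"
        using \<epsilon> by (intro image_eqI[of _ _ "r \<odot>\<^bsub>?E\<^esub> \<epsilon>"]) (simp_all add: lin_maps_smult[OF \<beta>])
    qed
  qed (use \<beta>_closed in auto)
  \<comment> \<open>Both sides are linear in \<open>\<xi>\<close>, so it suffices to treat products \<open>f \<and> g \<and> h\<close>, where one factor
    \<open>[u, v, w]\<close> goes to each functional.\<close>
  have cube: "(vol u v w [^]\<^bsub>R\<^esub> (3::nat)) \<odot>\<^bsub>?E\<^esub> \<xi>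
      = \<beta> \<xi> \<odot>\<^bsub>?E\<^esub> (vol u v w \<odot>\<^bsub>?E\<^esub> wedge3 R ?D (?x v w) (?x w u) (?x u v))"
    if uvw: "u \<in> carrier T" "v \<in> carrier T" "w \<in> carrier T" and \<xi>: "\<xi> \<in> carrier ?E" for u v w \<xi>
  proof (rule ext3_linear_eq[OF module_dual modE _ _ _ \<xi>])
    let ?X = "wedge3 R ?D (?x v w) (?x w u) (?x u v)"
    have D: "?x v w \<in> carrier ?D" "?x w u \<in> carrier ?D" "?x u v \<in> carrier ?D"
      using uvw by (simp_all add: vec_prod_closed)
    have X: "?X \<in> carrier ?E" by (rule wedge3_closed[OF module_dual D])
    show "(\<lambda>\<xi>. (vol u v w [^]\<^bsub>R\<^esub> (3::nat)) \<odot>\<^bsub>?E\<^esub> \<xi>) \<in> lin_maps R ?E ?E"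
      using uvw by (intro lin_maps_scaled[OF modE lin_maps_id]) simp
    show "(\<lambda>\<xi>. \<beta> \<xi> \<odot>\<^bsub>?E\<^esub> (vol u v w \<odot>\<^bsub>?E\<^esub> ?X)) \<in> lin_maps R ?E ?E"
      using uvw X by (intro lin_maps_scalar[OF modE \<beta>]) simp
    fix f g h assume fgh: "f \<in> carrier ?D" "g \<in> carrier ?D" "h \<in> carrier ?D"
    note alt = wedge3_alternating[OF module_dual]
    have cl: "wedge3 R ?D f g h \<in> carrier ?E" by (rule wedge3_closed[OF module_dual fgh])
    let ?V = "vol u v w"
    have V: "?V \<in> carrier R" using uvw by simp
    have "(?V [^]\<^bsub>R\<^esub> (3::nat)) \<odot>\<^bsub>?E\<^esub> wedge3 R ?D f g h
      = ?V \<odot>\<^bsub>?E\<^esub> (?V \<odot>\<^bsub>?E\<^esub> (?V \<odot>\<^bsub>?E\<^esub> wedge3 R ?D f g h))"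
      using V cl by (simp add: numeral_3_eq_3 E.smult_assoc1)
    also have "\<dots> = wedge3 R ?D (?V \<odot>\<^bsub>?D\<^esub> f) (?V \<odot>\<^bsub>?D\<^esub> g) (?V \<odot>\<^bsub>?D\<^esub> h)"
      using V fgh by (simp add: lin_maps_smult[OF alternating3D(1)[OF alt]]
          lin_maps_smult[OF alternating3D(2)[OF alt]] lin_maps_smult[OF alternating3D(3)[OF alt]])
    also have "\<dots> = pair_det R f g h u v w \<odot>\<^bsub>?E\<^esub> ?X"
      unfolding cramer_dual[OF fgh(1) uvw] cramer_dual[OF fgh(2) uvw] cramer_dual[OF fgh(3) uvw]
        pair_det_def
      by (rule alternating3_expand[OF module_dual modE alt D])
        (use dual_closed[OF fgh(1)] dual_closed[OF fgh(2)] dual_closed[OF fgh(3)] uvw in simp_all)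
    also have "\<dots> = \<beta> (wedge3 R ?D f g h) \<odot>\<^bsub>?E\<^esub> (?V \<odot>\<^bsub>?E\<^esub> ?X)"
      using fgh uvw V X
      by (simp add: \<beta>_wedge dual_form(2)[OF fgh uvw, symmetric] dual_form(1) E.smult_assoc1[symmetric]
          R.m_comm)
    finally show "(?V [^]\<^bsub>R\<^esub> (3::nat)) \<odot>\<^bsub>?E\<^esub> wedge3 R ?D f g h
      = \<beta> (wedge3 R ?D f g h) \<odot>\<^bsub>?E\<^esub> (?V \<odot>\<^bsub>?E\<^esub> ?X)" .
  qed
  have kernel: "\<xi> = \<zero>\<^bsub>?E\<^esub>" if \<xi>: "\<xi> \<in> carrier ?E" "\<beta> \<xi> = \<zero>\<^bsub>R\<^esub>" for \<xi>
  proof -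
    have "\<xi> \<in> {\<zero>\<^bsub>?E\<^esub>}"
    proof (rule local_membership[where n = 3, OF modE submodule_zero[OF modE] \<xi>(1)])
      fix u v w assume uvw: "u \<in> carrier T" "v \<in> carrier T" "w \<in> carrier T"
      then have "wedge3 R ?D (?x v w) (?x w u) (?x u v) \<in> carrier ?E"
        by (intro wedge3_closed[OF module_dual] vec_prod_closed)
      then show "(vol u v w [^]\<^bsub>R\<^esub> (3::nat)) \<odot>\<^bsub>?E\<^esub> \<xi> \<in> {\<zero>\<^bsub>?E\<^esub>}"
        using uvw \<xi> by (simp add: cube)
    qed
    then show ?thesis by simp
  qed
  have "inj_on \<beta> (carrier ?E)"
  proof (rule inj_onI)
    fix \<xi> \<eta> assume *: "\<xi> \<in> carrier ?E" "\<eta> \<in> carrier ?E" "\<beta> \<xi> = \<beta> \<eta>"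
    then have "\<beta> (\<xi> \<ominus>\<^bsub>?E\<^esub> \<eta>) = \<zero>\<^bsub>R\<^esub>"
      using \<beta>_closed by (simp add: lin_maps_minus[OF modE module_R \<beta>] R.minus_eq_zero_iff)
    then have "\<xi> \<ominus>\<^bsub>?E\<^esub> \<eta> = \<zero>\<^bsub>?E\<^esub>" using * by (intro kernel) simp_all
    then show "\<xi> = \<eta>" using * by (simp add: E.M.minus_eq_zero_iff)
  qed
  with surj show ?thesis by (simp add: bij_betw_def)
qed

text \<open>
  The defining property of \<open>dual_vol\<close>, restated on exterior products of functionals, says that the values
  are those of \<open>dual_form\<close>. So it determines the map, and the linear extension of \<open>dual_form\<close> has it.
\<close>

lemma dual_vol:
  shows dual_vol_iso: "dual_vol R T \<alpha> \<in> lin_isos R (ext3 R (dual_module R T)) (reg_module R)"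
    and dual_vol_wedge: "f \<in> carrier (dual_module R T) \<Longrightarrow> g \<in> carrier (dual_module R T) \<Longrightarrow>
      h \<in> carrier (dual_module R T) \<Longrightarrow> dual_vol R T \<alpha> (wedge3 R (dual_module R T) f g h) = dual_form f g h"
proof -
  let ?D = "dual_module R T"
  let ?E = "ext3 R ?D"
  have modE: "module R ?E" by (rule module_ext3[OF module_dual])
  \<comment> \<open>The predicate under the definite description in the definition of \<open>dual_vol\<close>.\<close>
  define good where "good \<beta> \<longleftrightarrow> \<beta> \<in> lin_isos R ?E (reg_module R) \<and> \<beta> \<in> extensional (carrier ?E) \<and>
       (\<forall>u f. u \<in> {1..3::nat} \<rightarrow> carrier T \<and> f \<in> {1..3::nat} \<rightarrow> carrier ?D \<longrightarrow>
          \<alpha> (wedge3 R T (u 1) (u 2) (u 3)) \<otimes>\<^bsub>R\<^esub> \<beta> (wedge3 R ?D (f 1) (f 2) (f 3))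
            = det3 R (\<lambda>i j. f j (u i)))" for \<beta>
  have wedge: "\<beta> (wedge3 R ?D f g h) = dual_form f g h"
    if \<beta>: "good \<beta>" and fgh: "f \<in> carrier ?D" "g \<in> carrier ?D" "h \<in> carrier ?D" for \<beta> f g h
  proof (rule vol_cancel_R)
    have "\<beta> \<in> lin_maps R ?E (reg_module R)" using \<beta> by (simp add: good_def lin_isos_def)
    then show "\<beta> (wedge3 R ?D f g h) \<in> carrier R"
      using lin_maps_closed[OF _ wedge3_closed[OF module_dual fgh]] by fastforce
    show "dual_form f g h \<in> carrier R" by (rule dual_form(1)[OF fgh])
    fix u v w assume uvw: "u \<in> carrier T" "v \<in> carrier T" "w \<in> carrier T"
    \<comment> \<open>The description quantifies over families indexed by \<open>{1..3}\<close>.\<close>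
    define U where "U = (\<lambda>i::nat. if i = 1 then u else if i = 2 then v else w)"
    define F where "F = (\<lambda>i::nat. if i = 1 then f else if i = 2 then g else h)"
    have "U \<in> {1..3} \<rightarrow> carrier T" "F \<in> {1..3} \<rightarrow> carrier ?D"
      using uvw fgh by (auto simp: U_def F_def)
    with \<beta> have "\<alpha> (wedge3 R T (U 1) (U 2) (U 3)) \<otimes>\<^bsub>R\<^esub> \<beta> (wedge3 R ?D (F 1) (F 2) (F 3))
        = det3 R (\<lambda>i j. F j (U i))"
      unfolding good_def by blast
    also have "\<dots> = pair_det R (F 1) (F 2) (F 3) (U 1) (U 2) (U 3)"
      using uvw fgh by (intro det3_pair_det[OF cring_R]) (auto simp: U_def F_def dual_closed)
    finally show "vol u v w \<otimes>\<^bsub>R\<^esub> \<beta> (wedge3 R ?D f g h) = vol u v w \<otimes>\<^bsub>R\<^esub> dual_form f g h"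
      using uvw fgh by (simp add: dual_form(2)) (simp add: U_def F_def vol_def)
  qed
  obtain \<beta>0 where \<beta>0: "\<beta>0 \<in> lin_maps R ?E (reg_module R)"
    and \<beta>0_wedge: "\<And>f g h. f \<in> carrier ?D \<Longrightarrow> g \<in> carrier ?D \<Longrightarrow> h \<in> carrier ?D \<Longrightarrow>
      \<beta>0 (wedge3 R ?D f g h) = dual_form f g h"
    using ext3_lift[OF module_dual module_R dual_form_alternating] by blast
  define \<beta> where "\<beta> = restrict \<beta>0 (carrier ?E)"
  have \<beta>: "\<beta> \<in> lin_maps R ?E (reg_module R)"
    unfolding \<beta>_def using lin_maps_cong[OF \<beta>0 modE] by simp
  have \<beta>_wedge: "\<beta> (wedge3 R ?D f g h) = dual_form f g h"
    if "f \<in> carrier ?D" "g \<in> carrier ?D" "h \<in> carrier ?D" for f g h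
    using \<beta>0_wedge[OF that] wedge3_closed[OF module_dual that] by (simp add: \<beta>_def)
  have "good \<beta>"
    unfolding good_def
  proof (intro conjI allI impI)
    show "\<beta> \<in> lin_isos R ?E (reg_module R)"
    proof -
      have "bij_betw \<beta> (carrier ?E) (carrier R)"
        using \<beta>_wedge by (rule dual_form_extension_bij[OF \<beta>])
      then show ?thesis using \<beta> by (simp add: lin_isos_def)
    qed
    show "\<beta> \<in> extensional (carrier ?E)" by (simp add: \<beta>_def)
    fix u :: "nat \<Rightarrow> 'b" and f :: "nat \<Rightarrow> 'b \<Rightarrow> 'a"
    assume uf: "u \<in> {1..3} \<rightarrow> carrier T \<and> f \<in> {1..3} \<rightarrow> carrier ?D"
    then have u: "u 1 \<in> carrier T" "u 2 \<in> carrier T" "u 3 \<in> carrier T"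
      and f: "f 1 \<in> carrier ?D" "f 2 \<in> carrier ?D" "f 3 \<in> carrier ?D"
      by (auto simp: Pi_iff)
    have "\<alpha> (wedge3 R T (u 1) (u 2) (u 3)) \<otimes>\<^bsub>R\<^esub> \<beta> (wedge3 R ?D (f 1) (f 2) (f 3))
      = pair_det R (f 1) (f 2) (f 3) (u 1) (u 2) (u 3)"
      using dual_form(2)[OF f u] \<beta>_wedge[OF f] by (simp add: vol_def)
    also have "\<dots> = det3 R (\<lambda>i j. f j (u i))"
      using u f by (intro det3_pair_det[OF cring_R, symmetric]) (auto simp: dual_closed)
    finally show "\<alpha> (wedge3 R T (u 1) (u 2) (u 3)) \<otimes>\<^bsub>R\<^esub> \<beta> (wedge3 R ?D (f 1) (f 2) (f 3))
      = det3 R (\<lambda>i j. f j (u i))" .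
  qed
  moreover have "\<beta>' = \<beta>" if "good \<beta>'" for \<beta>'
  proof (rule extensionalityI)
    show "\<beta>' \<in> extensional (carrier ?E)" "\<beta> \<in> extensional (carrier ?E)"
      using that by (simp_all add: good_def \<beta>_def)
    have lin: "\<beta>' \<in> lin_maps R ?E (reg_module R)"
      using that by (simp add: good_def lin_isos_def)
    fix \<xi> assume \<xi>: "\<xi> \<in> carrier ?E"
    show "\<beta>' \<xi> = \<beta> \<xi>"
      by (rule ext3_linear_eq[OF module_dual module_R lin \<beta> _ \<xi>]) (simp add: \<beta>_wedge wedge[OF that])
  qed
  ultimately have "dual_vol R T \<alpha> = \<beta>"
    unfolding dual_vol_def Let_def good_def by (intro the_equality) blast+
  then show "dual_vol R T \<alpha> \<in> lin_isos R ?E (reg_module R)"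
    and "f \<in> carrier ?D \<Longrightarrow> g \<in> carrier ?D \<Longrightarrow> h \<in> carrier ?D \<Longrightarrow>
      dual_vol R T \<alpha> (wedge3 R ?D f g h) = dual_form f g h"
    using \<open>good \<beta>\<close> \<beta>_wedge by (simp_all add: good_def)
qed

lemma volume_module_dual: "volume_module R (dual_module R T) (dual_vol R T \<alpha>)"
  by (intro volume_module.intro module_dual volume_module_axioms.intro dual_vol_iso)

lemma vol_dual_vol:
  assumes "f \<in> carrier (dual_module R T)" "g \<in> carrier (dual_module R T)" "h \<in> carrier (dual_module R T)"
    and "u \<in> carrier T" "v \<in> carrier T" "w \<in> carrier T"
  shows "vol u v w \<otimes>\<^bsub>R\<^esub> volume_module.vol R (dual_module R T) (dual_vol R T \<alpha>) f g h
    = pair_det R f g h u v w"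
  using dual_form(2)[OF assms] dual_vol_wedge[OF assms(1-3)]
  by (simp add: volume_module.vol_def[OF volume_module_dual])

end

section \<open>The bidual and the vector product on the dual\<close>

lemma alternating3_neg_neg:
  assumes M: "module R M" and N: "module R N" and A: "alternating3 R M N A"
    and uvw: "u \<in> carrier M" "v \<in> carrier M" "w \<in> carrier M"
  shows "A (\<ominus>\<^bsub>M\<^esub> u) (\<ominus>\<^bsub>M\<^esub> v) w = A u v w"
proof -
  interpret M: module R M by fact
  interpret N: module R N by fact
  show ?thesis
    using uvw lin_maps_neg[OF M N alternating3D(1)[OF A]] lin_maps_neg[OF M N alternating3D(2)[OF A]]
    by (simp add: alternating3_closed[OF A])
qed

lemma bidual_eval_apply: "f \<in> carrier (dual_module R M) \<Longrightarrow> bidual_eval R M u f = f u"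
  by (simp add: bidual_eval_def)

lemma bidual_eval_linear:
  assumes M: "module R M"
  shows "bidual_eval R M \<in> lin_maps R M (dual_module R (dual_module R M))"
proof -
  let ?D = "dual_module R M"
  interpret M: module R M by fact
  interpret DD: module R "dual_module R ?D" by (intro module_dual_module M)
  have cl: "bidual_eval R M u \<in> carrier (dual_module R ?D)" if "u \<in> carrier M" for u
    unfolding bidual_eval_def by (rule restrict_in_dual[OF module_dual_module[OF M] dual_eval_linear[OF that]])
  show ?thesis
  proof (rule lin_mapsI)
    fix u v assume "u \<in> carrier M" "v \<in> carrier M"
    then show "bidual_eval R M (u \<oplus>\<^bsub>M\<^esub> v) =
      bidual_eval R M u \<oplus>\<^bsub>dual_module R ?D\<^esub> bidual_eval R M v"
      by (intro dual_eqI[where R = R and M = ?D])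
        (simp_all add: cl dual_add_apply bidual_eval_apply lin_maps_add[OF dual_lin])
  next
    fix r u assume "r \<in> carrier R" "u \<in> carrier M"
    then show "bidual_eval R M (r \<odot>\<^bsub>M\<^esub> u) = r \<odot>\<^bsub>dual_module R ?D\<^esub> bidual_eval R M u"
      by (intro dual_eqI[where R = R and M = ?D])
        (simp_all add: cl dual_smult_apply bidual_eval_apply lin_maps_smult[OF dual_lin])
  qed (rule cl)
qed

context volume_module
begin

text \<open>
  Cramer's rule recovers \<open>[u, v, w] s\<close> from the values at \<open>s\<close> of the vector products of \<open>u, v, w\<close>.
\<close>

lemma dual_separates:
  assumes "s \<in> carrier T" "t \<in> carrier T" and eq: "\<And>f. f \<in> carrier (dual_module R T) \<Longrightarrow> f s = f t"
  shows "s = t"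
proof (rule vol_cancel[OF module_T assms(1,2)])
  fix u v w assume uvw: "u \<in> carrier T" "v \<in> carrier T" "w \<in> carrier T"
  have "vol s x y = vol t x y" if "x \<in> carrier T" "y \<in> carrier T" for x y
    using eq[OF vec_prod_closed[OF that]] assms(1,2) that vol_cycle[of s x y] vol_cycle[of t x y]
    by (simp add: vec_prod_apply)
  then show "vol u v w \<odot>\<^bsub>T\<^esub> s = vol u v w \<odot>\<^bsub>T\<^esub> t"
    using cramer[OF assms(1) uvw] cramer[OF assms(2) uvw] uvw by simp
qed

text \<open>
  Injectivity is \<open>dual_separates\<close>. For surjectivity it suffices to find a preimage of \<open>[u, v, w] \<Xi>\<close>, and
  applying \<open>\<Xi>\<close> to the dual Cramer rule shows which vector it is.
\<close>

lemma bidual_eval_bij: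
  "bij_betw (bidual_eval R T) (carrier T) (carrier (dual_module R (dual_module R T)))"
proof -
  let ?D = "dual_module R T"
  let ?DD = "dual_module R ?D"
  let ?x = "vec_prod R T \<alpha>"
  have modDD: "module R ?DD" by (intro module_dual_module module_T)
  interpret D: module R ?D by (rule module_dual)
  note lin = bidual_eval_linear[OF module_T]
  have "\<Xi> \<in> bidual_eval R T ` carrier T" if \<Xi>: "\<Xi> \<in> carrier ?DD" for \<Xi>
  proof (rule local_membership[where n = 1, OF modDD submodule_image[OF module_T modDD lin] \<Xi>])
    fix u v w assume uvw: "u \<in> carrier T" "v \<in> carrier T" "w \<in> carrier T"
    have D: "?x v w \<in> carrier ?D" "?x w u \<in> carrier ?D" "?x u v \<in> carrier ?D"
      using uvw by (simp_all add: vec_prod_closed)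
    note \<Xi>R = dual_closed[OF \<Xi>] and \<Xi>lin = dual_lin[OF \<Xi>]
    define t where "t = \<Xi> (?x v w) \<odot>\<^bsub>T\<^esub> u \<oplus>\<^bsub>T\<^esub> \<Xi> (?x w u) \<odot>\<^bsub>T\<^esub> v \<oplus>\<^bsub>T\<^esub> \<Xi> (?x u v) \<odot>\<^bsub>T\<^esub> w"
    have t: "t \<in> carrier T" using uvw D \<Xi>R by (simp add: t_def)
    have "vol u v w \<odot>\<^bsub>?DD\<^esub> \<Xi> = bidual_eval R T t"
    proof (rule dual_eqI[where R = R and M = ?D])
      show "vol u v w \<odot>\<^bsub>?DD\<^esub> \<Xi> \<in> carrier ?DD"
        using uvw \<Xi> by (intro module.smult_closed[OF modDD]) simp_all
      show "bidual_eval R T t \<in> carrier ?DD" by (rule lin_maps_closed[OF lin t])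
      fix f assume f: "f \<in> carrier ?D"
      have fT: "f u \<in> carrier R" "f v \<in> carrier R" "f w \<in> carrier R"
        using uvw dual_closed[OF f] by simp_all
      have "(vol u v w \<odot>\<^bsub>?DD\<^esub> \<Xi>) f = \<Xi> (vol u v w \<odot>\<^bsub>?D\<^esub> f)"
        using uvw f by (simp add: dual_smult_apply lin_maps_smult[OF \<Xi>lin])
      also have "\<dots> = f u \<otimes>\<^bsub>R\<^esub> \<Xi> (?x v w) \<oplus>\<^bsub>R\<^esub> f v \<otimes>\<^bsub>R\<^esub> \<Xi> (?x w u) \<oplus>\<^bsub>R\<^esub> f w \<otimes>\<^bsub>R\<^esub> \<Xi> (?x u v)"
        using fT D by (simp add: cramer_dual[OF f uvw] lin_maps_add[OF \<Xi>lin] lin_maps_smult[OF \<Xi>lin])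
      also have "\<dots> = f t"
        using uvw D fT \<Xi>R
        by (simp add: t_def lin_maps_add[OF dual_lin[OF f]] lin_maps_smult[OF dual_lin[OF f]] R.m_comm)
      finally show "(vol u v w \<odot>\<^bsub>?DD\<^esub> \<Xi>) f = bidual_eval R T t f"
        using f by (simp add: bidual_eval_apply)
    qed
    then show "(vol u v w [^]\<^bsub>R\<^esub> (1::nat)) \<odot>\<^bsub>?DD\<^esub> \<Xi> \<in> bidual_eval R T ` carrier T"
      using uvw t by simp
  qed
  moreover have "inj_on (bidual_eval R T) (carrier T)"
  proof (rule inj_onI)
    fix s t assume st: "s \<in> carrier T" "t \<in> carrier T" "bidual_eval R T s = bidual_eval R T t"
    show "s = t"
    proof (rule dual_separates[OF st(1,2)])
      fix f assume "f \<in> carrier ?D"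
      then show "f s = f t" using fun_cong[OF st(3), of f] by (simp add: bidual_eval_apply)
    qed
  qed
  ultimately show ?thesis using lin_maps_closed[OF lin] by (auto simp: bij_betw_def)
qed

text \<open>
  The dual vector product is defined through the inverse of the evaluation map, so surjectivity of
  that map is what gives it its characteristic property.
\<close>

lemma dual_vec_prod:
  assumes f: "f \<in> carrier (dual_module R T)" and g: "g \<in> carrier (dual_module R T)"
  shows dual_vec_prod_closed: "dual_vec_prod R T \<alpha> f g \<in> carrier T"
    and dual_vec_prod_apply: "h \<in> carrier (dual_module R T) \<Longrightarrow> h (dual_vec_prod R T \<alpha> f g)
      = volume_module.vol R (dual_module R T) (dual_vol R T \<alpha>) f g h"
proof -
  let ?D = "dual_module R T"
  interpret D: volume_module R ?D "dual_vol R T \<alpha>" by (rule volume_module_dual)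
  have im: "vec_prod R ?D (dual_vol R T \<alpha>) f g \<in> bidual_eval R T ` carrier T"
    using D.vec_prod_closed[OF f g] bidual_eval_bij by (simp add: bij_betw_def)
  show "dual_vec_prod R T \<alpha> f g \<in> carrier T"
    unfolding dual_vec_prod_def by (rule inv_into_into[OF im])
  have eval: "bidual_eval R T (dual_vec_prod R T \<alpha> f g) = vec_prod R ?D (dual_vol R T \<alpha>) f g"
    unfolding dual_vec_prod_def by (rule f_inv_into_f[OF im])
  show "h (dual_vec_prod R T \<alpha> f g) = D.vol f g h" if "h \<in> carrier ?D"
    using fun_cong[OF eval, of h] that by (simp add: bidual_eval_apply D.vec_prod_apply)
qed

text \<open>
  Both sides are scalars whose product with \<open>\<beta>(f, g, h)\<close> is the determinant of the values of
  \<open>f, g, h\<close> at \<open>u, v, w\<close>: for the left-hand side it is the transposed determinant, by the defining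
  property of the form dual to \<open>\<beta>\<close>. Cancellation is legitimate because the dual with \<open>\<beta>\<close> is itself a
  module with a volume form.
\<close>

lemma vol_bidual:
  assumes uvw: "u \<in> carrier T" "v \<in> carrier T" "w \<in> carrier T"
  shows "volume_module.vol R (dual_module R (dual_module R T))
      (dual_vol R (dual_module R T) (dual_vol R T \<alpha>))
      (bidual_eval R T u) (bidual_eval R T v) (bidual_eval R T w) = vol u v w"
proof -
  let ?D = "dual_module R T"
  interpret D: volume_module R ?D "dual_vol R T \<alpha>" by (rule volume_module_dual)
  interpret DD: volume_module R "dual_module R ?D" "dual_vol R ?D (dual_vol R T \<alpha>)"
    by (rule D.volume_module_dual)
  let ?e = "bidual_eval R T"
  have e: "?e u \<in> carrier (dual_module R ?D)" "?e v \<in> carrier (dual_module R ?D)"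
    "?e w \<in> carrier (dual_module R ?D)"
    using uvw lin_maps_closed[OF bidual_eval_linear[OF module_T]] by simp_all
  show ?thesis
  proof (rule D.vol_cancel_R)
    fix f g h assume fgh: "f \<in> carrier ?D" "g \<in> carrier ?D" "h \<in> carrier ?D"
    have "D.vol f g h \<otimes>\<^bsub>R\<^esub> DD.vol (?e u) (?e v) (?e w) = pair_det R (?e u) (?e v) (?e w) f g h"
      by (rule D.vol_dual_vol[OF e fgh])
    also have "\<dots> = pair_det R (\<lambda>k. k u) (\<lambda>k. k v) (\<lambda>k. k w) f g h"
      using fgh by (simp add: pair_det_def bidual_eval_apply)
    also have "\<dots> = pair_det R f g h u v w"
      using uvw fgh by (intro pair_det_transpose[OF cring_R, symmetric]) (auto intro: dual_closed)
    also have "\<dots> = D.vol f g h \<otimes>\<^bsub>R\<^esub> vol u v w"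
      using vol_dual_vol[OF fgh uvw] uvw fgh by (simp add: R.m_comm)
    finally show "D.vol f g h \<otimes>\<^bsub>R\<^esub> DD.vol (?e u) (?e v) (?e w) = D.vol f g h \<otimes>\<^bsub>R\<^esub> vol u v w" .
  qed (use uvw e in simp_all)
qed

end

section \<open>Split colour algebras and their morphisms\<close>

lemma Col_simps:
  "carrier (Col R T \<alpha>) = carrier R \<times> carrier T \<times> carrier (dual_module R T)"
  "(a, u, f) \<otimes>\<^bsub>Col R T \<alpha>\<^esub> (b, v, g) =
     (a \<otimes>\<^bsub>R\<^esub> b \<oplus>\<^bsub>R\<^esub> g u \<oplus>\<^bsub>R\<^esub> f v,
      (a \<odot>\<^bsub>T\<^esub> v \<oplus>\<^bsub>T\<^esub> b \<odot>\<^bsub>T\<^esub> u) \<ominus>\<^bsub>T\<^esub> dual_vec_prod R T \<alpha> f g,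
      b \<odot>\<^bsub>dual_module R T\<^esub> f \<oplus>\<^bsub>dual_module R T\<^esub> a \<odot>\<^bsub>dual_module R T\<^esub> g
        \<oplus>\<^bsub>dual_module R T\<^esub> vec_prod R T \<alpha> u v)"
  "\<one>\<^bsub>Col R T \<alpha>\<^esub> = (\<one>\<^bsub>R\<^esub>, \<zero>\<^bsub>T\<^esub>, \<zero>\<^bsub>dual_module R T\<^esub>)"
  "(a, u, f) \<oplus>\<^bsub>Col R T \<alpha>\<^esub> (b, v, g) = (a \<oplus>\<^bsub>R\<^esub> b, u \<oplus>\<^bsub>T\<^esub> v, f \<oplus>\<^bsub>dual_module R T\<^esub> g)"
  "r \<odot>\<^bsub>Col R T \<alpha>\<^esub> (a, u, f) = (r \<otimes>\<^bsub>R\<^esub> a, r \<odot>\<^bsub>T\<^esub> u, r \<odot>\<^bsub>dual_module R T\<^esub> f)"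
  by (simp_all add: Col_def Let_def)

lemma alg_isosI:
  assumes "bij_betw h (carrier A) (carrier B)"
    and "\<And>x y. x \<in> carrier A \<Longrightarrow> y \<in> carrier A \<Longrightarrow> h (x \<oplus>\<^bsub>A\<^esub> y) = h x \<oplus>\<^bsub>B\<^esub> h y"
    and "\<And>x y. x \<in> carrier A \<Longrightarrow> y \<in> carrier A \<Longrightarrow> h (x \<otimes>\<^bsub>A\<^esub> y) = h x \<otimes>\<^bsub>B\<^esub> h y"
    and "\<And>r x. r \<in> carrier R \<Longrightarrow> x \<in> carrier A \<Longrightarrow> h (r \<odot>\<^bsub>A\<^esub> x) = r \<odot>\<^bsub>B\<^esub> h x"
    and "h \<one>\<^bsub>A\<^esub> = \<one>\<^bsub>B\<^esub>"
  shows "h \<in> alg_isos R A B"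
  using assms bij_betw_imp_funcset[OF assms(1)]
  unfolding alg_isos_def lin_isos_def lin_maps_def ring_iso_def ring_hom_def by blast

text \<open>
  The signs account for the minus sign in front of the dual vector product: vector products are
  bilinear, so negating both factors does not change them, whereas negating the result
  exchanges the roles of \<open>- f \<times> g\<close> and \<open>u \<times> v\<close>.
\<close>

lemma (in volume_module) Col_bidual_iso:
  "(\<lambda>(a, u, f). (a, \<ominus>\<^bsub>dual_module R T\<^esub> f,
       \<ominus>\<^bsub>dual_module R (dual_module R T)\<^esub> bidual_eval R T u))
    \<in> alg_isos R (Col R T \<alpha>) (Col R (dual_module R T) (dual_vol R T \<alpha>))"
proof -
  let ?D = "dual_module R T"
  let ?DD = "dual_module R ?D"
  let ?\<beta> = "dual_vol R T \<alpha>"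
  let ?e = "bidual_eval R T"
  interpret D: volume_module R ?D ?\<beta> by (rule volume_module_dual)
  interpret DD: volume_module R ?DD "dual_vol R ?D ?\<beta>" by (rule D.volume_module_dual)
  note lin = bidual_eval_linear[OF module_T]
  note e = lin_maps_closed[OF lin]
  have vec_prod_neg: "vec_prod R ?D ?\<beta> (\<ominus>\<^bsub>?D\<^esub> f) (\<ominus>\<^bsub>?D\<^esub> g) = ?e (dual_vec_prod R T \<alpha> f g)"
    if fg: "f \<in> carrier ?D" "g \<in> carrier ?D" for f g
  proof (rule dual_eqI[where R = R and M = ?D])
    fix h assume h: "h \<in> carrier ?D"
    show "vec_prod R ?D ?\<beta> (\<ominus>\<^bsub>?D\<^esub> f) (\<ominus>\<^bsub>?D\<^esub> g) h = ?e (dual_vec_prod R T \<alpha> f g) h"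
      using fg h alternating3_neg_neg[OF D.module_T D.module_R D.vol_alternating fg h]
      by (simp add: D.vec_prod_apply bidual_eval_apply dual_vec_prod_apply)
  qed (use fg in \<open>simp_all add: D.vec_prod_closed e dual_vec_prod_closed\<close>)
  have dual_vec_prod_neg: "dual_vec_prod R ?D ?\<beta> (\<ominus>\<^bsub>?DD\<^esub> ?e u) (\<ominus>\<^bsub>?DD\<^esub> ?e v) = vec_prod R T \<alpha> u v"
    if uv: "u \<in> carrier T" "v \<in> carrier T" for u v
  proof (rule dual_eqI[where R = R and M = T])
    have neg: "\<ominus>\<^bsub>?DD\<^esub> ?e u \<in> carrier ?DD" "\<ominus>\<^bsub>?DD\<^esub> ?e v \<in> carrier ?DD" using uv e by simp_all
    show cl: "dual_vec_prod R ?D ?\<beta> (\<ominus>\<^bsub>?DD\<^esub> ?e u) (\<ominus>\<^bsub>?DD\<^esub> ?e v) \<in> carrier ?D"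
      by (rule D.dual_vec_prod_closed[OF neg])
    fix t assume t: "t \<in> carrier T"
    have "dual_vec_prod R ?D ?\<beta> (\<ominus>\<^bsub>?DD\<^esub> ?e u) (\<ominus>\<^bsub>?DD\<^esub> ?e v) t
      = ?e t (dual_vec_prod R ?D ?\<beta> (\<ominus>\<^bsub>?DD\<^esub> ?e u) (\<ominus>\<^bsub>?DD\<^esub> ?e v))"
      using cl by (simp add: bidual_eval_apply)
    also have "\<dots> = DD.vol (\<ominus>\<^bsub>?DD\<^esub> ?e u) (\<ominus>\<^bsub>?DD\<^esub> ?e v) (?e t)"
      by (rule D.dual_vec_prod_apply[OF neg e[OF t]])
    also have "\<dots> = DD.vol (?e u) (?e v) (?e t)"
      using uv t e by (intro alternating3_neg_neg[OF DD.module_T DD.module_R DD.vol_alternating])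
    finally show "dual_vec_prod R ?D ?\<beta> (\<ominus>\<^bsub>?DD\<^esub> ?e u) (\<ominus>\<^bsub>?DD\<^esub> ?e v) t = vec_prod R T \<alpha> u v t"
      using uv t by (simp add: vol_bidual vec_prod_apply)
  qed (rule vec_prod_closed[OF uv])
  let ?h = "\<lambda>(a, u, f). (a, \<ominus>\<^bsub>?D\<^esub> f, \<ominus>\<^bsub>?DD\<^esub> ?e u)"
  show ?thesis
  proof (rule alg_isosI)
    show "bij_betw ?h (carrier (Col R T \<alpha>)) (carrier (Col R ?D ?\<beta>))"
    proof (rule bij_betw_byWitness[where f' = "\<lambda>(a, f, \<Xi>).
        (a, inv_into (carrier T) ?e (\<ominus>\<^bsub>?DD\<^esub> \<Xi>), \<ominus>\<^bsub>?D\<^esub> f)"])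
      note inv = bij_betw_inv_into_left[OF bidual_eval_bij] bij_betw_inv_into_right[OF bidual_eval_bij]
      have inv_closed: "inv_into (carrier T) ?e \<Xi> \<in> carrier T" if "\<Xi> \<in> carrier ?DD" for \<Xi>
        using bidual_eval_bij that by (auto simp: bij_betw_def intro: inv_into_into)
      show "\<forall>x\<in>carrier (Col R T \<alpha>). (\<lambda>(a, f, \<Xi>).
        (a, inv_into (carrier T) ?e (\<ominus>\<^bsub>?DD\<^esub> \<Xi>), \<ominus>\<^bsub>?D\<^esub> f)) (?h x) = x"
        by (auto simp: Col_simps e inv)
      show "\<forall>x\<in>carrier (Col R ?D ?\<beta>). ?h ((\<lambda>(a, f, \<Xi>).
        (a, inv_into (carrier T) ?e (\<ominus>\<^bsub>?DD\<^esub> \<Xi>), \<ominus>\<^bsub>?D\<^esub> f)) x) = x"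
        by (auto simp: Col_simps inv)
      show "?h ` carrier (Col R T \<alpha>) \<subseteq> carrier (Col R ?D ?\<beta>)"
        by (auto simp: Col_simps e)
      show "(\<lambda>(a, f, \<Xi>). (a, inv_into (carrier T) ?e (\<ominus>\<^bsub>?DD\<^esub> \<Xi>), \<ominus>\<^bsub>?D\<^esub> f)) ` carrier (Col R ?D ?\<beta>)
        \<subseteq> carrier (Col R T \<alpha>)"
        by (auto simp: Col_simps inv_closed)
    qed
  next
    fix x y assume "x \<in> carrier (Col R T \<alpha>)" "y \<in> carrier (Col R T \<alpha>)"
    then obtain a u f b v g where x: "x = (a, u, f)" "a \<in> carrier R" "u \<in> carrier T" "f \<in> carrier ?D"
      and y: "y = (b, v, g)" "b \<in> carrier R" "v \<in> carrier T" "g \<in> carrier ?D"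
      by (auto simp: Col_simps)
    show "?h (x \<oplus>\<^bsub>Col R T \<alpha>\<^esub> y) = ?h x \<oplus>\<^bsub>Col R ?D ?\<beta>\<^esub> ?h y"
      using x y by (simp add: Col_simps lin_maps_add[OF lin] e D.M.minus_add DD.M.minus_add)
    have pair: "(\<ominus>\<^bsub>?DD\<^esub> ?e w) (\<ominus>\<^bsub>?D\<^esub> k) = k w" if "w \<in> carrier T" "k \<in> carrier ?D" for w k
      using that by (simp add: dual_neg_apply[OF module_dual] dual_neg_apply[OF module_T] e
          bidual_eval_apply dual_closed)
    have fg: "dual_vec_prod R T \<alpha> f g \<in> carrier T" "vec_prod R T \<alpha> u v \<in> carrier ?D"
      using x y by (simp_all add: dual_vec_prod_closed vec_prod_closed)
    have "a \<otimes>\<^bsub>R\<^esub> b \<oplus>\<^bsub>R\<^esub> g u \<oplus>\<^bsub>R\<^esub> f v = a \<otimes>\<^bsub>R\<^esub> b \<oplus>\<^bsub>R\<^esub> f v \<oplus>\<^bsub>R\<^esub> g u"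
      using x y by (simp add: dual_closed R.a_ac)
    moreover have "\<ominus>\<^bsub>?D\<^esub> (b \<odot>\<^bsub>?D\<^esub> f \<oplus>\<^bsub>?D\<^esub> a \<odot>\<^bsub>?D\<^esub> g \<oplus>\<^bsub>?D\<^esub> vec_prod R T \<alpha> u v)
      = (a \<odot>\<^bsub>?D\<^esub> (\<ominus>\<^bsub>?D\<^esub> g) \<oplus>\<^bsub>?D\<^esub> b \<odot>\<^bsub>?D\<^esub> (\<ominus>\<^bsub>?D\<^esub> f)) \<ominus>\<^bsub>?D\<^esub> vec_prod R T \<alpha> u v"
      using x y fg by (simp add: D.smult_r_minus D.M.minus_add D.M.a_ac a_minus_def)
    moreover have "\<ominus>\<^bsub>?DD\<^esub> ?e ((a \<odot>\<^bsub>T\<^esub> v \<oplus>\<^bsub>T\<^esub> b \<odot>\<^bsub>T\<^esub> u) \<ominus>\<^bsub>T\<^esub> dual_vec_prod R T \<alpha> f g)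
      = b \<odot>\<^bsub>?DD\<^esub> (\<ominus>\<^bsub>?DD\<^esub> ?e u) \<oplus>\<^bsub>?DD\<^esub> a \<odot>\<^bsub>?DD\<^esub> (\<ominus>\<^bsub>?DD\<^esub> ?e v) \<oplus>\<^bsub>?DD\<^esub> ?e (dual_vec_prod R T \<alpha> f g)"
      using x y fg
      by (simp add: lin_maps_neg[OF module_T DD.module_T lin] lin_maps_add[OF lin]
          lin_maps_smult[OF lin] e DD.smult_r_minus DD.M.minus_add DD.M.a_ac a_minus_def)
    ultimately show "?h (x \<otimes>\<^bsub>Col R T \<alpha>\<^esub> y) = ?h x \<otimes>\<^bsub>Col R ?D ?\<beta>\<^esub> ?h y"
      using x y by (simp add: Col_simps pair vec_prod_neg dual_vec_prod_neg)
  next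
    fix r x assume "r \<in> carrier R" "x \<in> carrier (Col R T \<alpha>)"
    then show "?h (r \<odot>\<^bsub>Col R T \<alpha>\<^esub> x) = r \<odot>\<^bsub>Col R ?D ?\<beta>\<^esub> ?h x"
      by (auto simp: Col_simps lin_maps_smult[OF lin] e D.smult_r_minus DD.smult_r_minus)
  next
    show "?h \<one>\<^bsub>Col R T \<alpha>\<^esub> = \<one>\<^bsub>Col R ?D ?\<beta>\<^esub>"
      by (simp add: Col_simps lin_maps_zero[OF module_T DD.module_T lin])
  qed
qed

text \<open>
  The universal property provides exactly one linear map with the values that define \<open>ext3_map\<close>.
\<close>

lemma ext3_map_wedge:
  assumes M: "module R M" and N: "module R N" and \<phi>: "\<phi> \<in> lin_maps R M N"
    and uvw: "u \<in> carrier M" "v \<in> carrier M" "w \<in> carrier M"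
  shows "ext3_map R M N \<phi> (wedge3 R M u v w) = wedge3 R N (\<phi> u) (\<phi> v) (\<phi> w)"
proof -
  note EM = module_ext3[OF M] and EN = module_ext3[OF N] and alt = wedge3_alternating[OF N]
  note cl = lin_maps_closed[OF \<phi>]
  define good where "good h \<longleftrightarrow> h \<in> lin_maps R (ext3 R M) (ext3 R N) \<and> h \<in> extensional (carrier (ext3 R M)) \<and>
       (\<forall>u\<in>carrier M. \<forall>v\<in>carrier M. \<forall>w\<in>carrier M.
          h (wedge3 R M u v w) = wedge3 R N (\<phi> u) (\<phi> v) (\<phi> w))" for h
  have "alternating3 R M (ext3 R N) (\<lambda>u v w. wedge3 R N (\<phi> u) (\<phi> v) (\<phi> w))"
    unfolding alternating3_def
    by (intro conjI ballI lin_maps_comp[OF \<phi> alternating3D(1)[OF alt]]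
        lin_maps_comp[OF \<phi> alternating3D(2)[OF alt]] lin_maps_comp[OF \<phi> alternating3D(3)[OF alt]]
        alternating3D(4,5)[OF alt] cl)
  then obtain h where h: "h \<in> lin_maps R (ext3 R M) (ext3 R N)"
    and hw: "\<And>u v w. u \<in> carrier M \<Longrightarrow> v \<in> carrier M \<Longrightarrow> w \<in> carrier M \<Longrightarrow>
      h (wedge3 R M u v w) = wedge3 R N (\<phi> u) (\<phi> v) (\<phi> w)"
    using ext3_lift[OF M EN] by blast
  define k where "k = restrict h (carrier (ext3 R M))"
  have k: "k \<in> lin_maps R (ext3 R M) (ext3 R N)"
    unfolding k_def by (rule lin_maps_cong[OF h EM]) simp
  have kw: "k (wedge3 R M u v w) = wedge3 R N (\<phi> u) (\<phi> v) (\<phi> w)"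
    if "u \<in> carrier M" "v \<in> carrier M" "w \<in> carrier M" for u v w
    using hw[OF that] wedge3_closed[OF M that] by (simp add: k_def)
  have "good k" unfolding good_def using k kw by (simp add: k_def)
  moreover have "k' = k" if "good k'" for k'
  proof (rule extensionalityI)
    show "k' \<in> extensional (carrier (ext3 R M))" "k \<in> extensional (carrier (ext3 R M))"
      using that by (simp_all add: good_def k_def)
    have k': "k' \<in> lin_maps R (ext3 R M) (ext3 R N)" using that by (simp add: good_def)
    fix \<xi> assume \<xi>: "\<xi> \<in> carrier (ext3 R M)"
    show "k' \<xi> = k \<xi>"
      by (rule ext3_linear_eq[OF M EN k' k _ \<xi>]) (use that in \<open>simp add: good_def kw\<close>)
  qed
  ultimately have "ext3_map R M N \<phi> = k"
    unfolding ext3_map_def good_def by (intro the_equality) blast+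
  then show ?thesis using kw[OF uvw] by simp
qed

locale volume_morphism = dom: volume_module R T \<alpha> + cod: volume_module R T' \<alpha>'
  for R :: "('a, 'm) ring_scheme" (structure)
    and T :: "('a, 'b, 'p) module_scheme" and \<alpha> :: "('b \<times> 'b \<times> 'b \<Rightarrow> 'a) set \<Rightarrow> 'a"
    and T' :: "('a, 'c, 'q) module_scheme" and \<alpha>' :: "('c \<times> 'c \<times> 'c \<Rightarrow> 'a) set \<Rightarrow> 'a" +
  fixes \<phi> :: "'b \<Rightarrow> 'c"
  assumes morphism: "\<phi> \<in> vol_morphisms R T \<alpha> T' \<alpha>'"
begin

lemma linear: "\<phi> \<in> lin_maps R T T'"
  using morphism by (simp add: vol_morphisms_def)

lemma closed [simp]: "u \<in> carrier T \<Longrightarrow> \<phi> u \<in> carrier T'"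
  by (rule lin_maps_closed[OF linear])

lemma vol_image:
  assumes "u \<in> carrier T" "v \<in> carrier T" "w \<in> carrier T"
  shows "cod.vol (\<phi> u) (\<phi> v) (\<phi> w) = dom.vol u v w"
  using morphism wedge3_closed[OF dom.module_T assms]
    ext3_map_wedge[OF dom.module_T cod.module_T linear assms]
  unfolding vol_morphisms_def dom.vol_def cod.vol_def by fastforce

text \<open>
  Both halves are Cramer's rule. If \<open>\<phi> s = \<phi> t\<close>, then \<open>s\<close> and \<open>t\<close> have the same coefficients with
  respect to any \<open>u, v, w\<close>; and for \<open>y\<close> in the codomain, the rule with \<open>\<phi> u, \<phi> v, \<phi> w\<close> shows that
  \<open>[u, v, w] y\<close> lies in the image of \<open>\<phi>\<close>.
\<close>

lemma bij: "bij_betw \<phi> (carrier T) (carrier T')"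
proof -
  have "inj_on \<phi> (carrier T)"
  proof (rule inj_onI)
    fix s t assume st: "s \<in> carrier T" "t \<in> carrier T" "\<phi> s = \<phi> t"
    show "s = t"
    proof (rule dom.vol_cancel[OF dom.module_T st(1,2)])
      fix u v w assume uvw: "u \<in> carrier T" "v \<in> carrier T" "w \<in> carrier T"
      have "dom.vol s x y = dom.vol t x y" if "x \<in> carrier T" "y \<in> carrier T" for x y
        using vol_image[OF st(1) that] vol_image[OF st(2) that] st(3) by simp
      then show "dom.vol u v w \<odot>\<^bsub>T\<^esub> s = dom.vol u v w \<odot>\<^bsub>T\<^esub> t"
        using dom.cramer[OF st(1) uvw] dom.cramer[OF st(2) uvw] uvw by simp
    qed
  qed
  moreover have "y \<in> \<phi> ` carrier T" if y: "y \<in> carrier T'" for y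
  proof (rule dom.local_membership[where n = 1, OF cod.module_T
        submodule_image[OF dom.module_T cod.module_T linear] y])
    fix u v w assume uvw: "u \<in> carrier T" "v \<in> carrier T" "w \<in> carrier T"
    define c where "c x x' = cod.vol y (\<phi> x) (\<phi> x')" for x x'
    have c: "c x x' \<in> carrier R" if "x \<in> carrier T" "x' \<in> carrier T" for x x'
      using that y by (simp add: c_def)
    have "dom.vol u v w \<odot>\<^bsub>T'\<^esub> y = c v w \<odot>\<^bsub>T'\<^esub> \<phi> u \<oplus>\<^bsub>T'\<^esub> c w u \<odot>\<^bsub>T'\<^esub> \<phi> v \<oplus>\<^bsub>T'\<^esub> c u v \<odot>\<^bsub>T'\<^esub> \<phi> w"
      using cod.cramer[OF y closed[OF uvw(1)] closed[OF uvw(2)] closed[OF uvw(3)]] uvw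
      by (simp add: vol_image c_def)
    also have "\<dots> = \<phi> (c v w \<odot>\<^bsub>T\<^esub> u \<oplus>\<^bsub>T\<^esub> c w u \<odot>\<^bsub>T\<^esub> v \<oplus>\<^bsub>T\<^esub> c u v \<odot>\<^bsub>T\<^esub> w)"
      using uvw c by (simp add: lin_maps_add[OF linear] lin_maps_smult[OF linear])
    also have "\<dots> \<in> \<phi> ` carrier T" using uvw c by (intro imageI) simp
    finally show "(dom.vol u v w [^]\<^bsub>R\<^esub> (1::nat)) \<odot>\<^bsub>T'\<^esub> y \<in> \<phi> ` carrier T" using uvw by simp
  qed
  ultimately show ?thesis by (auto simp: bij_betw_def)
qed

lemma transpose_closed:
  "g \<in> carrier (dual_module R T') \<Longrightarrow> transpose_map T \<phi> g \<in> carrier (dual_module R T)"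
  unfolding transpose_map_def
  by (intro restrict_in_dual[OF dom.module_T] lin_maps_comp[OF linear] dual_lin)

lemma transpose_apply: "u \<in> carrier T \<Longrightarrow> transpose_map T \<phi> g u = g (\<phi> u)"
  by (simp add: transpose_map_def)

lemma dual_eq_on_image:
  assumes "g \<in> carrier (dual_module R T')" "h \<in> carrier (dual_module R T')"
    and "\<And>u. u \<in> carrier T \<Longrightarrow> g (\<phi> u) = h (\<phi> u)"
  shows "g = h"
proof (rule dual_eqI[OF assms(1,2)])
  fix x assume "x \<in> carrier T'"
  then obtain u where "u \<in> carrier T" "x = \<phi> u" using bij by (auto simp: bij_betw_def)
  then show "g x = h x" using assms(3) by simp
qed

lemma transpose_bij:
  "bij_betw (transpose_map T \<phi>) (carrier (dual_module R T')) (carrier (dual_module R T))"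
proof -
  have "inj_on (transpose_map T \<phi>) (carrier (dual_module R T'))"
    by (intro inj_onI dual_eq_on_image) (simp_all add: transpose_apply[symmetric])
  moreover have "f \<in> transpose_map T \<phi> ` carrier (dual_module R T')"
    if f: "f \<in> carrier (dual_module R T)" for f
  proof
    let ?i = "inv_into (carrier T) \<phi>"
    have i: "?i (\<phi> u) = u" if "u \<in> carrier T" for u
      using that bij by (simp add: bij_betw_inv_into_left)
    have surj: "\<exists>u\<in>carrier T. x = \<phi> u" if "x \<in> carrier T'" for x
      using that bij by (auto simp: bij_betw_def)
    have "(\<lambda>x. f (?i x)) \<in> lin_maps R T' (reg_module R)"
    proof (rule lin_mapsI)
      fix x y assume "x \<in> carrier T'" "y \<in> carrier T'"
      then obtain u v where "u \<in> carrier T" "x = \<phi> u" "v \<in> carrier T" "y = \<phi> v" using surj by blast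
      then show "f (?i (x \<oplus>\<^bsub>T'\<^esub> y)) = f (?i x) \<oplus>\<^bsub>reg_module R\<^esub> f (?i y)"
        by (simp add: lin_maps_add[OF linear, symmetric] i lin_maps_add[OF dual_lin[OF f]])
    next
      fix r x assume "r \<in> carrier R" "x \<in> carrier T'"
      then obtain u where "r \<in> carrier R" "u \<in> carrier T" "x = \<phi> u" using surj by blast
      then show "f (?i (r \<odot>\<^bsub>T'\<^esub> x)) = r \<odot>\<^bsub>reg_module R\<^esub> f (?i x)"
        by (simp add: lin_maps_smult[OF linear, symmetric] i lin_maps_smult[OF dual_lin[OF f]])
    qed (use surj i dual_closed[OF f] in fastforce)
    then show g: "(\<lambda>x\<in>carrier T'. f (?i x)) \<in> carrier (dual_module R T')"
      by (rule restrict_in_dual[OF cod.module_T])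
    show "f = transpose_map T \<phi> (\<lambda>x\<in>carrier T'. f (?i x))"
      by (rule dual_eqI[OF f transpose_closed[OF g]]) (simp add: transpose_apply i)
  qed
  ultimately show ?thesis using transpose_closed by (auto simp: bij_betw_def)
qed

abbreviation contragredient :: "('b \<Rightarrow> 'a) \<Rightarrow> 'c \<Rightarrow> 'a"
  where "contragredient \<equiv> inv_into (carrier (dual_module R T')) (transpose_map T \<phi>)"

lemma contragredient_closed:
  "f \<in> carrier (dual_module R T) \<Longrightarrow> contragredient f \<in> carrier (dual_module R T')"
  using transpose_bij by (auto simp: bij_betw_def intro: inv_into_into)

lemma contragredient_apply:
  assumes "f \<in> carrier (dual_module R T)" "u \<in> carrier T"
  shows "contragredient f (\<phi> u) = f u"
  using bij_betw_inv_into_right[OF transpose_bij assms(1)] transpose_apply[OF assms(2)] by metis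

lemma contragredient_eqI:
  assumes "f \<in> carrier (dual_module R T)" "g \<in> carrier (dual_module R T')"
    and "\<And>u. u \<in> carrier T \<Longrightarrow> f u = g (\<phi> u)"
  shows "contragredient f = g"
  using assms by (intro dual_eq_on_image) (simp_all add: contragredient_closed contragredient_apply)

lemma contragredient_linear:
  "contragredient \<in> lin_maps R (dual_module R T) (dual_module R T')"
proof -
  interpret D: module R "dual_module R T" by (rule dom.module_dual)
  interpret D': module R "dual_module R T'" by (rule cod.module_dual)
  show ?thesis
    by (intro lin_mapsI contragredient_eqI)
      (simp_all add: contragredient_closed contragredient_apply dual_add_apply dual_smult_apply)
qed

lemma contragredient_vec_prod:
  assumes "u \<in> carrier T" "v \<in> carrier T"
  shows "contragredient (vec_prod R T \<alpha> u v) = vec_prod R T' \<alpha>' (\<phi> u) (\<phi> v)"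
  using assms
  by (intro contragredient_eqI)
    (simp_all add: dom.vec_prod_closed cod.vec_prod_closed dom.vec_prod_apply cod.vec_prod_apply vol_image)

text \<open>
  Test both sides with a functional \<open>h\<close>. This leaves the equality of the two dual forms at
  \<open>f, g, h \<circ> \<phi>\<close> and at the corresponding functionals on the codomain. They agree because \<open>\<phi>\<close>
  preserves the volume and the matrices of values are the same.
\<close>

lemma dual_vec_prod_image:
  assumes f: "f \<in> carrier (dual_module R T)" and g: "g \<in> carrier (dual_module R T)"
  shows "\<phi> (dual_vec_prod R T \<alpha> f g) = dual_vec_prod R T' \<alpha>' (contragredient f) (contragredient g)"
proof (rule cod.dual_separates)
  interpret D: volume_module R "dual_module R T" "dual_vol R T \<alpha>" by (rule dom.volume_module_dual)
  interpret D': volume_module R "dual_module R T'" "dual_vol R T' \<alpha>'" by (rule cod.volume_module_dual)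
  let ?c = contragredient
  note c = contragredient_closed[OF f] contragredient_closed[OF g]
  show "\<phi> (dual_vec_prod R T \<alpha> f g) \<in> carrier T'"
    by (intro closed dom.dual_vec_prod_closed f g)
  show "dual_vec_prod R T' \<alpha>' (?c f) (?c g) \<in> carrier T'"
    by (intro cod.dual_vec_prod_closed c)
  fix h assume h: "h \<in> carrier (dual_module R T')"
  let ?h = "transpose_map T \<phi> h"
  have h': "?h \<in> carrier (dual_module R T)" by (rule transpose_closed[OF h])
  have "D.vol f g ?h = D'.vol (?c f) (?c g) h"
  proof (rule dom.vol_cancel_R)
    fix u v w assume uvw: "u \<in> carrier T" "v \<in> carrier T" "w \<in> carrier T"
    have "dom.vol u v w \<otimes>\<^bsub>R\<^esub> D.vol f g ?h = pair_det R f g ?h u v w"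
      by (rule dom.vol_dual_vol[OF f g h' uvw])
    also have "\<dots> = pair_det R (?c f) (?c g) h (\<phi> u) (\<phi> v) (\<phi> w)"
      using uvw f g by (simp add: pair_det_def contragredient_apply transpose_apply)
    also have "\<dots> = cod.vol (\<phi> u) (\<phi> v) (\<phi> w) \<otimes>\<^bsub>R\<^esub> D'.vol (?c f) (?c g) h"
      using uvw by (intro cod.vol_dual_vol[symmetric] c h closed)
    finally show "dom.vol u v w \<otimes>\<^bsub>R\<^esub> D.vol f g ?h = dom.vol u v w \<otimes>\<^bsub>R\<^esub> D'.vol (?c f) (?c g) h"
      using uvw by (simp add: vol_image)
  qed (use f g h h' c in simp_all)
  then show "h (\<phi> (dual_vec_prod R T \<alpha> f g)) = h (dual_vec_prod R T' \<alpha>' (?c f) (?c g))"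
    using dom.dual_vec_prod_apply[OF f g h'] cod.dual_vec_prod_apply[OF c h]
      transpose_apply[OF dom.dual_vec_prod_closed[OF f g]] by simp
qed

lemma Col_iso:
  "(\<lambda>(a, u, f). (a, \<phi> u, contragredient f)) \<in> alg_isos R (Col R T \<alpha>) (Col R T' \<alpha>')"
    (is "?h \<in> _")
proof -
  let ?D = "dual_module R T" and ?D' = "dual_module R T'" and ?c = contragredient
  interpret D: module R ?D by (rule dom.module_dual)
  interpret D': module R ?D' by (rule cod.module_dual)
  note c = contragredient_closed and lin = contragredient_linear
  show ?thesis
  proof (rule alg_isosI)
    have "bij_betw ?c (carrier ?D) (carrier ?D')"
      by (rule bij_betw_inv_into[OF transpose_bij])
    then have "bij_betw (map_prod id (map_prod \<phi> ?c)) (carrier R \<times> carrier T \<times> carrier ?D)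
      (carrier R \<times> carrier T' \<times> carrier ?D')"
      by (intro bij_betw_map_prod bij bij_betw_id)
    moreover have "?h = map_prod id (map_prod \<phi> ?c)" by auto
    ultimately show "bij_betw ?h (carrier (Col R T \<alpha>)) (carrier (Col R T' \<alpha>'))"
      by (simp add: Col_simps)
  next
    fix x y assume "x \<in> carrier (Col R T \<alpha>)" "y \<in> carrier (Col R T \<alpha>)"
    then obtain a u f b v g where x: "x = (a, u, f)" "a \<in> carrier R" "u \<in> carrier T" "f \<in> carrier ?D"
      and y: "y = (b, v, g)" "b \<in> carrier R" "v \<in> carrier T" "g \<in> carrier ?D"
      by (auto simp: Col_simps)
    show "?h (x \<oplus>\<^bsub>Col R T \<alpha>\<^esub> y) = ?h x \<oplus>\<^bsub>Col R T' \<alpha>'\<^esub> ?h y"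
      using x y by (simp add: Col_simps lin_maps_add[OF linear] lin_maps_add[OF lin])
    show "?h (x \<otimes>\<^bsub>Col R T \<alpha>\<^esub> y) = ?h x \<otimes>\<^bsub>Col R T' \<alpha>'\<^esub> ?h y"
      using x y dom.dual_vec_prod_closed[OF x(4) y(4)] dom.vec_prod_closed[OF x(3) y(3)]
      by (simp add: Col_simps contragredient_apply lin_maps_minus[OF dom.module_T cod.module_T linear]
          lin_maps_add[OF linear] lin_maps_smult[OF linear] lin_maps_add[OF lin] lin_maps_smult[OF lin]
          dual_vec_prod_image contragredient_vec_prod)
  next
    fix r x assume "r \<in> carrier R" "x \<in> carrier (Col R T \<alpha>)"
    then show "?h (r \<odot>\<^bsub>Col R T \<alpha>\<^esub> x) = r \<odot>\<^bsub>Col R T' \<alpha>'\<^esub> ?h x"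
      by (auto simp: Col_simps lin_maps_smult[OF linear] lin_maps_smult[OF lin])
  next
    show "?h \<one>\<^bsub>Col R T \<alpha>\<^esub> = \<one>\<^bsub>Col R T' \<alpha>'\<^esub>"
      by (simp add: Col_simps lin_maps_zero[OF dom.module_T cod.module_T linear]
          lin_maps_zero[OF dom.module_dual cod.module_dual lin])
  qed
qed

end

theorem proposition2p1:
  fixes R :: "('a, 'm) ring_scheme"
    and T :: "('a, 'b, 'p) module_scheme" and T' :: "('a, 'c, 'q) module_scheme"
    and \<alpha> :: "('b \<times> 'b \<times> 'b \<Rightarrow> 'a) set \<Rightarrow> 'a"
    and \<alpha>' :: "('c \<times> 'c \<times> 'c \<Rightarrow> 'a) set \<Rightarrow> 'a"
  assumes "cring R" and "\<one>\<^bsub>R\<^esub> \<oplus>\<^bsub>R\<^esub> \<one>\<^bsub>R\<^esub> \<in> Units R"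
    and "fg_projective R T" and "constant_rank R T 3"
    and "fg_projective R T'" and "constant_rank R T' 3"
    and "\<alpha> \<in> lin_isos R (ext3 R T) (reg_module R)"
    and "\<alpha>' \<in> lin_isos R (ext3 R T') (reg_module R)"
  shows "(\<forall>\<phi> \<in> vol_morphisms R T \<alpha> T' \<alpha>'.
       (\<lambda>(a, u, f). (a, \<phi> u, inv_into (carrier (dual_module R T')) (transpose_map T \<phi>) f))
         \<in> alg_isos R (Col R T \<alpha>) (Col R T' \<alpha>')) \<and>
    (\<lambda>(a, u, f). (a, \<ominus>\<^bsub>dual_module R T\<^esub> f,
         \<ominus>\<^bsub>dual_module R (dual_module R T)\<^esub> bidual_eval R T u))
      \<in> alg_isos R (Col R T \<alpha>) (Col R (dual_module R T) (dual_vol R T \<alpha>))"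
proof (intro conjI ballI)
  have dom: "volume_module R T \<alpha>" and cod: "volume_module R T' \<alpha>'"
    using assms by (auto simp: fg_projective_def volume_module_def volume_module_axioms_def)
  then show "(\<lambda>(a, u, f). (a, \<phi> u, inv_into (carrier (dual_module R T')) (transpose_map T \<phi>) f))
         \<in> alg_isos R (Col R T \<alpha>) (Col R T' \<alpha>')" if "\<phi> \<in> vol_morphisms R T \<alpha> T' \<alpha>'" for \<phi>
    using that
    by (intro volume_morphism.Col_iso volume_morphism.intro volume_morphism_axioms.intro)
  show "(\<lambda>(a, u, f). (a, \<ominus>\<^bsub>dual_module R T\<^esub> f,
         \<ominus>\<^bsub>dual_module R (dual_module R T)\<^esub> bidual_eval R T u))
      \<in> alg_isos R (Col R T \<alpha>) (Col R (dual_module R T) (dual_vol R T \<alpha>))"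
    by (rule volume_module.Col_bidual_iso[OF dom])
qed

end
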